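(* Let $d\in\mathbb{N}$, let $a<b$ be real numbers, let $P_1=P_1^*\in\mathbb{R}^{d\times d}$ be invertible, $P_0=-P_0^*\in\mathbb{R}^{d\times d}$, and let $\mathcal{H}\colon(a,b)\to\mathbb{R}^{d\times d}$ be measurable such that there are $m,M_0>0$ with $m\le \mathcal{H}(x)=\mathcal{H}(x)^*\le M_0$ for all $x\in(a,b)$. Let $H$ be the Hilbert space $L_2(a,b)^d$ with inner product $\langle u,v\rangle_H=\langle\mathcal{H}u,v\rangle_{L_2}$ and let $\mathcal{A}\colon\operatorname{dom}(\mathcal{A})\subseteq H\to H$ be a linear operator of the form $\mathcal{A}u=P_1(\mathcal{H}u)'+P_0\mathcal{H}u$ whose domain satisfies $$\{u\in H\,;\ \mathcal{H}u\in H_0^1(a,b)^d\}\subseteq\operatorname{dom}(\mathcal{A})\subseteq\{u\in H\,;\ \mathcal{H}u\in H^1(a,b)^d\}.$$ For $t\in\mathbb{R}$ let $\Phi_t\colon[a,b]\to\mathbb{C}^{d\times d}$ be the fundamental solution of $u'(x)=P_1^{-1}(\mathrm{i}t\mathcal{H}(x)^{-1}-P_0)u(x)$ $(x\in(a,b))$ with $\Phi_t(a)=1_d$, and assume that $\sup_{t\in\mathbb{R}}\sup_{x\in(a,b)}\|\Phi_t(x)\|<\infty$. Assume that $\mathcal{A}$ generates a contraction semigroup. If there exist $c>0$ and $\eta\in\{a,b\}$ such that for all $u\in\operatorname{dom}(\mathcal{A})$ $$\langle u,\mathcal{A}u\rangle_H\le -c\|(\mathcal{H}u)(\eta)\|^2,$$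 then $\mathcal{A}$ generates an exponentially stable $C_0$-semigroup.
   Context: $1_d$ is the $d\times d$ identity matrix. $L_2(a,b)^d$, $H^1(a,b)^d$, $H^1_0(a,b)^d$ consist of $\mathbb{R}^d$-valued functions; derivatives are weak derivatives, and point evaluations of $H^1$ functions refer to the continuous representative on $[a,b]$. Inequalities between matrices are in the sense of positive (semi-)definiteness. A $C_0$-semigroup $(S(t))_{t\ge0}$ is exponentially stable if there are $C\ge1$, $\omega>0$ with $\|S(t)\|\le C\mathrm{e}^{-\omega t}$ for all $t\ge0$. The fundamental solution $\Phi_t$ is the matrix-valued (absolutely continuous) solution of the ODE with the stated initial value. *)

theory Defs
  imports "HOL-Analysis.Analysis"
begin

section \<open>The space \<open>L\<^sub>2\<close> and its subspaces \<open>L\<^sub>2(a,b)\<close>\<close>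

definition square_integrable :: "(real \<Rightarrow> 'b::euclidean_space) \<Rightarrow> bool" where
  "square_integrable f \<longleftrightarrow>
     f \<in> borel_measurable lebesgue \<and> integrable lebesgue (\<lambda>x. (norm (f x))\<^sup>2)"

definition L2_rel :: "(real \<Rightarrow> 'b::euclidean_space) \<Rightarrow> (real \<Rightarrow> 'b) \<Rightarrow> bool" where
  "L2_rel f g \<longleftrightarrow>
     square_integrable f \<and> square_integrable g \<and> (AE x in lebesgue. f x = g x)"

lemma square_integrable_0: "square_integrable (\<lambda>_. 0)"
  by (simp add: square_integrable_def)

lemma square_integrable_scaleR:
  assumes "square_integrable f" shows "square_integrable (\<lambda>x. r *\<^sub>R f x)"
  using assms by (auto simp: square_integrable_def power_mult_distrib)

lemma square_integrable_add:
  assumes "square_integrable f" "square_integrable g"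
  shows "square_integrable (\<lambda>x. f x + g x)"
proof -
  have [measurable]: "f \<in> borel_measurable lebesgue" "g \<in> borel_measurable lebesgue"
    using assms by (auto simp: square_integrable_def)
  have "integrable lebesgue (\<lambda>x. (norm (f x + g x))\<^sup>2)"
  proof (rule Bochner_Integration.integrable_bound)
    show "integrable lebesgue (\<lambda>x. 2 * (norm (f x))\<^sup>2 + 2 * (norm (g x))\<^sup>2)"
      using assms by (auto simp: square_integrable_def)
    have "(norm (u + v))\<^sup>2 \<le> 2 * (norm u)\<^sup>2 + 2 * (norm v)\<^sup>2" for u v :: 'a
    proof -
      have "(norm (u + v))\<^sup>2 \<le> (norm u + norm v)\<^sup>2"
        by (intro power_mono norm_triangle_ineq) simp
      also have "\<dots> \<le> 2 * (norm u)\<^sup>2 + 2 * (norm v)\<^sup>2"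
        using sum_squares_bound[of "norm u" "norm v"] by (simp add: power2_sum)
      finally show ?thesis .
    qed
    then show "AE x in lebesgue. norm ((norm (f x + g x))\<^sup>2)
        \<le> norm (2 * (norm (f x))\<^sup>2 + 2 * (norm (g x))\<^sup>2)"
      by (auto simp: abs_of_nonneg)
  qed measurable
  then show ?thesis
    by (simp add: square_integrable_def)
qed

lemma square_integrable_uminus:
  "square_integrable f \<Longrightarrow> square_integrable (\<lambda>x. - f x)"
  using square_integrable_scaleR[of f "-1"] by simp

lemma square_integrable_diff:
  "square_integrable f \<Longrightarrow> square_integrable g \<Longrightarrow> square_integrable (\<lambda>x. f x - g x)"
  using square_integrable_add[OF _ square_integrable_uminus, of f g] by simp

lemma square_integrable_inner:
  assumes "square_integrable f" "square_integrable g"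
  shows "integrable lebesgue (\<lambda>x. f x \<bullet> g x)"
proof -
  have [measurable]: "f \<in> borel_measurable lebesgue" "g \<in> borel_measurable lebesgue"
    using assms by (auto simp: square_integrable_def)
  show ?thesis
  proof (rule Bochner_Integration.integrable_bound)
    show "integrable lebesgue (\<lambda>x. (norm (f x))\<^sup>2 + (norm (g x))\<^sup>2)"
      using assms by (auto simp: square_integrable_def)
    have "\<bar>u \<bullet> v\<bar> \<le> (norm u)\<^sup>2 + (norm v)\<^sup>2" for u v :: 'a
    proof -
      have "\<bar>u \<bullet> v\<bar> \<le> norm u * norm v"
        by (rule Cauchy_Schwarz_ineq2)
      also have "\<dots> \<le> 2 * norm u * norm v"
        by simp
      also have "\<dots> \<le> (norm u)\<^sup>2 + (norm v)\<^sup>2"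
        by (rule sum_squares_bound)
      finally show ?thesis .
    qed
    then show "AE x in lebesgue. norm (f x \<bullet> g x) \<le> norm ((norm (f x))\<^sup>2 + (norm (g x))\<^sup>2)"
      by auto
  qed measurable
qed

quotient_type (overloaded) 'b L2 = "real \<Rightarrow> 'b::euclidean_space" / partial: L2_rel
proof (rule part_equivpI)
  show "\<exists>f. L2_rel f f"
    using square_integrable_0 unfolding L2_rel_def by blast
  show "symp L2_rel"
    by (auto simp: L2_rel_def symp_def eq_commute)
  show "transp L2_rel"
    by (auto simp: L2_rel_def transp_def elim: AE_mp)
qed

instantiation L2 :: (euclidean_space) real_inner
begin

lift_definition zero_L2 :: "'a L2" is "\<lambda>_. 0"
  by (simp add: L2_rel_def square_integrable_0)

lift_definition plus_L2 :: "'a L2 \<Rightarrow> 'a L2 \<Rightarrow> 'a L2" is "\<lambda>f g x. f x + g x"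
  by (auto simp: L2_rel_def square_integrable_add)

lift_definition minus_L2 :: "'a L2 \<Rightarrow> 'a L2 \<Rightarrow> 'a L2" is "\<lambda>f g x. f x - g x"
  by (auto simp: L2_rel_def square_integrable_diff)

lift_definition uminus_L2 :: "'a L2 \<Rightarrow> 'a L2" is "\<lambda>f x. - f x"
  by (auto simp: L2_rel_def square_integrable_uminus)

lift_definition scaleR_L2 :: "real \<Rightarrow> 'a L2 \<Rightarrow> 'a L2" is "\<lambda>r f x. r *\<^sub>R f x"
  by (auto simp: L2_rel_def square_integrable_scaleR)

lift_definition inner_L2 :: "'a L2 \<Rightarrow> 'a L2 \<Rightarrow> real" is "\<lambda>f g. LINT x|lebesgue. f x \<bullet> g x"
proof -
  fix f f' g g' :: "real \<Rightarrow> 'a"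
  assume "L2_rel f f'" "L2_rel g g'"
  then have [measurable]: "f \<in> borel_measurable lebesgue" "g \<in> borel_measurable lebesgue"
      "f' \<in> borel_measurable lebesgue" "g' \<in> borel_measurable lebesgue"
    and ae: "AE x in lebesgue. f x = f' x" "AE x in lebesgue. g x = g' x"
    by (auto simp: L2_rel_def square_integrable_def)
  show "(LINT x|lebesgue. f x \<bullet> g x) = (LINT x|lebesgue. f' x \<bullet> g' x)"
  proof (rule integral_cong_AE)
    show "AE x in lebesgue. f x \<bullet> g x = f' x \<bullet> g' x"
      using ae by eventually_elim simp
  qed measurable
qed

definition norm_L2 :: "'a L2 \<Rightarrow> real" where
  "norm_L2 u = sqrt (inner u u)"

definition sgn_L2 :: "'a L2 \<Rightarrow> 'a L2" where
  "sgn_L2 u = inverse (norm u) *\<^sub>R u"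

definition dist_L2 :: "'a L2 \<Rightarrow> 'a L2 \<Rightarrow> real" where
  "dist_L2 u v = norm (u - v)"

definition uniformity_L2 :: "('a L2 \<times> 'a L2) filter" where
  "uniformity_L2 = (INF e\<in>{0<..}. principal {(x, y). dist x y < e})"

definition open_L2 :: "'a L2 set \<Rightarrow> bool" where
  "open_L2 U \<longleftrightarrow> (\<forall>x\<in>U. eventually (\<lambda>(x', y). x' = x \<longrightarrow> y \<in> U) uniformity)"

instance
proof
  fix u v w :: "'a L2" and r s :: real
  show "u + v + w = u + (v + w)"
    by transfer (auto simp: L2_rel_def square_integrable_add add.assoc)
  show "u + v = v + u"
    by transfer (auto simp: L2_rel_def square_integrable_add add.commute)
  show "0 + u = u"
    by transfer (auto simp: L2_rel_def)
  show "- u + u = 0"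
    by transfer (auto simp: L2_rel_def square_integrable_0)
  show "u - v = u + - v"
    by transfer (auto simp: L2_rel_def square_integrable_diff)
  show "r *\<^sub>R (u + v) = r *\<^sub>R u + r *\<^sub>R v"
    by transfer
      (auto simp: L2_rel_def square_integrable_add square_integrable_scaleR scaleR_add_right)
  show "(r + s) *\<^sub>R u = r *\<^sub>R u + s *\<^sub>R u"
    by transfer
      (auto simp: L2_rel_def square_integrable_add square_integrable_scaleR scaleR_add_left
        simp flip: scaleR_add_left)
  show "r *\<^sub>R s *\<^sub>R u = (r * s) *\<^sub>R u"
    by transfer (auto simp: L2_rel_def square_integrable_scaleR)
  show "1 *\<^sub>R u = u"
    by transfer (auto simp: L2_rel_def)
  show "sgn u = inverse (norm u) *\<^sub>R u"
    by (rule sgn_L2_def)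
  show "dist u v = norm (u - v)"
    by (rule dist_L2_def)
  show "uniformity = (INF e\<in>{0<..}. principal {(x, y :: 'a L2). dist x y < e})"
    by (rule uniformity_L2_def)
  show "open U \<longleftrightarrow> (\<forall>x\<in>U. eventually (\<lambda>(x', y). x' = x \<longrightarrow> y \<in> U) uniformity)"
    for U :: "'a L2 set"
    by (rule open_L2_def)
  show "inner u v = inner v u"
    by transfer (simp add: inner_commute)
  show "inner (u + v) w = inner u w + inner v w"
    by transfer (simp add: L2_rel_def inner_add_left square_integrable_inner)
  show "inner (r *\<^sub>R u) v = r * inner u v"
    by transfer simp
  show "0 \<le> inner u u"
    by transfer simp
  show "inner u u = 0 \<longleftrightarrow> u = 0"
  proof (transfer, goal_cases)
    case (1 f)
    then have "(LINT x|lebesgue. f x \<bullet> f x) = 0 \<longleftrightarrow> (AE x in lebesgue. f x \<bullet> f x = 0)"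
      by (intro integral_nonneg_eq_0_iff_AE square_integrable_inner) (auto simp: L2_rel_def)
    with 1 show ?case
      by (simp add: L2_rel_def square_integrable_0)
  qed
  show "norm u = sqrt (inner u u)"
    by (rule norm_L2_def)
qed

end

text \<open>\<open>L\<^sub>2(a,b)\<close> is identified, through extension by zero, with the closed subspace of those
  elements of \<open>L\<^sub>2(\<real>)\<close> that vanish almost everywhere outside \<open>(a,b)\<close>.\<close>

definition L2_on :: "real \<Rightarrow> real \<Rightarrow> ('b::euclidean_space) L2 set" where
  "L2_on a b = {u. AE x in lebesgue. x \<notin> {a<..<b} \<longrightarrow> rep_L2 u x = 0}"

text \<open>Multiplication by a matrix-valued function on \<open>(a,b)\<close>; meaningful if that function is
  measurable and bounded on \<open>(a,b)\<close>. Its values outside \<open>(a,b)\<close> are irrelevant.\<close>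

definition mult_on ::
  "real \<Rightarrow> real \<Rightarrow> (real \<Rightarrow> real^'n^'n) \<Rightarrow> (real^'n) L2 \<Rightarrow> (real^'n) L2" where
  "mult_on a b M u = abs_L2 (\<lambda>x. indicator {a<..<b} x *\<^sub>R (M x *v rep_L2 u x))"

text \<open>\<open>\<langle>u,v\<rangle>\<^sub>H = \<langle>\<H>u,v\<rangle>\<close> and the norm it induces.\<close>

definition inner_H ::
  "real \<Rightarrow> real \<Rightarrow> (real \<Rightarrow> real^'n^'n) \<Rightarrow> (real^'n) L2 \<Rightarrow> (real^'n) L2 \<Rightarrow> real" where
  "inner_H a b \<H> u v = inner (mult_on a b \<H> u) v"

definition norm_H ::
  "real \<Rightarrow> real \<Rightarrow> (real \<Rightarrow> real^'n^'n) \<Rightarrow> (real^'n) L2 \<Rightarrow> real" where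
  "norm_H a b \<H> u = sqrt (inner_H a b \<H> u u)"


section \<open>Sobolev spaces\<close>

definition vderiv :: "(real \<Rightarrow> 'b::real_normed_vector) \<Rightarrow> real \<Rightarrow> 'b" where
  "vderiv f x = vector_derivative f (at x)"

text \<open>The space \<open>C\<^sub>c\<^sup>\<infinity>(a,b)\<close>, extended by zero.\<close>

definition test_functions :: "real \<Rightarrow> real \<Rightarrow> (real \<Rightarrow> 'b::euclidean_space) set" where
  "test_functions a b = {\<phi>. (\<forall>k x. (vderiv ^^ k) \<phi> differentiable (at x)) \<and>
     compact (closure {x. \<phi> x \<noteq> 0}) \<and> closure {x. \<phi> x \<noteq> 0} \<subseteq> {a<..<b}}"

definition weak_derivative ::
  "real \<Rightarrow> real \<Rightarrow> ('b::euclidean_space) L2 \<Rightarrow> 'b L2 \<Rightarrow> bool" where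
  "weak_derivative a b u v \<longleftrightarrow> (\<forall>\<phi>\<in>test_functions a b.
     (LINT x:{a<..<b}|lebesgue. vderiv \<phi> x *\<^sub>R rep_L2 u x) =
     - (LINT x:{a<..<b}|lebesgue. (\<phi> x :: real) *\<^sub>R rep_L2 v x))"

definition H1 :: "real \<Rightarrow> real \<Rightarrow> ('b::euclidean_space) L2 set" where
  "H1 a b = {u \<in> L2_on a b. \<exists>v\<in>L2_on a b. weak_derivative a b u v}"

text \<open>\<open>H\<^sup>1\<^sub>0(a,b)\<close> is the closure of \<open>C\<^sub>c\<^sup>\<infinity>(a,b)\<close> in \<open>H\<^sup>1(a,b)\<close>; convergence in \<open>H\<^sup>1\<close> is
  convergence of the pairs \<open>(\<phi>, \<phi>')\<close> in \<open>L\<^sub>2 \<times> L\<^sub>2\<close>.\<close>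

definition H1_0 :: "real \<Rightarrow> real \<Rightarrow> ('b::euclidean_space) L2 set" where
  "H1_0 a b = {u. \<exists>v. (u, v) \<in> closure ((\<lambda>\<phi>. (abs_L2 \<phi>, abs_L2 (vderiv \<phi>))) ` test_functions a b)}"

definition point_eval :: "real \<Rightarrow> real \<Rightarrow> ('b::euclidean_space) L2 \<Rightarrow> real \<Rightarrow> 'b" where
  "point_eval a b u \<eta> = (THE y. \<exists>w. continuous_on {a..b} w \<and>
     (AE x in lebesgue. x \<in> {a<..<b} \<longrightarrow> w x = rep_L2 u x) \<and> w \<eta> = y)"


section \<open>Semigroups\<close>

text \<open>The underlying normed space is the linear subspace \<open>X\<close> of a vector space, with a norm
  \<open>N\<close> on \<open>X\<close> that need not be the canonical norm of the type. An operator with domain \<open>D\<close> is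
  a function of which only the values on \<open>D\<close> matter.\<close>

definition linear_operator :: "'v::real_vector set \<Rightarrow> 'v set \<Rightarrow> ('v \<Rightarrow> 'v) \<Rightarrow> bool" where
  "linear_operator X D A \<longleftrightarrow> subspace D \<and> D \<subseteq> X \<and> A ` D \<subseteq> X \<and>
     (\<forall>u\<in>D. \<forall>v\<in>D. A (u + v) = A u + A v) \<and> (\<forall>u\<in>D. \<forall>r. A (r *\<^sub>R u) = r *\<^sub>R A u)"

definition C0_semigroup ::
  "'v::real_vector set \<Rightarrow> ('v \<Rightarrow> real) \<Rightarrow> (real \<Rightarrow> 'v \<Rightarrow> 'v) \<Rightarrow> bool" where
  "C0_semigroup X N S \<longleftrightarrow>
     (\<forall>t\<ge>0. linear_operator X X (S t) \<and> (\<exists>K. \<forall>u\<in>X. N (S t u) \<le> K * N u)) \<and>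
     (\<forall>u\<in>X. S 0 u = u) \<and>
     (\<forall>s\<ge>0. \<forall>t\<ge>0. \<forall>u\<in>X. S (s + t) u = S s (S t u)) \<and>
     (\<forall>u\<in>X. ((\<lambda>t. N (S t u - u)) \<longlongrightarrow> 0) (at_right 0))"

definition contraction_semigroup ::
  "'v::real_vector set \<Rightarrow> ('v \<Rightarrow> real) \<Rightarrow> (real \<Rightarrow> 'v \<Rightarrow> 'v) \<Rightarrow> bool" where
  "contraction_semigroup X N S \<longleftrightarrow>
     C0_semigroup X N S \<and> (\<forall>t\<ge>0. \<forall>u\<in>X. N (S t u) \<le> N u)"

definition exponentially_stable ::
  "'v::real_vector set \<Rightarrow> ('v \<Rightarrow> real) \<Rightarrow> (real \<Rightarrow> 'v \<Rightarrow> 'v) \<Rightarrow> bool" where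
  "exponentially_stable X N S \<longleftrightarrow>
     (\<exists>C\<ge>1. \<exists>\<omega>>0. \<forall>t\<ge>0. \<forall>u\<in>X. N (S t u) \<le> C * exp (- \<omega> * t) * N u)"

text \<open>The operator \<open>A\<close> with domain \<open>D\<close> is the infinitesimal generator of \<open>S\<close> (equality of
  graphs).\<close>

definition generator_of ::
  "'v::real_vector set \<Rightarrow> ('v \<Rightarrow> real) \<Rightarrow> 'v set \<Rightarrow> ('v \<Rightarrow> 'v) \<Rightarrow> (real \<Rightarrow> 'v \<Rightarrow> 'v) \<Rightarrow> bool" where
  "generator_of X N D A S \<longleftrightarrow>
     {(u, A u) | u. u \<in> D} =
     {(u, v). u \<in> X \<and> v \<in> X \<and> ((\<lambda>h. N ((1 / h) *\<^sub>R (S h u - u) - v)) \<longlongrightarrow> 0) (at_right 0)}"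


section \<open>Matrices and the fundamental solution\<close>

definition pos_semidef :: "real^'n^'n \<Rightarrow> bool" where
  "pos_semidef M \<longleftrightarrow> transpose M = M \<and> (\<forall>v. 0 \<le> (M *v v) \<bullet> v)"

definition matrix_le :: "real^'n^'n \<Rightarrow> real^'n^'n \<Rightarrow> bool" where
  "matrix_le A B \<longleftrightarrow> pos_semidef (B - A)"

definition cmat :: "real^'n^'n \<Rightarrow> complex^'n^'n" where
  "cmat M = (\<chi> i j. complex_of_real (M $ i $ j))"

definition abs_continuous_on :: "real \<Rightarrow> real \<Rightarrow> (real \<Rightarrow> 'b::real_normed_vector) \<Rightarrow> bool" where
  "abs_continuous_on a b f \<longleftrightarrow> (\<forall>\<epsilon>>0. \<exists>\<delta>>0. \<forall>I.
     finite I \<and> (\<forall>(x, y)\<in>I. a \<le> x \<and> x < y \<and> y \<le> b) \<and>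
     disjoint_family_on (\<lambda>(x, y). {x<..<y}) I \<and> (\<Sum>(x, y)\<in>I. y - x) < \<delta> \<longrightarrow>
     (\<Sum>(x, y)\<in>I. norm (f y - f x)) < \<epsilon>)"

text \<open>The solution of \<open>u' = Q u\<close> on \<open>(a,b)\<close> with \<open>u(a) = 1\<close>, in the sense of Caratheodory.\<close>

definition fundamental_solution ::
  "real \<Rightarrow> real \<Rightarrow> (real \<Rightarrow> complex^'n^'n) \<Rightarrow> (real \<Rightarrow> complex^'n^'n) \<Rightarrow> bool" where
  "fundamental_solution a b Q \<Phi> \<longleftrightarrow> abs_continuous_on a b \<Phi> \<and> \<Phi> a = mat 1 \<and>
     (AE x in lebesgue. x \<in> {a<..<b} \<longrightarrow> (\<Phi> has_vector_derivative (Q x ** \<Phi> x)) (at x))"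

end

theory Submission
  imports Defs "HOL-Real_Asymp.Real_Asymp"
begin

text \<open>
  For a contraction semigroup, exponential stability amounts to a contraction factor below one at a
  single time. Two facts provide it.

  First, \<open>(i t - A) u = f\<close> implies \<open>\<parallel>u\<parallel> \<le> C \<parallel>f\<parallel>\<close> with \<open>C\<close> independent of \<open>t \<in> \<real>\<close>
  (\<open>imaginary_resolvent_bound\<close>). Indeed \<open>w = \<H> u\<close> solves \<open>P\<^sub>1 w' = (i t \<H>\<inverse> - P\<^sub>0) w - f\<close>, and the
  matrices \<open>i t \<H>\<inverse> - P\<^sub>0\<close> are skew-adjoint. Hence \<open>\<Phi>\<^sub>t\<^sup>* P\<^sub>1 \<Phi>\<^sub>t = P\<^sub>1\<close>, so that the uniform bound for
  \<open>\<Phi>\<^sub>t\<close> is also one for its inverse, and \<open>\<bar>w(x)\<bar> \<le> C\<^sub>1 (\<bar>w(\<eta>)\<bar> + \<integral> \<bar>f\<bar>)\<close> for all \<open>x\<close>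
  (\<open>skew_system_estimate\<close>). The boundary value is paid for by dissipation:
  \<open>c \<bar>w(\<eta>)\<bar>\<^sup>2 \<le> - Re \<langle>u, A u\<rangle> = Re \<langle>u, f\<rangle> \<le> \<parallel>u\<parallel> \<parallel>f\<parallel>\<close>. Together these give
  \<open>\<parallel>u\<parallel>\<^sup>2 \<le> C\<^sub>2 (\<parallel>u\<parallel> \<parallel>f\<parallel> + \<parallel>f\<parallel>\<^sup>2)\<close>, from which the product is absorbed.

  Secondly, such a bound forces decay, which is the part of the Gearhart-Pruess theorem that is needed
  (\<open>contraction_semigroup_exponentially_stable\<close>). Multiply an orbit \<open>u\<close> by the tent function \<open>\<phi>\<close> on
  \<open>[0,T]\<close>. Then \<open>g = \<phi> u\<close> vanishes at both ends and \<open>g' - A g = \<phi>' u\<close>, so that a Fourier transform in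
  time, the resolvent bound at each frequency and Parseval's identity yield
  \<open>\<integral> \<parallel>g\<parallel>\<^sup>2 \<le> C\<^sup>2 \<integral> \<parallel>\<phi>' u\<parallel>\<^sup>2\<close>. As \<open>\<parallel>u\<parallel>\<close> decreases, the left side is at least a multiple of
  \<open>T\<^sup>3 \<parallel>u(T)\<parallel>\<^sup>2\<close>, and the right side is at most \<open>C\<^sup>2 T \<parallel>u(0)\<parallel>\<^sup>2\<close>; thus \<open>\<parallel>u(T)\<parallel> \<le> \<parallel>u(0)\<parallel> / 2\<close> for
  large \<open>T\<close>. The argument is carried out on a time grid with the discrete Fourier transform, which
  involves neither vector-valued integrals nor completeness: trapezoidal means and central
  differences are transformed into exact resolvent equations at points of the imaginary axis, and the
  discretisation error vanishes with the mesh by the definition of the generator and by strong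
  continuity.

  The analysis behind the first fact is this: test functions are dense in \<open>L\<^sub>2(a,b)\<close>
  (\<open>test_functions_dense\<close>), which also makes the domain of \<open>A\<close> dense (\<open>H1_0_preimage_dense\<close>);
  functions with a weak derivative in \<open>L\<^sub>2\<close> are indefinite integrals
  (\<open>weak_derivative_primitive_on\<close>), and so are absolutely continuous functions
  (\<open>abs_continuous_FTC\<close>); and indefinite integrals obey the product rule
  (\<open>primitive_on_bilinear\<close>).
\<close>

section \<open>Semi-inner products\<close>

text \<open>The energy form \<open>\<langle>u,v\<rangle>\<^sub>H\<close> makes sense on all of \<open>L\<^sub>2(\<real>)\<close> but vanishes on functions supported
  outside \<open>(a,b)\<close>; it is therefore treated as a semidefinite form.\<close>

locale semi_inner =
  fixes ip :: "'v::real_vector \<Rightarrow> 'v \<Rightarrow> real"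
  assumes add_left: "ip (u + v) w = ip u w + ip v w"
    and scale_left: "ip (r *\<^sub>R u) v = r * ip u v"
    and commute: "ip u v = ip v u"
    and nonneg: "0 \<le> ip u u"
begin

definition seminorm :: "'v \<Rightarrow> real" where
  "seminorm u = sqrt (ip u u)"

lemma add_right: "ip u (v + w) = ip u v + ip u w"
  by (simp only: commute[of u] add_left)

lemma scale_right: "ip u (r *\<^sub>R v) = r * ip u v"
  by (simp only: commute[of u] scale_left)

lemma zero_left [simp]: "ip 0 v = 0"
  using scale_left[of 0 0 v] by simp

lemma sum_left: "ip (\<Sum>i\<in>I. f i) v = (\<Sum>i\<in>I. ip (f i) v)"
  by (induction I rule: infinite_finite_induct) (auto simp: add_left)

lemma sum_right: "ip v (\<Sum>i\<in>I. f i) = (\<Sum>i\<in>I. ip v (f i))"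
  by (simp only: commute[of v] sum_left)

lemma minus_left: "ip (- u) v = - ip u v"
  using scale_left[of "-1" u v] by simp

lemma diff_left: "ip (u - v) w = ip u w - ip v w"
  using add_left[of u "- v" w] by (simp add: minus_left)

lemma diff_right: "ip w (u - v) = ip w u - ip w v"
  by (simp only: commute[of w] diff_left)

lemma seminorm_nonneg [simp]: "0 \<le> seminorm u"
  by (simp add: seminorm_def nonneg)

lemma seminorm_power2: "(seminorm u)\<^sup>2 = ip u u"
  by (simp add: seminorm_def nonneg)

lemma Cauchy_Schwarz: "ip u v \<le> seminorm u * seminorm v"
proof -
  have q: "0 \<le> ip u u + 2 * r * ip u v + r\<^sup>2 * ip v v" for r
    using nonneg[of "u + r *\<^sub>R v"]
    by (simp add: add_left add_right scale_left scale_right commute[of v u] power2_eq_square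
        algebra_simps)
  have "(ip u v)\<^sup>2 \<le> ip u u * ip v v"
  proof (cases "ip v v = 0")
    case True
    have "ip u v = 0"
    proof (rule ccontr)
      assume "ip u v \<noteq> 0"
      with q[of "- (ip u u + 1) / (2 * ip u v)"] True show False
        by (simp add: field_simps)
    qed
    with True show ?thesis
      by simp
  next
    case False
    with nonneg[of v] have "ip v v > 0"
      by linarith
    with q[of "- ip u v / ip v v"] show ?thesis
      by (simp add: field_simps power2_eq_square)
  qed
  then have "\<bar>ip u v\<bar> \<le> sqrt (ip u u * ip v v)"
    by (rule real_le_rsqrt[of "\<bar>ip u v\<bar>", simplified])
  then show ?thesis
    by (simp add: seminorm_def real_sqrt_mult)
qed

lemma seminorm_add: "seminorm (u + v) \<le> seminorm u + seminorm v"
proof -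
  have "ip (u + v) (u + v) \<le> (seminorm u + seminorm v)\<^sup>2"
    using Cauchy_Schwarz[of u v] seminorm_power2[of u] seminorm_power2[of v]
    by (simp add: add_left add_right commute[of v u] power2_sum)
  then show ?thesis
    unfolding seminorm_def[of "u + v"] by (intro real_le_lsqrt) simp_all
qed

lemma seminorm_scaleR: "seminorm (r *\<^sub>R u) = \<bar>r\<bar> * seminorm u"
  by (simp add: seminorm_def scale_left scale_right real_sqrt_mult flip: mult.assoc)

lemma seminorm_minus: "seminorm (- u) = seminorm u"
  using seminorm_scaleR[of "-1" u] by simp

lemma seminorm_diff: "seminorm (u - v) \<le> seminorm u + seminorm v"
  using seminorm_add[of u "- v"] by (simp add: seminorm_minus)

lemma seminorm_triangle: "seminorm u \<le> seminorm (u - v) + seminorm v"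
  using seminorm_add[of "u - v" v] by simp

end

section \<open>The discrete Fourier transform\<close>

text \<open>This is the real part of a geometric sum: for \<open>j \<noteq> l\<close> the ratio is an \<open>N\<close>-th root of unity
  other than \<open>1\<close>.\<close>

lemma sum_cos_roots_of_unity:
  assumes "j < N" "l < N"
  shows "(\<Sum>k<N. cos ((real j - real l) * (2 * pi * real k / real N))) = (if j = l then real N else 0)"
proof (cases "j = l")
  case False
  define z where "z = cis ((real j - real l) * (2 * pi / real N))"
  have zk: "z ^ k = cis ((real j - real l) * (2 * pi * real k / real N))" for k
    unfolding z_def Complex.DeMoivre by (rule arg_cong[of _ _ cis]) simp
  have "z ^ N = cis (2 * pi * of_int (int j - int l))"
    unfolding zk using assms by (intro arg_cong[of _ _ cis]) simp
  also have "\<dots> = 1"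
    by (rule cis_multiple_2pi) simp
  finally have zN: "z ^ N = 1" .
  have "z \<noteq> 1"
  proof
    assume "z = 1"
    then have "cos ((real j - real l) * (2 * pi / real N)) = 1"
      unfolding z_def by (metis cis.sel(1) one_complex.sel(1))
    then obtain i where "(real j - real l) * (2 * pi / real N) = of_int i * 2 * pi"
      unfolding cos_one_2pi_int by auto
    then have "pi * (real j - real l) = pi * (of_int i * real N)"
      using assms by (simp add: field_simps)
    then have "real j - real l = of_int i * real N"
      by simp
    then have "int j - int l = i * int N"
      by (metis (mono_tags) of_int_diff of_int_eq_iff of_int_mult of_int_of_nat_eq)
    moreover from this False have "i \<noteq> 0"
      by auto
    ultimately have "int N \<le> \<bar>int j - int l\<bar>"
      using int_one_le_iff_zero_less[of "\<bar>i\<bar>"]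
      by (simp add: abs_mult mult_le_cancel_right1)
    with assms show False
      by linarith
  qed
  then have "(\<Sum>k<N. z ^ k) = 0"
    using geometric_sum[of z N] zN by simp
  then have "Re (\<Sum>k<N. z ^ k) = 0"
    by simp
  with False show ?thesis
    unfolding zk Re_sum by simp
qed simp

context semi_inner
begin

text \<open>Real and imaginary parts of the transform are kept as two vectors of the real space. The shift of
  the index by \<open>1/2\<close> is immaterial, because \<open>cos \<alpha> cos \<beta> + sin \<alpha> sin \<beta> = cos (\<alpha> - \<beta>)\<close> involves only
  differences of indices.\<close>

lemma Parseval:
  fixes g :: "nat \<Rightarrow> 'v" and N :: nat
  defines "\<theta> \<equiv> \<lambda>k::nat. 2 * pi * real k / real N"
  shows "(\<Sum>k<N. (seminorm (\<Sum>j<N. cos ((real j + 1/2) * \<theta> k) *\<^sub>R g j))\<^sup>2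
               + (seminorm (\<Sum>j<N. sin ((real j + 1/2) * \<theta> k) *\<^sub>R g j))\<^sup>2)
       = real N * (\<Sum>j<N. (seminorm (g j))\<^sup>2)" (is "?L = ?R")
proof -
  have expand: "(seminorm (\<Sum>j<N. c j *\<^sub>R g j))\<^sup>2 = (\<Sum>j<N. \<Sum>l<N. c j * c l * ip (g j) (g l))"
    for c :: "nat \<Rightarrow> real"
    unfolding seminorm_power2 sum_left scale_left
    unfolding sum_right scale_right sum_distrib_left mult.assoc ..
  have "?L = (\<Sum>k<N. \<Sum>j<N. \<Sum>l<N. cos ((real j - real l) * \<theta> k) * ip (g j) (g l))"
    unfolding expand sum.distrib[symmetric] distrib_right[symmetric] cos_diff[symmetric]
      left_diff_distrib[symmetric] by simp
  also have "\<dots> = (\<Sum>j<N. \<Sum>l<N. \<Sum>k<N. cos ((real j - real l) * \<theta> k) * ip (g j) (g l))"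
    by (rule trans[OF sum.swap sum.cong[OF refl sum.swap]])
  also have "\<dots> = (\<Sum>j<N. \<Sum>l<N. if l = j then real N * ip (g j) (g j) else 0)"
  proof (intro sum.cong refl)
    fix j l assume "j \<in> {..<N}" "l \<in> {..<N}"
    then have "(\<Sum>k<N. cos ((real j - real l) * \<theta> k)) = (if j = l then real N else 0)"
      unfolding \<theta>_def by (intro sum_cos_roots_of_unity) simp_all
    then show "(\<Sum>k<N. cos ((real j - real l) * \<theta> k) * ip (g j) (g l))
        = (if l = j then real N * ip (g j) (g j) else 0)"
      unfolding sum_distrib_right[symmetric] by auto
  qed
  also have "\<dots> = (\<Sum>j<N. real N * ip (g j) (g j))"
    by simp
  finally show ?thesis
    unfolding seminorm_power2 sum_distrib_left .
qed

end

text \<open>Summation by parts, without boundary terms since \<open>g\<close> vanishes at both ends. With the transform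
  centred at the midpoints, sums and differences of neighbours become the multiples by
  \<open>2 cos (\<theta>/2)\<close> and \<open>\<plusminus> 2 sin (\<theta>/2)\<close> of the same two vectors. Hence a difference quotient with step
  \<open>h\<close>, compared with the mean of neighbours, acts as multiplication by \<open>i (2/h) tan (\<theta>/2)\<close>, which lies
  exactly on the imaginary axis.\<close>

lemma midpoint_transform:
  fixes g :: "nat \<Rightarrow> 'v::real_vector"
  assumes "g 0 = 0" "g N = 0"
  shows "(\<Sum>j<N. cos ((real j + 1/2) * \<theta>) *\<^sub>R (g (Suc j) + g j))
           = (2 * cos (\<theta>/2)) *\<^sub>R (\<Sum>j<N. cos (real j * \<theta>) *\<^sub>R g j)"
    and "(\<Sum>j<N. sin ((real j + 1/2) * \<theta>) *\<^sub>R (g (Suc j) + g j))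
           = (2 * cos (\<theta>/2)) *\<^sub>R (\<Sum>j<N. sin (real j * \<theta>) *\<^sub>R g j)"
    and "(\<Sum>j<N. cos ((real j + 1/2) * \<theta>) *\<^sub>R (g (Suc j) - g j))
           = (2 * sin (\<theta>/2)) *\<^sub>R (\<Sum>j<N. sin (real j * \<theta>) *\<^sub>R g j)"
    and "(\<Sum>j<N. sin ((real j + 1/2) * \<theta>) *\<^sub>R (g (Suc j) - g j))
           = - ((2 * sin (\<theta>/2)) *\<^sub>R (\<Sum>j<N. cos (real j * \<theta>) *\<^sub>R g j))"
proof -
  have shift: "(\<Sum>j<N. f (real j + 1/2) *\<^sub>R g (Suc j)) = (\<Sum>j<N. f (real j - 1/2) *\<^sub>R g j)"
    for f :: "real \<Rightarrow> real"
  proof -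
    have "(\<Sum>j<N. f (real j + 1/2) *\<^sub>R g (Suc j)) = (\<Sum>j<N. f (real (Suc j) - 1/2) *\<^sub>R g (Suc j))"
      by (intro sum.cong refl) (simp add: algebra_simps)
    also have "\<dots> = (\<Sum>j<Suc N. f (real j - 1/2) *\<^sub>R g j)"
      unfolding sum.lessThan_Suc_shift using assms by simp
    also have "\<dots> = (\<Sum>j<N. f (real j - 1/2) *\<^sub>R g j)"
      using assms by simp
    finally show ?thesis .
  qed
  have add: "(\<Sum>j<N. f (real j + 1/2) *\<^sub>R (g (Suc j) + g j))
      = (\<Sum>j<N. (f (real j - 1/2) + f (real j + 1/2)) *\<^sub>R g j)"
    and diff: "(\<Sum>j<N. f (real j + 1/2) *\<^sub>R (g (Suc j) - g j))
      = (\<Sum>j<N. (f (real j - 1/2) - f (real j + 1/2)) *\<^sub>R g j)" for f :: "real \<Rightarrow> real"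
    by (simp_all add: scaleR_add_right scaleR_diff_right scaleR_add_left scaleR_diff_left
        sum.distrib sum_subtractf shift[of f])
  have trig: "cos ((x - 1/2) * \<theta>) + cos ((x + 1/2) * \<theta>) = 2 * cos (\<theta>/2) * cos (x * \<theta>)"
    "sin ((x - 1/2) * \<theta>) + sin ((x + 1/2) * \<theta>) = 2 * cos (\<theta>/2) * sin (x * \<theta>)"
    "cos ((x - 1/2) * \<theta>) - cos ((x + 1/2) * \<theta>) = 2 * sin (\<theta>/2) * sin (x * \<theta>)"
    "sin ((x - 1/2) * \<theta>) - sin ((x + 1/2) * \<theta>) = - (2 * sin (\<theta>/2) * cos (x * \<theta>))" for x :: real
    using cos_add[of "x * \<theta>" "\<theta>/2"] cos_diff[of "x * \<theta>" "\<theta>/2"]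
      sin_add[of "x * \<theta>" "\<theta>/2"] sin_diff[of "x * \<theta>" "\<theta>/2"]
    by (simp_all add: left_diff_distrib distrib_right)
  show "(\<Sum>j<N. cos ((real j + 1/2) * \<theta>) *\<^sub>R (g (Suc j) + g j))
           = (2 * cos (\<theta>/2)) *\<^sub>R (\<Sum>j<N. cos (real j * \<theta>) *\<^sub>R g j)"
    using add[of "\<lambda>x. cos (x * \<theta>)"] by (simp add: trig scaleR_sum_right)
  show "(\<Sum>j<N. sin ((real j + 1/2) * \<theta>) *\<^sub>R (g (Suc j) + g j))
           = (2 * cos (\<theta>/2)) *\<^sub>R (\<Sum>j<N. sin (real j * \<theta>) *\<^sub>R g j)"
    using add[of "\<lambda>x. sin (x * \<theta>)"] by (simp add: trig scaleR_sum_right)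
  show "(\<Sum>j<N. cos ((real j + 1/2) * \<theta>) *\<^sub>R (g (Suc j) - g j))
           = (2 * sin (\<theta>/2)) *\<^sub>R (\<Sum>j<N. sin (real j * \<theta>) *\<^sub>R g j)"
    using diff[of "\<lambda>x. cos (x * \<theta>)"] by (simp add: trig scaleR_sum_right)
  show "(\<Sum>j<N. sin ((real j + 1/2) * \<theta>) *\<^sub>R (g (Suc j) - g j))
           = - ((2 * sin (\<theta>/2)) *\<^sub>R (\<Sum>j<N. cos (real j * \<theta>) *\<^sub>R g j))"
    using diff[of "\<lambda>x. sin (x * \<theta>)"] by (simp add: trig scaleR_sum_right sum_negf)
qed

section \<open>A resolvent bound on the imaginary axis gives decay\<close>

context semi_inner
begin

text \<open>The assumption \<open>res\<close> says \<open>\<parallel>w\<parallel> \<le> C \<parallel>(i t - A) w\<parallel>\<close> for \<open>w = u + i v\<close>. At each frequency the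
  transform of the means \<open>p\<close> solves such an equation whose right side is the transform of the defects,
  and Parseval's identity sums the resulting estimates.\<close>

lemma discrete_resolvent_estimate:
  fixes A :: "'v \<Rightarrow> 'v" and g :: "nat \<Rightarrow> 'v"
  assumes lin: "linear_operator X D A"
    and g: "\<And>j. g j \<in> D" "g 0 = 0" "g N = 0" and h: "h > 0"
    and res: "\<And>t u v. u \<in> D \<Longrightarrow> v \<in> D \<Longrightarrow> (seminorm u)\<^sup>2 + (seminorm v)\<^sup>2 \<le>
        C\<^sup>2 * ((seminorm (- (t *\<^sub>R v) - A u))\<^sup>2 + (seminorm (t *\<^sub>R u - A v))\<^sup>2)"
  defines "p \<equiv> \<lambda>j. (1/2) *\<^sub>R (g (Suc j) + g j)"
  shows "(\<Sum>j<N. (seminorm (p j))\<^sup>2)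
      \<le> C\<^sup>2 * (\<Sum>j<N. (seminorm ((1/h) *\<^sub>R (g (Suc j) - g j) - A (p j)))\<^sup>2)"
proof (cases "N = 0")
  case False
  define F where "F j = (1/h) *\<^sub>R (g (Suc j) - g j) - A (p j)" for j
  define \<theta> where "\<theta> k = 2 * pi * real k / real N" for k :: nat
  define T where "T w f = (\<Sum>j<N. w j *\<^sub>R f j)" for w :: "nat \<Rightarrow> real" and f :: "nat \<Rightarrow> 'v"
  define c where "c k j = cos ((real j + 1/2) * \<theta> k)" for k j :: nat
  define s where "s k j = sin ((real j + 1/2) * \<theta> k)" for k j :: nat
  have sub: "subspace D" and A_add: "\<And>u v. u \<in> D \<Longrightarrow> v \<in> D \<Longrightarrow> A (u + v) = A u + A v"
    and A_scale: "\<And>u r. u \<in> D \<Longrightarrow> A (r *\<^sub>R u) = r *\<^sub>R A u"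
    using lin by (auto simp: linear_operator_def)
  have pD: "p j \<in> D" for j
    unfolding p_def by (intro subspace_scale subspace_add sub g)
  have TD: "T w p \<in> D" for w
    unfolding T_def by (intro subspace_sum subspace_scale sub pD)
  have A0: "A 0 = 0"
    using A_scale[OF pD[of 0], of 0] by simp
  have AT: "A (T w p) = T w (\<lambda>j. A (p j))" for w
  proof -
    have "(\<Sum>j<n. w j *\<^sub>R p j) \<in> D \<and> A (\<Sum>j<n. w j *\<^sub>R p j) = (\<Sum>j<n. w j *\<^sub>R A (p j))" for n
      by (induction n) (auto simp: A0 A_add A_scale subspace_0 subspace_add subspace_scale sub pD)
    then show ?thesis
      by (simp add: T_def)
  qed
  have TF: "T w F = (1/h) *\<^sub>R T w (\<lambda>j. g (Suc j) - g j) - A (T w p)" for w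
    unfolding AT by (simp add: T_def F_def scaleR_diff_right sum_subtractf scaleR_sum_right mult.commute)
  have Tp: "T w p = (1/2) *\<^sub>R T w (\<lambda>j. g (Suc j) + g j)" for w
    by (simp add: T_def p_def scaleR_sum_right mult.commute)
  have freq: "(seminorm (T (c k) p))\<^sup>2 + (seminorm (T (s k) p))\<^sup>2
      \<le> C\<^sup>2 * ((seminorm (T (c k) F))\<^sup>2 + (seminorm (T (s k) F))\<^sup>2)" for k
  proof -
    define G\<^sub>c where "G\<^sub>c = (\<Sum>j<N. cos (real j * \<theta> k) *\<^sub>R g j)"
    define G\<^sub>s where "G\<^sub>s = (\<Sum>j<N. sin (real j * \<theta> k) *\<^sub>R g j)"
    note tr = midpoint_transform[OF g(2,3), of "\<theta> k", folded G\<^sub>c_def G\<^sub>s_def]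
    have p: "T (c k) p = cos (\<theta> k / 2) *\<^sub>R G\<^sub>c" "T (s k) p = cos (\<theta> k / 2) *\<^sub>R G\<^sub>s"
      unfolding Tp by (simp_all add: T_def c_def s_def tr)
    show ?thesis
\<comment> \<open>At the frequency \<open>\<theta> = \<pi>\<close> the resolvent equation is not available, but there the mean vanishes.\<close>
    proof (cases "cos (\<theta> k / 2) = 0")
      case True
      then have "T (c k) p = 0" "T (s k) p = 0"
        by (simp_all add: p)
      then show ?thesis
        by (simp add: seminorm_def nonneg)
    next
      case False
      define \<tau> where "\<tau> = 2 / h * tan (\<theta> k / 2)"
      have d: "(1/h) *\<^sub>R T (c k) (\<lambda>j. g (Suc j) - g j) = \<tau> *\<^sub>R T (s k) p"
        "(1/h) *\<^sub>R T (s k) (\<lambda>j. g (Suc j) - g j) = - (\<tau> *\<^sub>R T (c k) p)"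
        unfolding p unfolding T_def c_def s_def tr \<tau>_def tan_def using False by simp_all
      have "T (c k) F = - ((- \<tau>) *\<^sub>R T (s k) p) - A (T (c k) p)"
        "T (s k) F = (- \<tau>) *\<^sub>R T (c k) p - A (T (s k) p)"
        unfolding TF d by simp_all
      then show ?thesis
        using res[OF TD TD, of "c k" "s k" "- \<tau>"] by simp
    qed
  qed
  have "real N * (\<Sum>j<N. (seminorm (p j))\<^sup>2)
      = (\<Sum>k<N. (seminorm (T (c k) p))\<^sup>2 + (seminorm (T (s k) p))\<^sup>2)"
    unfolding T_def c_def s_def \<theta>_def by (rule Parseval[symmetric])
  also have "\<dots> \<le> (\<Sum>k<N. C\<^sup>2 * ((seminorm (T (c k) F))\<^sup>2 + (seminorm (T (s k) F))\<^sup>2))"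
    by (intro sum_mono freq)
  also have "\<dots> = C\<^sup>2 * (\<Sum>k<N. (seminorm (T (c k) F))\<^sup>2 + (seminorm (T (s k) F))\<^sup>2)"
    by (simp add: sum_distrib_left)
  also have "(\<Sum>k<N. (seminorm (T (c k) F))\<^sup>2 + (seminorm (T (s k) F))\<^sup>2)
      = real N * (\<Sum>j<N. (seminorm (F j))\<^sup>2)"
    unfolding T_def c_def s_def \<theta>_def by (rule Parseval)
  finally show ?thesis
    using False by (simp add: F_def mult.left_commute)
qed simp

end

lemma linear_operatorD:
  assumes "linear_operator X D A"
  shows "subspace D" "D \<subseteq> X" "\<And>u. u \<in> D \<Longrightarrow> A u \<in> X"
    "\<And>u v. u \<in> D \<Longrightarrow> v \<in> D \<Longrightarrow> A (u + v) = A u + A v"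
    "\<And>u r. u \<in> D \<Longrightarrow> A (r *\<^sub>R u) = r *\<^sub>R A u"
    "\<And>u v. u \<in> D \<Longrightarrow> v \<in> D \<Longrightarrow> A (u - v) = A u - A v"
proof -
  show 1: "subspace D" "D \<subseteq> X" "\<And>u. u \<in> D \<Longrightarrow> A u \<in> X"
    and add: "\<And>u v. u \<in> D \<Longrightarrow> v \<in> D \<Longrightarrow> A (u + v) = A u + A v"
    and scale: "\<And>u r. u \<in> D \<Longrightarrow> A (r *\<^sub>R u) = r *\<^sub>R A u"
    using assms by (auto simp: linear_operator_def)
  show "A (u - v) = A u - A v" if "u \<in> D" "v \<in> D" for u v
    using add[of u "-1 *\<^sub>R v"] scale[of v "-1"] subspace_neg[OF 1(1) \<open>v \<in> D\<close>] that by simp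
qed

context semi_inner
begin

lemma contraction_semigroupD:
  assumes "contraction_semigroup X seminorm S"
  shows "\<And>t. t \<ge> 0 \<Longrightarrow> linear_operator X X (S t)"
    "\<And>u. u \<in> X \<Longrightarrow> S 0 u = u"
    "\<And>s t u. s \<ge> 0 \<Longrightarrow> t \<ge> 0 \<Longrightarrow> u \<in> X \<Longrightarrow> S (s + t) u = S s (S t u)"
    "\<And>u. u \<in> X \<Longrightarrow> ((\<lambda>t. seminorm (S t u - u)) \<longlongrightarrow> 0) (at_right 0)"
    "\<And>t u. t \<ge> 0 \<Longrightarrow> u \<in> X \<Longrightarrow> seminorm (S t u) \<le> seminorm u"
  using assms by (auto simp: contraction_semigroup_def C0_semigroup_def)

lemma generator_ofD:
  assumes "generator_of X seminorm D A S" "u \<in> D"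
  shows "u \<in> X" "A u \<in> X"
    "((\<lambda>h. seminorm ((1 / h) *\<^sub>R (S h u - u) - A u)) \<longlongrightarrow> 0) (at_right 0)"
proof -
  have "(u, A u) \<in> {(u, A u) | u. u \<in> D}"
    using assms(2) by blast
  then show "u \<in> X" "A u \<in> X"
    "((\<lambda>h. seminorm ((1 / h) *\<^sub>R (S h u - u) - A u)) \<longlongrightarrow> 0) (at_right 0)"
    unfolding assms(1)[unfolded generator_of_def] by auto
qed

text \<open>The contraction \<open>S s\<close> maps the difference quotients of the orbit of \<open>u\<close> to those of the orbit of
  \<open>S s u\<close>, so that these converge as well.\<close>

lemma semigroup_commutes_with_generator:
  assumes S: "contraction_semigroup X seminorm S" and gen: "generator_of X seminorm D A S"
    and u: "u \<in> D" and s: "s \<ge> 0"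
  shows "S s u \<in> D" "A (S s u) = S s (A u)"
proof -
  note S' = contraction_semigroupD[OF S] and u' = generator_ofD[OF gen u]
  note L = linear_operatorD[OF S'(1)]
  have sub: "subspace X"
    using L(1)[of 0] by simp
  have "((\<lambda>h. seminorm ((1 / h) *\<^sub>R (S h (S s u) - S s u) - S s (A u))) \<longlongrightarrow> 0) (at_right 0)"
  proof (rule Lim_null_comparison[OF _ u'(3)])
    have "seminorm ((1 / h) *\<^sub>R (S h (S s u) - S s u) - S s (A u))
        \<le> seminorm ((1 / h) *\<^sub>R (S h u - u) - A u)" if "h > 0" for h
    proof -
      have "S h (S s u) = S s (S h u)"
        using S'(3)[of h s u] S'(3)[of s h u] u' s that by (simp add: add.commute)
      then have "(1 / h) *\<^sub>R (S h (S s u) - S s u) - S s (A u)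
          = S s ((1 / h) *\<^sub>R (S h u - u) - A u)"
        using s that u' by (simp add: L subspace_diff subspace_scale sub)
      moreover have "(1 / h) *\<^sub>R (S h u - u) - A u \<in> X"
        using that u' by (auto intro!: subspace_diff subspace_scale sub L)
      ultimately show ?thesis
        using S'(5)[OF s] by simp
    qed
    then show "\<forall>\<^sub>F h in at_right 0. norm (seminorm ((1 / h) *\<^sub>R (S h (S s u) - S s u) - S s (A u)))
        \<le> seminorm ((1 / h) *\<^sub>R (S h u - u) - A u)"
      by (simp add: eventually_at_filter)
  qed
  then have "(S s u, S s (A u)) \<in> {(u, A u) | u. u \<in> D}"
    unfolding gen[unfolded generator_of_def] using u' s by (simp add: L)
  then show "S s u \<in> D" "A (S s u) = S s (A u)"
    by auto
qed

text \<open>The discrete estimate is applied to the samples \<open>g j = \<phi> j *\<^sub>R S (j h) u\<close> of the orbit, cut off by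
  a tent function of height \<open>T/2\<close> and slopes \<open>\<plusminus> 1\<close>. Their defects are at most \<open>\<parallel>u\<parallel>\<close>, from the slope, plus
  errors that tend to \<open>0\<close> with \<open>h\<close>. On the middle half of \<open>[0,T]\<close> the tent is at least \<open>T/4\<close> and the
  orbit at least \<open>\<parallel>S T u\<parallel>\<close>; comparing \<open>2 K\<close> of the \<open>4 K\<close> grid points with all of them costs a factor
  \<open>sqrt 2\<close>, rounded up to \<open>2\<close>.\<close>

lemma semigroup_bound_discrete:
  fixes K :: nat
  assumes S: "contraction_semigroup X seminorm S" and gen: "generator_of X seminorm D A S"
    and lin: "linear_operator X D A"
    and C: "C > 0"
    and res: "\<And>t u v. u \<in> D \<Longrightarrow> v \<in> D \<Longrightarrow> (seminorm u)\<^sup>2 + (seminorm v)\<^sup>2 \<le>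
        C\<^sup>2 * ((seminorm (- (t *\<^sub>R v) - A u))\<^sup>2 + (seminorm (t *\<^sub>R u - A v))\<^sup>2)"
    and u: "u \<in> D" and T: "T > 0" and K: "K > 0"
  defines "h \<equiv> T / (4 * real K)"
  shows "T/4 * seminorm (S T u) \<le> T/4 * seminorm (S h u - u) + 2 * C * (seminorm u
     + (T/2 * seminorm ((1/h) *\<^sub>R (S h u - u) - A u) + h/2 * seminorm (A u)
        + T/4 * seminorm (S h (A u) - A u)))"
proof -
  define N where "N = 4 * K"
  define \<phi> where "\<phi> j = h * real (min j (N - j))" for j
  define U where "U j = S (real j * h) u" for j
  define g where "g j = \<phi> j *\<^sub>R U j" for j
  define p where "p j = (1/2) *\<^sub>R (g (Suc j) + g j)" for j
\<comment> \<open>\<open>q\<close> and \<open>r\<close> are the errors of the first time step; by contractivity they bound those of all steps.\<close>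
  define q where "q = (1/h) *\<^sub>R (S h u - u) - A u"
  define r where "r = S h (A u) - A u"
  define E where "E = T/2 * seminorm q + h/2 * seminorm (A u) + T/4 * seminorm r"
  note S' = contraction_semigroupD[OF S] and u' = generator_ofD[OF gen u]
    and comm = semigroup_commutes_with_generator[OF S gen u] and A = linear_operatorD[OF lin]
  note L = linear_operatorD[OF S'(1)]
  have sub: "subspace X"
    using L(1)[of 0] by simp
  have h: "h > 0"
    using T K by (simp add: h_def)
  have jh: "0 \<le> real j * h" for j
    using h by simp
  have Nh: "real N * h = T"
    using K by (simp add: N_def h_def)
  have UD: "U j \<in> D" for j
    unfolding U_def by (rule comm[OF jh])
  have AU: "A (U j) = S (real j * h) (A u)" for j
    unfolding U_def by (rule comm[OF jh])
  have qX: "q \<in> X" and rX: "r \<in> X"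
    unfolding q_def r_def using u' h by (auto intro!: subspace_diff subspace_scale sub L)
  have Suc_h: "S (real (Suc j) * h) v = S (real j * h) (S h v)" if "v \<in> X" for j v
    using S'(3)[OF jh _ that, of h j] h by (simp add: algebra_simps)
  have step: "U (Suc j) = U j + h *\<^sub>R (A (U j) + S (real j * h) q)" for j
  proof -
    have "S h u = u + h *\<^sub>R (A u + q)"
      using h by (simp add: q_def)
    moreover have "S (real j * h) (u + h *\<^sub>R (A u + q))
        = S (real j * h) u + h *\<^sub>R (S (real j * h) (A u) + S (real j * h) q)"
      using qX u' by (simp add: L[OF jh] subspace_add subspace_scale sub)
    moreover have "U (Suc j) = S (real j * h) (S h u)"
      unfolding U_def by (rule Suc_h[OF u'(1)])
    ultimately show ?thesis
      unfolding AU by (simp add: U_def)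
  qed
  have Astep: "A (U (Suc j)) = A (U j) + S (real j * h) r" for j
    unfolding AU Suc_h[OF u'(2)] using L(4)[OF jh u'(2) rX] by (simp add: r_def)
  have \<phi>_le: "0 \<le> \<phi> j" "\<phi> j \<le> T/2" for j
  proof -
    have "real (min j (N - j)) \<le> real N / 2"
      by (auto simp: min_def)
    then have "h * real (min j (N - j)) \<le> h * (real N / 2)"
      using h by (intro mult_left_mono) auto
    then show "\<phi> j \<le> T/2"
      using Nh by (simp add: \<phi>_def mult.commute)
    show "0 \<le> \<phi> j"
      using h by (simp add: \<phi>_def)
  qed
  have \<phi>_diff: "\<bar>\<phi> (Suc j) - \<phi> j\<bar> \<le> h" for j
  proof -
    have "\<bar>real (min (Suc j) (N - Suc j)) - real (min j (N - j))\<bar> \<le> 1"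
      by (auto simp: min_def)
    then have "h * \<bar>real (min (Suc j) (N - Suc j)) - real (min j (N - j))\<bar> \<le> h * 1"
      using h by (intro mult_left_mono) auto
    then show ?thesis
      using h by (simp add: \<phi>_def abs_mult flip: right_diff_distrib)
  qed
  have F: "seminorm ((1/h) *\<^sub>R (g (Suc j) - g j) - A (p j)) \<le> seminorm u + E" for j
  proof -
    define \<delta> where "\<delta> = (\<phi> (Suc j) - \<phi> j) / h"
    have \<delta>: "\<bar>\<delta>\<bar> \<le> 1" and \<phi>_Suc: "\<phi> (Suc j) = \<phi> j + h * \<delta>"
      using \<phi>_diff[of j] h by (simp_all add: \<delta>_def)
    have Ap: "A (p j) = (1/2) *\<^sub>R (\<phi> (Suc j) *\<^sub>R A (U (Suc j)) + \<phi> j *\<^sub>R A (U j))"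
      by (simp add: p_def g_def A UD subspace_add subspace_scale)
    define a y z where "a = A (U j)" and "y = S (real j * h) q" and "z = S (real j * h) r"
    have "(1/h) *\<^sub>R (g (Suc j) - g j) = \<delta> *\<^sub>R U (Suc j) + (\<phi> j / h) *\<^sub>R (U (Suc j) - U j)"
      using h by (simp add: g_def \<phi>_Suc algebra_simps)
    also have "U (Suc j) - U j = h *\<^sub>R (a + y)"
      by (simp add: step a_def y_def)
    also have "(\<phi> j / h) *\<^sub>R (h *\<^sub>R (a + y)) = \<phi> j *\<^sub>R a + \<phi> j *\<^sub>R y"
      using h by (simp add: scaleR_add_right)
    finally have d: "(1/h) *\<^sub>R (g (Suc j) - g j) = \<delta> *\<^sub>R U (Suc j) + (\<phi> j *\<^sub>R a + \<phi> j *\<^sub>R y)" .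
    have "A (p j) = (\<phi> (Suc j) / 2) *\<^sub>R (a + z) + (\<phi> j / 2) *\<^sub>R a"
      unfolding Ap Astep by (simp add: a_def z_def scaleR_add_right)
    also have "\<dots> = \<phi> j *\<^sub>R a + (h/2 * \<delta>) *\<^sub>R a + (\<phi> (Suc j) / 2) *\<^sub>R z"
      by (simp add: \<phi>_Suc scaleR_add_right add_divide_distrib flip: scaleR_add_left)
    finally have "(1/h) *\<^sub>R (g (Suc j) - g j) - A (p j)
        = \<delta> *\<^sub>R U (Suc j) + \<phi> j *\<^sub>R y - ((h/2 * \<delta>) *\<^sub>R a + (\<phi> (Suc j) / 2) *\<^sub>R z)"
      unfolding d by simp
    then have "seminorm ((1/h) *\<^sub>R (g (Suc j) - g j) - A (p j))
        \<le> \<bar>\<delta>\<bar> * seminorm (U (Suc j)) + \<phi> j * seminorm y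
          + (h/2 * \<bar>\<delta>\<bar> * seminorm a + \<phi> (Suc j) / 2 * seminorm z)"
      using seminorm_diff[of "\<delta> *\<^sub>R U (Suc j) + \<phi> j *\<^sub>R y" "(h/2 * \<delta>) *\<^sub>R a + (\<phi> (Suc j) / 2) *\<^sub>R z"]
        seminorm_add[of "\<delta> *\<^sub>R U (Suc j)" "\<phi> j *\<^sub>R y"]
        seminorm_add[of "(h/2 * \<delta>) *\<^sub>R a" "(\<phi> (Suc j) / 2) *\<^sub>R z"] h \<phi>_le[of j] \<phi>_le[of "Suc j"]
      by (simp add: seminorm_scaleR abs_mult)
    also have "\<dots> \<le> 1 * seminorm u + T/2 * seminorm q + (h/2 * 1 * seminorm (A u) + T/2 / 2 * seminorm r)"
    proof (intro add_mono mult_mono \<delta> \<phi>_le divide_right_mono)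
      show "seminorm (U (Suc j)) \<le> seminorm u"
        unfolding U_def using S'(5)[OF jh u'(1), of "Suc j"] by simp
      show "seminorm y \<le> seminorm q" "seminorm a \<le> seminorm (A u)" "seminorm z \<le> seminorm r"
        unfolding y_def a_def z_def AU using S'(5)[OF jh] qX rX u' by auto
    qed (use h T in auto)
    finally show ?thesis
      by (simp add: E_def)
  qed
  have decr: "seminorm (S T u) \<le> seminorm (U j)" if "j \<le> N" for j
  proof -
    have "S T u = S (real (N - j) * h) (U j)"
      using S'(3)[OF jh jh u'(1), of "N - j" j] that
      by (simp add: U_def Nh flip: distrib_right of_nat_add)
    moreover have "U j \<in> X"
      using A(2) UD by blast
    ultimately show ?thesis
      using S'(5)[OF jh] by simp
  qed
  define M where "M = T/4 * seminorm (S T u) - T/4 * seminorm (S h u - u)"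
  have low: "M \<le> seminorm (p j)" if j: "K \<le> j" "j < 3 * K" for j
  proof -
    have ge: "\<phi> j \<ge> T/4" "\<phi> (Suc j) \<ge> T/4"
    proof -
      have "real K * h = T/4"
        using K by (simp add: h_def)
      moreover have "real K * h \<le> real (min j (N - j)) * h"
          "real K * h \<le> real (min (Suc j) (N - Suc j)) * h"
        using j h by (intro mult_right_mono; simp add: N_def)+
      ultimately show "\<phi> j \<ge> T/4" "\<phi> (Suc j) \<ge> T/4"
        by (simp_all add: \<phi>_def mult.commute)
    qed
    have ud: "seminorm (U (Suc j) - U j) \<le> seminorm (S h u - u)"
    proof -
      have "U (Suc j) - U j = S (real j * h) (S h u - u)"
        unfolding U_def Suc_h[OF u'(1)] using u' h by (simp add: L)
      moreover have "S h u - u \<in> X"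
        using u' h by (auto intro!: subspace_diff sub L)
      ultimately show ?thesis
        using S'(5)[OF jh] by simp
    qed
    define w where "w = (\<phi> (Suc j) / 2) *\<^sub>R (U (Suc j) - U j)"
    define v where "v = ((\<phi> (Suc j) + \<phi> j) / 2) *\<^sub>R U j"
    have "p j = v - (- w)"
      by (simp add: p_def g_def v_def w_def algebra_simps add_divide_distrib)
    then have "seminorm v \<le> seminorm (p j) + seminorm w"
      using seminorm_triangle[of v "- w"] by (simp add: seminorm_minus)
    moreover have "seminorm w \<le> T/2/2 * seminorm (S h u - u)"
    proof -
      have "seminorm w = \<phi> (Suc j) / 2 * seminorm (U (Suc j) - U j)"
        using \<phi>_le[of "Suc j"] by (simp add: w_def seminorm_scaleR)
      also have "\<dots> \<le> T/2/2 * seminorm (S h u - u)"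
        using \<phi>_le[of "Suc j"] ud T by (intro mult_mono) simp_all
      finally show ?thesis .
    qed
    moreover have "T/4 * seminorm (S T u) \<le> seminorm v"
    proof -
      have "T/4 * seminorm (S T u) \<le> (\<phi> (Suc j) + \<phi> j) / 2 * seminorm (U j)"
        using ge decr[of j] j T by (intro mult_mono) (auto simp: N_def)
      then show ?thesis
        using \<phi>_le[of j] \<phi>_le[of "Suc j"] by (simp add: v_def seminorm_scaleR)
    qed
    ultimately show ?thesis
      by (simp add: M_def)
  qed
  have E0: "0 \<le> E"
    using h T by (simp add: E_def)
  have "M \<le> 2 * C * (seminorm u + E)"
  proof (cases "M \<le> 0")
    case True
    then show ?thesis
      using C E0 by (smt (verit) seminorm_nonneg mult_nonneg_nonneg)
  next
    case False
    have "2 * real K * M\<^sup>2 = (\<Sum>j\<in>{K..<3*K}. M\<^sup>2)"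
      by simp
    also have "\<dots> \<le> (\<Sum>j\<in>{K..<3*K}. (seminorm (p j))\<^sup>2)"
      using low False by (intro sum_mono power_mono) auto
    also have "\<dots> \<le> (\<Sum>j<N. (seminorm (p j))\<^sup>2)"
      by (intro sum_mono2) (auto simp: N_def)
    also have "\<dots> \<le> C\<^sup>2 * (\<Sum>j<N. (seminorm ((1/h) *\<^sub>R (g (Suc j) - g j) - A (p j)))\<^sup>2)"
      unfolding p_def
    proof (rule discrete_resolvent_estimate[OF lin])
      show "g j \<in> D" for j
        unfolding g_def by (intro subspace_scale A UD)
      show "g 0 = 0" "g N = 0"
        by (simp_all add: g_def \<phi>_def)
    qed (use h res in auto)
    also have "\<dots> \<le> C\<^sup>2 * (\<Sum>j<N. (seminorm u + E)\<^sup>2)"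
      using F by (intro mult_left_mono sum_mono power_mono) auto
    also have "\<dots> = 2 * real K * (2 * C\<^sup>2 * (seminorm u + E)\<^sup>2)"
      by (simp add: N_def)
    finally have "M\<^sup>2 \<le> 2 * C\<^sup>2 * (seminorm u + E)\<^sup>2"
      using K by simp
    also have "\<dots> \<le> (2 * C * (seminorm u + E))\<^sup>2"
      by (simp add: power_mult_distrib mult_right_mono)
    finally show ?thesis
      using C E0 by (intro power2_le_imp_le[of M]) auto
  qed
  then show ?thesis
    by (simp add: M_def E_def q_def r_def)
qed

text \<open>The mesh tends to \<open>0\<close>. The errors vanish because \<open>u\<close> lies in the domain of the generator and because
  the semigroup is strongly continuous at \<open>u\<close> and at \<open>A u\<close>.\<close>

lemma semigroup_bound:
  assumes S: "contraction_semigroup X seminorm S" and gen: "generator_of X seminorm D A S"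
    and lin: "linear_operator X D A"
    and C: "C > 0"
    and res: "\<And>t u v. u \<in> D \<Longrightarrow> v \<in> D \<Longrightarrow> (seminorm u)\<^sup>2 + (seminorm v)\<^sup>2 \<le>
        C\<^sup>2 * ((seminorm (- (t *\<^sub>R v) - A u))\<^sup>2 + (seminorm (t *\<^sub>R u - A v))\<^sup>2)"
    and u: "u \<in> D" and T: "T > 0"
  shows "T/4 * seminorm (S T u) \<le> 2 * C * seminorm u"
proof -
  define B where "B h = T/4 * seminorm (S h u - u) + 2 * C * (seminorm u
     + (T/2 * seminorm ((1/h) *\<^sub>R (S h u - u) - A u) + h/2 * seminorm (A u)
        + T/4 * seminorm (S h (A u) - A u)))" for h
  note u' = generator_ofD[OF gen u]
  have "(B \<longlongrightarrow> T/4 * 0 + 2 * C * (seminorm u + (T/2 * 0 + 0/2 * seminorm (A u) + T/4 * 0)))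
      (at_right 0)"
    unfolding B_def by (intro tendsto_intros u' contraction_semigroupD(4)[OF S]) auto
  moreover have "filterlim (\<lambda>K. T / (4 * real (Suc K))) (at_right 0) sequentially"
  proof (rule filterlim_at_withinI)
    have "(\<lambda>K. T / (4 * real K)) \<longlonglongrightarrow> 0"
      using tendsto_mult_left[OF lim_inverse_n', of "T/4"] by simp
    then show "(\<lambda>K. T / (4 * real (Suc K))) \<longlonglongrightarrow> 0"
      by (rule LIMSEQ_Suc)
  qed (use T in \<open>auto simp: eventually_sequentially\<close>)
  ultimately have "(\<lambda>K. B (T / (4 * real (Suc K)))) \<longlonglongrightarrow>
      T/4 * 0 + 2 * C * (seminorm u + (T/2 * 0 + 0/2 * seminorm (A u) + T/4 * 0))"
    by (rule filterlim_compose)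
  then have "(\<lambda>K. B (T / (4 * real (Suc K)))) \<longlonglongrightarrow> 2 * C * seminorm u"
    by simp
  then show ?thesis
  proof (rule LIMSEQ_le_const, intro exI allI impI)
    show "T/4 * seminorm (S T u) \<le> B (T / (4 * real (Suc K)))" for K
      unfolding B_def by (rule semigroup_bound_discrete[OF S gen lin C res u T zero_less_Suc])
  qed
qed

text \<open>The bound for a single orbit improves with \<open>T\<close>, and at \<open>T = 16 C\<close> it is the contraction factor
  \<open>1/2\<close>. Density and contractivity extend this from \<open>D\<close> to all of \<open>X\<close>, and the semigroup law turns it
  into exponential decay.\<close>

theorem contraction_semigroup_exponentially_stable:
  assumes S: "contraction_semigroup X seminorm S" and gen: "generator_of X seminorm D A S"
    and lin: "linear_operator X D A"
    and dense: "\<And>u e. u \<in> X \<Longrightarrow> e > 0 \<Longrightarrow> \<exists>v\<in>D. seminorm (u - v) < e"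
    and C: "C > 0"
    and res: "\<And>t u v. u \<in> D \<Longrightarrow> v \<in> D \<Longrightarrow> (seminorm u)\<^sup>2 + (seminorm v)\<^sup>2 \<le>
        C\<^sup>2 * ((seminorm (- (t *\<^sub>R v) - A u))\<^sup>2 + (seminorm (t *\<^sub>R u - A v))\<^sup>2)"
  shows "exponentially_stable X seminorm S"
proof -
  define T where "T = 16 * C"
  have T: "T > 0"
    using C by (simp add: T_def)
  note S' = contraction_semigroupD[OF S] and A = linear_operatorD[OF lin]
  note L = linear_operatorD[OF S'(1)]
  have sub: "subspace X"
    using L(1)[of 0] by simp
  have half: "seminorm (S T u) \<le> seminorm u / 2" if u: "u \<in> X" for u
  proof (rule field_le_epsilon)
    fix e :: real assume "e > 0"
    then obtain v where v: "v \<in> D" "seminorm (u - v) < e / 2"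
      using dense[OF u, of "e/2"] by auto
    have vX: "v \<in> X"
      using v A(2) by blast
    have "seminorm (S T v) \<le> seminorm v / 2"
      using semigroup_bound[OF S gen lin C res v(1) T] C by (simp add: T_def)
    moreover have "seminorm (S T u) \<le> seminorm (S T (u - v)) + seminorm (S T v)"
      using seminorm_triangle[of "S T u" "S T v"] L(6)[of T u v] u vX T by simp
    moreover have "seminorm (S T (u - v)) \<le> seminorm (u - v)"
      using S'(5) T u vX by (simp add: subspace_diff sub)
    moreover have "seminorm v \<le> seminorm (u - v) + seminorm u"
      using seminorm_diff[of u "u - v"] by simp
    ultimately show "seminorm (S T u) \<le> seminorm u / 2 + e"
      using v(2) \<open>e > 0\<close> by linarith
  qed
  have pow: "seminorm (S (real n * T) u) \<le> (1/2)^n * seminorm u" if "u \<in> X" for n u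
  proof (induction n)
    case (Suc n)
    have "S (real (Suc n) * T) u = S T (S (real n * T) u)"
      using S'(3)[of T "real n * T" u] T that by (simp add: algebra_simps)
    moreover have "S (real n * T) u \<in> X"
      using T that by (intro L) auto
    ultimately show ?case
      using half[of "S (real n * T) u"] Suc by simp
  qed (simp add: S'(2) that)
  define \<omega> where "\<omega> = ln 2 / T"
  have "seminorm (S t u) \<le> 2 * exp (- \<omega> * t) * seminorm u" if t: "t \<ge> 0" and u: "u \<in> X" for t u
  proof -
    define n where "n = nat \<lfloor>t / T\<rfloor>"
    have n: "real n \<le> t / T" "t / T < real n + 1"
      using t T by (auto simp: n_def of_nat_nat)
    define s where "s = t - real n * T"
    have s: "s \<ge> 0"
      using n T by (simp add: s_def field_simps)
    have "S t u = S s (S (real n * T) u)"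
      using S'(3)[OF s, of "real n * T" u] T u by (simp add: s_def)
    moreover have "S (real n * T) u \<in> X"
      using T u by (intro L) auto
    ultimately have "seminorm (S t u) \<le> (1/2)^n * seminorm u"
      using S'(5)[OF s, of "S (real n * T) u"] pow[OF u, of n] by simp
    also have "(1/2::real)^n = exp (- ln 2 * real n)"
      by (simp add: exp_of_nat_mult[symmetric] exp_minus power_one_over exp_of_nat2_mult inverse_eq_divide flip: exp_of_nat_mult)
    also have "\<dots> \<le> exp (ln 2 - \<omega> * t)"
    proof -
      have "ln 2 * (t / T) \<le> ln 2 * (real n + 1)"
        using n by (intro mult_left_mono) auto
      then show ?thesis
        by (simp add: \<omega>_def algebra_simps)
    qed
    also have "\<dots> = 2 * exp (- \<omega> * t)"
      by (simp add: exp_diff exp_minus divide_inverse)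
    finally show ?thesis
      by (simp add: mult_right_mono)
  qed
  moreover have "\<omega> > 0"
    using T by (simp add: \<omega>_def)
  ultimately show ?thesis
    unfolding exponentially_stable_def by (intro exI[of _ 2] conjI exI[of _ \<omega>]) auto
qed

end

section \<open>Smooth functions\<close>

definition smooth :: "(real \<Rightarrow> 'b::real_normed_vector) \<Rightarrow> bool" where
  "smooth f \<longleftrightarrow> (\<forall>k x. (vderiv ^^ k) f differentiable (at x))"

text \<open>Iterated derivatives need never be computed: it is enough to find a family of differentiable
  functions that is closed under derivation.\<close>

lemma smooth_coinduct:
  assumes "f \<in> F" "\<And>g x. g \<in> F \<Longrightarrow> g differentiable (at x)" "\<And>g. g \<in> F \<Longrightarrow> vderiv g \<in> F"
  shows "smooth f"
proof -
  have "(vderiv ^^ k) f \<in> F" for k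
    by (induction k) (auto simp: assms)
  then show ?thesis
    by (auto simp: smooth_def intro: assms)
qed

lemma smooth_differentiable: "smooth f \<Longrightarrow> f differentiable (at x)"
  unfolding smooth_def by (metis funpow_0)

lemma smooth_has_vderiv: "smooth f \<Longrightarrow> (f has_vector_derivative vderiv f x) (at x)"
  using smooth_differentiable[of f x] by (simp add: vderiv_def vector_derivative_works)

lemma smooth_vderiv: "smooth f \<Longrightarrow> smooth (vderiv f)"
  unfolding smooth_def by (metis comp_apply funpow_Suc_right)

lemma vderivI: "(\<And>x. (f has_vector_derivative f' x) (at x)) \<Longrightarrow> vderiv f = f'"
  by (auto simp: vderiv_def fun_eq_iff intro!: vector_derivative_at)

lemma smoothI_vderiv:
  assumes "\<And>x. (f has_vector_derivative f' x) (at x)" "smooth f'"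
  shows "smooth f"
proof (rule smooth_coinduct[of _ "insert f (Collect smooth)"])
  show "g differentiable at x" if "g \<in> insert f (Collect smooth)" for g x
    using that assms(1)[of x] by (auto intro: smooth_differentiable differentiableI_vector)
  show "vderiv g \<in> insert f (Collect smooth)" if "g \<in> insert f (Collect smooth)" for g
    using that smooth_vderiv vderivI[OF assms(1)] assms(2) by auto
qed simp

lemma smooth_continuous_on: "smooth f \<Longrightarrow> continuous_on S f"
  by (meson continuous_at_imp_continuous_on differentiable_imp_continuous_within smooth_differentiable)

lemma smooth_const: "smooth (\<lambda>_. c)"
proof (rule smooth_coinduct[of _ "range (\<lambda>c _. c)"])
  show "vderiv g \<in> range (\<lambda>c _. c)" if "g \<in> range (\<lambda>c _. c)" for g :: "real \<Rightarrow> 'a"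
  proof -
    from that obtain c where "g = (\<lambda>_. c)"
      by auto
    then have "vderiv g = (\<lambda>_. 0)"
      by (intro vderivI) simp
    then show ?thesis
      by blast
  qed
qed auto

lemma smooth_add:
  assumes "smooth f" "smooth g"
  shows "smooth (\<lambda>x. f x + g x)"
proof (rule smooth_coinduct[of _ "{\<lambda>x. f x + g x | f g. smooth f \<and> smooth g}"])
  fix h :: "real \<Rightarrow> 'a" assume "h \<in> {\<lambda>x. f x + g x | f g. smooth f \<and> smooth g}"
  then obtain f g where h: "h = (\<lambda>x. f x + g x)" "smooth f" "smooth g"
    by auto
  have d: "(h has_vector_derivative vderiv f x + vderiv g x) (at x)" for x
    unfolding h by (intro has_vector_derivative_add smooth_has_vderiv h)
  show "h differentiable at x" for x
    using d by (rule differentiableI_vector)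
  show "vderiv h \<in> {\<lambda>x. f x + g x | f g. smooth f \<and> smooth g}"
    using vderivI[OF d] h smooth_vderiv by blast
qed (use assms in auto)

text \<open>By the product rule the finite sums of products are closed under derivation, although single
  products are not.\<close>

lemma smooth_bilinear:
  fixes B :: "'a::real_normed_vector \<Rightarrow> 'b::real_normed_vector \<Rightarrow> 'c::real_normed_vector"
  assumes bil: "bounded_bilinear B" and fg: "smooth f" "smooth g"
  shows "smooth (\<lambda>x. B (f x) (g x))"
proof -
  define F where "F = {\<lambda>x. \<Sum>i<n. B (f i x) (g i x) | (n::nat) f g.
    (\<forall>i. smooth (f i)) \<and> (\<forall>i. smooth (g i))}"
  have B_in: "(\<lambda>x. \<Sum>i<n. B (f i x) (g i x)) \<in> F"
    if "\<And>i. smooth (f i)" "\<And>i. smooth (g i)" for n :: nat and f g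
    using that unfolding F_def by blast
  show ?thesis
  proof (rule smooth_coinduct[of _ F])
    show "(\<lambda>x. B (f x) (g x)) \<in> F"
      using B_in[of "\<lambda>_. f" "\<lambda>_. g" 1] fg by simp
    fix h assume "h \<in> F"
    then obtain n :: nat and f g where h: "h = (\<lambda>x. \<Sum>i<n. B (f i x) (g i x))"
      and s: "\<And>i. smooth (f i)" "\<And>i. smooth (g i)"
      unfolding F_def by auto
    have d: "(h has_vector_derivative (\<Sum>i<n. B (f i x) (vderiv (g i) x) + B (vderiv (f i) x) (g i x)))
        (at x)" for x
      unfolding h
      by (intro has_vector_derivative_sum bounded_bilinear.has_vector_derivative[OF bil] smooth_has_vderiv s)
    show "h differentiable at x" for x
      using d by (rule differentiableI_vector)
    define f' where "f' i = (if i < n then f i else vderiv (f (i - n)))" for i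
    define g' where "g' i = (if i < n then vderiv (g i) else g (i - n))" for i
    have split: "(\<Sum>i<n + m. X i) = (\<Sum>i<n. X i) + (\<Sum>i<m. X (n + i))"
      for m and X :: "nat \<Rightarrow> 'c"
      by (induction m) (auto simp: add.assoc)
    have "(\<Sum>i<n. B (f i x) (vderiv (g i) x) + B (vderiv (f i) x) (g i x))
        = (\<Sum>i<n + n. B (f' i x) (g' i x))" for x
      unfolding split by (simp add: sum.distrib f'_def g'_def)
    then have "vderiv h = (\<lambda>x. \<Sum>i<n + n. B (f' i x) (g' i x))"
      using vderivI[OF d] by simp
    then show "vderiv h \<in> F"
      using B_in[of f' g' "n + n"] s by (simp add: f'_def g'_def smooth_vderiv)
  qed
qed

lemma smooth_affine:
  assumes "smooth f"
  shows "smooth (\<lambda>x. f (p * x + q))"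
proof (rule smooth_coinduct[of _ "{\<lambda>x. c *\<^sub>R f (p * x + q) | c f. smooth f}"])
  show "(\<lambda>x. f (p * x + q)) \<in> {\<lambda>x. c *\<^sub>R f (p * x + q) | c f. smooth f}"
    using assms by (intro CollectI exI[of _ 1] exI[of _ f]) simp
  fix h :: "real \<Rightarrow> 'a" assume "h \<in> {\<lambda>x. c *\<^sub>R f (p * x + q) | c f. smooth f}"
  then obtain c f where h: "h = (\<lambda>x. c *\<^sub>R f (p * x + q))" "smooth f"
    by auto
  have d: "(h has_vector_derivative ((c * p) *\<^sub>R vderiv f (p * x + q))) (at x)" for x
  proof -
    have "((\<lambda>x. p * x + q) has_vector_derivative p) (at x)"
      by (auto intro!: derivative_eq_intros)
    from vector_diff_chain_at[OF this smooth_has_vderiv[OF h(2)]]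
    have "((\<lambda>x. f (p * x + q)) has_vector_derivative p *\<^sub>R vderiv f (p * x + q)) (at x)"
      by (simp add: o_def)
    from has_vector_derivative_scaleR[OF DERIV_const[of c] this] show ?thesis
      unfolding h by simp
  qed
  show "h differentiable at x" for x
    using d by (rule differentiableI_vector)
  show "vderiv h \<in> {\<lambda>x. c *\<^sub>R f (p * x + q) | c f. smooth f}"
    unfolding vderivI[OF d] using smooth_vderiv[OF h(2)] by blast
qed

text \<open>For \<open>p = 1\<close> this is the classical function \<open>exp (- 1/x)\<close> that is flat at \<open>0\<close>. The factor \<open>p (1/x)\<close>
  makes the family closed under derivation.\<close>

definition flat :: "real poly \<Rightarrow> real \<Rightarrow> real" where
  "flat p x = (if x > 0 then poly p (1 / x) * exp (- (1 / x)) else 0)"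

lemma poly_exp_decay: "((\<lambda>y. poly p y * exp (- y)) \<longlongrightarrow> (0::real)) at_top"
proof -
  have "((\<lambda>y. \<Sum>i\<le>degree p. coeff p i * (y ^ i / exp y)) \<longlongrightarrow> (\<Sum>i\<le>degree p. coeff p i * 0)) at_top"
    by (intro tendsto_intros tendsto_power_div_exp_0)
  then show ?thesis
    by (simp add: poly_altdef sum_distrib_right exp_minus divide_inverse mult.assoc)
qed

text \<open>At \<open>0\<close> the difference quotient tends to \<open>0\<close>, since the exponential beats every polynomial in
  \<open>1/x\<close>.\<close>

lemma flat_has_derivative:
  "(flat p has_real_derivative flat ((p - pderiv p) * [:0, 0, 1:]) x) (at x)"
proof -
  consider "x > 0" | "x < 0" | "x = 0"
    by linarith
  then show ?thesis
  proof cases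
    case 1
    have "((\<lambda>x. poly p (1 / x) * exp (- (1 / x))) has_real_derivative
        flat ((p - pderiv p) * [:0, 0, 1:]) x) (at x)"
      using 1 by (auto intro!: derivative_eq_intros DERIV_chain2[OF poly_DERIV]
          simp: flat_def field_simps power2_eq_square)
    then show ?thesis
      by (rule has_field_derivative_transform_within_open[of _ _ _ "{0<..}"])
        (use 1 in \<open>auto simp: flat_def\<close>)
  next
    case 2
    have "((\<lambda>x. 0) has_real_derivative flat ((p - pderiv p) * [:0, 0, 1:]) x) (at x)"
      using 2 by (simp add: flat_def)
    then show ?thesis
      by (rule has_field_derivative_transform_within_open[of _ _ _ "{..<0}"])
        (use 2 in \<open>auto simp: flat_def\<close>)
  next
    case 3
    have "((\<lambda>h. flat p h / h) \<longlongrightarrow> 0) (at_right 0)"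
    proof (rule Lim_transform_eventually)
      show "((\<lambda>h. poly (p * [:0, 1:]) (inverse h) * exp (- inverse h)) \<longlongrightarrow> 0) (at_right 0)"
        by (rule filterlim_compose[OF poly_exp_decay filterlim_inverse_at_top_right])
      show "\<forall>\<^sub>F h in at_right 0. poly (p * [:0, 1:]) (inverse h) * exp (- inverse h) = flat p h / h"
        by (auto simp: eventually_at_filter flat_def divide_inverse)
    qed
    moreover have "((\<lambda>h. flat p h / h) \<longlongrightarrow> 0) (at_left 0)"
      by (rule Lim_transform_eventually[OF tendsto_const]) (auto simp: eventually_at_filter flat_def)
    ultimately have "((\<lambda>h. flat p h / h) \<longlongrightarrow> 0) (at 0)"
      by (intro filterlim_split_at)
    moreover have "flat q 0 = 0" for q
      by (simp add: flat_def)
    ultimately show ?thesis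
      unfolding 3 DERIV_def by simp
  qed
qed

lemma smooth_flat: "smooth (flat p)"
proof (rule smooth_coinduct[of _ "range flat"])
  fix g assume "g \<in> range flat"
  then obtain p where g: "g = flat p"
    by auto
  note d = flat_has_derivative[THEN has_real_derivative_iff_has_vector_derivative[THEN iffD1], of p]
  show "g differentiable at x" for x
    unfolding g using d by (rule differentiableI_vector)
  show "vderiv g \<in> range flat"
    unfolding g vderivI[OF d] by blast
qed simp

text \<open>As \<open>r\<close> grows, these functions converge pointwise to the indicator function of \<open>(\<alpha>,\<beta>)\<close> and stay
  between \<open>0\<close> and \<open>1\<close>, so that dominated convergence applies without any normalisation.\<close>

definition bump :: "real \<Rightarrow> real \<Rightarrow> real \<Rightarrow> real \<Rightarrow> real" where
  "bump \<alpha> \<beta> r x = flat 1 (r * (x - \<alpha>)) * flat 1 (r * (\<beta> - x))"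

lemma smooth_bump: "smooth (bump \<alpha> \<beta> r)"
  unfolding bump_def
  using smooth_bilinear[OF bounded_bilinear_mult smooth_affine[OF smooth_flat, of 1 r "- r * \<alpha>"]
      smooth_affine[OF smooth_flat, of 1 "- r" "r * \<beta>"]]
  by (simp add: algebra_simps)

lemma bump_bounds: "0 \<le> bump \<alpha> \<beta> r x" "bump \<alpha> \<beta> r x \<le> 1"
proof -
  have "0 \<le> flat 1 y" "flat 1 y \<le> 1" for y
    by (simp_all add: flat_def)
  then show "0 \<le> bump \<alpha> \<beta> r x" "bump \<alpha> \<beta> r x \<le> 1"
    by (simp_all add: bump_def mult_le_one)
qed

lemma bump_pos: "r > 0 \<Longrightarrow> bump \<alpha> \<beta> r x > 0 \<longleftrightarrow> \<alpha> < x \<and> x < \<beta>"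
  by (auto simp: bump_def flat_def zero_less_mult_iff)

lemma bump_eq_0: "r > 0 \<Longrightarrow> \<not> (\<alpha> < x \<and> x < \<beta>) \<Longrightarrow> bump \<alpha> \<beta> r x = 0"
  using bump_pos[of r \<alpha> \<beta> x] bump_bounds(1)[of \<alpha> \<beta> r x] by linarith

section \<open>Test functions\<close>

lemma test_functions_iff:
  "\<phi> \<in> test_functions a b \<longleftrightarrow> smooth \<phi> \<and> compact (closure {x. \<phi> x \<noteq> 0}) \<and> closure {x. \<phi> x \<noteq> 0} \<subseteq> {a<..<b}"
  by (simp add: test_functions_def smooth_def)

lemma test_functionI_compact:
  assumes "smooth \<phi>" "\<And>x. \<phi> x \<noteq> 0 \<Longrightarrow> x \<in> S" "compact S" "S \<subseteq> {a<..<b}"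
  shows "\<phi> \<in> test_functions a b"
proof -
  have "closure {x. \<phi> x \<noteq> 0} \<subseteq> S"
    using assms by (intro closure_minimal compact_imp_closed) auto
  moreover from this have "compact (closure {x. \<phi> x \<noteq> 0})"
    using compact_Int_closed[OF assms(3) closed_closure, of "{x. \<phi> x \<noteq> 0}"]
    by (simp only: Int_absorb1)
  ultimately show ?thesis
    unfolding test_functions_iff using assms by blast
qed

lemma test_functionI:
  assumes "smooth \<phi>" "a < \<alpha>" "\<beta> < b" "\<And>x. \<phi> x \<noteq> 0 \<Longrightarrow> \<alpha> \<le> x \<and> x \<le> \<beta>"
  shows "\<phi> \<in> test_functions a b"
  by (rule test_functionI_compact[of _ "{\<alpha>..\<beta>}"]) (use assms in auto)

lemma test_functionE:
  assumes "\<phi> \<in> test_functions a b" "a < b"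
  obtains \<alpha> \<beta> where "a < \<alpha>" "\<alpha> < \<beta>" "\<beta> < b" "\<And>x. \<phi> x \<noteq> 0 \<Longrightarrow> \<alpha> < x \<and> x < \<beta>"
proof -
\<comment> \<open>The midpoint is added so that the interval exists also for the zero function.\<close>
  define K where "K = insert ((a + b) / 2) (closure {x. \<phi> x \<noteq> 0})"
  have K: "compact K" "K \<noteq> {}" "K \<subseteq> {a<..<b}"
    using assms by (auto simp: K_def test_functions_iff)
  obtain s where s: "s \<in> K" "\<And>x. x \<in> K \<Longrightarrow> s \<le> x"
    using compact_attains_inf[OF K(1,2)] by blast
  obtain t where t: "t \<in> K" "\<And>x. x \<in> K \<Longrightarrow> x \<le> t"
    using compact_attains_sup[OF K(1,2)] by blast
  have st: "a < s" "s \<le> t" "t < b"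
    using s(1) t(1) s(2)[OF t(1)] K(3) by auto
  show ?thesis
  proof
    show "a < (a + s) / 2" "(t + b) / 2 < b" "(a + s) / 2 < (t + b) / 2"
      using st by simp_all
    fix x assume "\<phi> x \<noteq> 0"
    then have "x \<in> K"
      by (auto simp: K_def intro: closure_subset[THEN subsetD])
    then have "s \<le> x" "x \<le> t"
      using s t by auto
    with st show "(a + s) / 2 < x \<and> x < (t + b) / 2"
      by simp
  qed
qed

lemma test_function_smooth: "\<phi> \<in> test_functions a b \<Longrightarrow> smooth \<phi>"
  by (simp add: test_functions_iff)

lemma subspace_test_functions:
  shows "(\<lambda>_. 0) \<in> test_functions a b"
    and "\<phi> \<in> test_functions a b \<Longrightarrow> \<psi> \<in> test_functions a b \<Longrightarrow> (\<lambda>x. \<phi> x + \<psi> x) \<in> test_functions a b"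
    and "\<kappa> \<in> test_functions a b \<Longrightarrow> (\<lambda>x. \<kappa> x *\<^sub>R v) \<in> test_functions a b"
    and "\<phi> \<in> test_functions a b \<Longrightarrow> (\<lambda>x. r *\<^sub>R \<phi> x) \<in> test_functions a b"
proof -
  show "(\<lambda>_. 0) \<in> test_functions a b"
    using smooth_const[of 0] by (simp add: test_functions_iff)
  have supp: "smooth \<phi>" "\<phi> x \<noteq> 0 \<Longrightarrow> x \<in> closure {x. \<phi> x \<noteq> 0}"
      "compact (closure {x. \<phi> x \<noteq> 0})" "closure {x. \<phi> x \<noteq> 0} \<subseteq> {a<..<b}"
    if "\<phi> \<in> test_functions a b" for \<phi> :: "real \<Rightarrow> 'd::euclidean_space" and x
    using that closure_subset[of "{x. \<phi> x \<noteq> 0}"] unfolding test_functions_iff by blast+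
  show "(\<lambda>x. \<phi> x + \<psi> x) \<in> test_functions a b"
    if \<phi>: "\<phi> \<in> test_functions a b" and \<psi>: "\<psi> \<in> test_functions a b"
  proof (rule test_functionI_compact)
    show "x \<in> closure {x. \<phi> x \<noteq> 0} \<union> closure {x. \<psi> x \<noteq> 0}" if "\<phi> x + \<psi> x \<noteq> 0" for x
      using that supp(2)[OF \<phi>, of x] supp(2)[OF \<psi>, of x] by (cases "\<phi> x = 0") auto
  qed (intro smooth_add compact_Un Un_least supp \<phi> \<psi>)+
  show "(\<lambda>x. \<kappa> x *\<^sub>R v) \<in> test_functions a b" if \<kappa>: "\<kappa> \<in> test_functions a b"
  proof (rule test_functionI_compact[OF _ _ supp(3,4)[OF \<kappa>]])
    show "x \<in> closure {x. \<kappa> x \<noteq> 0}" if "\<kappa> x *\<^sub>R v \<noteq> 0" for x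
      using that supp(2)[OF \<kappa>, of x] by auto
  qed (intro smooth_bilinear[OF bounded_bilinear_scaleR] smooth_const supp \<kappa>)
  show "(\<lambda>x. r *\<^sub>R \<phi> x) \<in> test_functions a b" if \<phi>: "\<phi> \<in> test_functions a b"
  proof (rule test_functionI_compact[OF _ _ supp(3,4)[OF \<phi>]])
    show "x \<in> closure {x. \<phi> x \<noteq> 0}" if "r *\<^sub>R \<phi> x \<noteq> 0" for x
      using that supp(2)[OF \<phi>, of x] by auto
  qed (intro smooth_bilinear[OF bounded_bilinear_scaleR] smooth_const supp \<phi>)
qed

section \<open>Representatives of elements of \<open>L\<^sub>2\<close>\<close>

lemma square_integrable_rep: "square_integrable (rep_L2 u)"
  using Quotient3_rep_reflp[OF Quotient3_L2, of u] by (simp add: L2_rel_def)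

lemma rep_L2_measurable [measurable]: "rep_L2 u \<in> borel_measurable lebesgue"
  using square_integrable_rep[of u] by (simp add: square_integrable_def)

lemma rep_abs_L2: "square_integrable f \<Longrightarrow> AE x in lebesgue. rep_L2 (abs_L2 f) x = f x"
  using Quotient3_rep_abs[OF Quotient3_L2, of f] by (simp add: L2_rel_def)

lemma abs_rep_L2: "abs_L2 (rep_L2 u) = u"
  by (rule Quotient3_abs_rep[OF Quotient3_L2])

lemma abs_L2_eqI:
  assumes "square_integrable f" "square_integrable g" "AE x in lebesgue. f x = g x"
  shows "abs_L2 f = abs_L2 g"
  using Quotient3_rel_abs[OF Quotient3_L2, of f g] assms by (simp add: L2_rel_def)

lemma L2_eqI: "AE x in lebesgue. rep_L2 u x = rep_L2 v x \<Longrightarrow> u = v"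
  using abs_L2_eqI[OF square_integrable_rep square_integrable_rep, of u v] by (simp add: abs_rep_L2)

lemma abs_L2_eq_iff:
  assumes "square_integrable f" "square_integrable g"
  shows "abs_L2 f = abs_L2 g \<longleftrightarrow> (AE x in lebesgue. f x = g x)"
  using Quotient3_rel[OF Quotient3_L2, of f g] assms by (auto simp: L2_rel_def)

lemma abs_L2_add: "square_integrable f \<Longrightarrow> square_integrable g \<Longrightarrow>
    abs_L2 (\<lambda>x. f x + g x) = abs_L2 f + abs_L2 g"
  by (rule plus_L2.abs_eq[symmetric]) (auto simp: L2_rel_def)

lemma abs_L2_diff: "square_integrable f \<Longrightarrow> square_integrable g \<Longrightarrow>
    abs_L2 (\<lambda>x. f x - g x) = abs_L2 f - abs_L2 g"
  by (rule minus_L2.abs_eq[symmetric]) (auto simp: L2_rel_def)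

lemma abs_L2_scaleR: "square_integrable f \<Longrightarrow> abs_L2 (\<lambda>x. r *\<^sub>R f x) = r *\<^sub>R abs_L2 f"
  by (rule scaleR_L2.abs_eq[symmetric]) (auto simp: L2_rel_def)

lemma abs_L2_0: "abs_L2 (\<lambda>x. 0) = 0"
  by (simp add: zero_L2_def)

lemma inner_abs_L2: "square_integrable f \<Longrightarrow> square_integrable g \<Longrightarrow>
    inner (abs_L2 f) (abs_L2 g) = (LINT x|lebesgue. f x \<bullet> g x)"
  by (rule inner_L2.abs_eq) (auto simp: L2_rel_def)

lemma norm_abs_L2: "square_integrable f \<Longrightarrow> (norm (abs_L2 f))\<^sup>2 = (LINT x|lebesgue. (norm (f x))\<^sup>2)"
  by (simp add: power2_norm_eq_inner inner_abs_L2)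

lemma inner_L2: "inner u v = (LINT x|lebesgue. rep_L2 u x \<bullet> rep_L2 v x)"
  using inner_abs_L2[OF square_integrable_rep square_integrable_rep, of u v] by (simp add: abs_rep_L2)

lemma rep_L2_add: "AE x in lebesgue. rep_L2 (u + v) x = rep_L2 u x + rep_L2 v x"
  using rep_abs_L2[OF square_integrable_add[OF square_integrable_rep square_integrable_rep], of u v]
  by (simp add: abs_L2_add square_integrable_rep abs_rep_L2)

lemma rep_L2_scaleR: "AE x in lebesgue. rep_L2 (r *\<^sub>R u) x = r *\<^sub>R rep_L2 u x"
  using rep_abs_L2[OF square_integrable_scaleR[OF square_integrable_rep], of r u]
  by (simp add: abs_L2_scaleR square_integrable_rep abs_rep_L2)

lemma square_integrable_bound:
  assumes "f \<in> borel_measurable lebesgue" "square_integrable g"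
    "AE x in lebesgue. norm (f x) \<le> norm (g x)"
  shows "square_integrable f"
  unfolding square_integrable_def
proof
  show "integrable lebesgue (\<lambda>x. (norm (f x))\<^sup>2)"
  proof (rule Bochner_Integration.integrable_bound)
    show "integrable lebesgue (\<lambda>x. (norm (g x))\<^sup>2)"
      using assms(2) by (simp add: square_integrable_def)
    show "AE x in lebesgue. norm ((norm (f x))\<^sup>2) \<le> norm ((norm (g x))\<^sup>2)"
      using assms(3) by eventually_elim (simp add: power_mono)
  qed (use assms(1) in measurable)
qed fact

lemma square_integrable_bounded_support:
  fixes f :: "real \<Rightarrow> 'b::euclidean_space"
  assumes "f \<in> borel_measurable lebesgue" "\<And>x. norm (f x) \<le> B" "\<And>x. x \<notin> {a..b} \<Longrightarrow> f x = 0"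
  shows "square_integrable f"
proof (rule square_integrable_bound)
  show "square_integrable (\<lambda>x. B * indicator {a..b} x)"
  proof -
    have "(\<lambda>x. (norm (B * indicator {a..b} x :: real))\<^sup>2) = (\<lambda>x. B\<^sup>2 * indicator {a..b} x)"
      by (auto simp: indicator_def fun_eq_iff)
    moreover have "integrable lebesgue (\<lambda>x. B\<^sup>2 * indicator {a..b} x)"
      by (intro integrable_mult_right integrable_real_indicator) (auto simp: emeasure_lborel_Icc_eq)
    moreover have "(\<lambda>x. B * indicator {a..b} x) \<in> borel_measurable lebesgue"
      by (intro borel_measurable_times borel_measurable_const borel_measurable_indicator) auto
    ultimately show ?thesis
      by (simp add: square_integrable_def)
  qed
  have "norm (f x) \<le> norm (B * indicator {a..b} x)" for x
    using assms(2)[of x] assms(3)[of x] norm_ge_zero[of "f x"] by (cases "x \<in> {a..b}") auto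
  then show "AE x in lebesgue. norm (f x) \<le> norm (B * indicator {a..b} x)"
    by simp
qed fact

lemma test_function_bounded:
  assumes "\<phi> \<in> test_functions a b" "a < b"
  obtains B where "\<And>x. norm (\<phi> x) \<le> B"
proof -
  obtain \<alpha> \<beta> where "a < \<alpha>" "\<alpha> < \<beta>" "\<beta> < b" and sup: "\<And>x. \<phi> x \<noteq> 0 \<Longrightarrow> \<alpha> < x \<and> x < \<beta>"
    using test_functionE[OF assms] by metis
  have "bounded (\<phi> ` {\<alpha>..\<beta>})"
    by (intro compact_imp_bounded compact_continuous_image smooth_continuous_on
        test_function_smooth[OF assms(1)]) simp
  then obtain B where B: "\<forall>x\<in>{\<alpha>..\<beta>}. norm (\<phi> x) \<le> B"
    by (auto simp: bounded_iff)
  then have "norm (\<phi> x) \<le> max B 0" for x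
    using sup[of x] bspec[OF B, of x] by (cases "\<phi> x = 0") (auto simp: le_max_iff_disj)
  then show ?thesis
    using that by blast
qed

lemma smooth_measurable: "smooth f \<Longrightarrow> f \<in> borel_measurable lebesgue"
  using borel_measurable_continuous_onI[OF smooth_continuous_on, of f]
  by (simp add: borel_measurable_if_D measurable_completion)

lemma test_function_square_integrable:
  assumes "\<phi> \<in> test_functions a b" "a < b"
  shows "square_integrable \<phi>"
proof -
  obtain B where B: "\<And>x. norm (\<phi> x) \<le> B"
    using test_function_bounded[OF assms] by auto
  obtain \<alpha> \<beta> where "a < \<alpha>" "\<alpha> < \<beta>" "\<beta> < b" and sup: "\<And>x. \<phi> x \<noteq> 0 \<Longrightarrow> \<alpha> < x \<and> x < \<beta>"
    using test_functionE[OF assms] by metis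
  show ?thesis
    by (rule square_integrable_bounded_support[of _ B \<alpha> \<beta>])
      (use B sup smooth_measurable[OF test_function_smooth[OF assms(1)]] in \<open>auto, force+\<close>)
qed

section \<open>Density of the test functions\<close>

lemma L2_dominated_convergence:
  fixes f :: "real \<Rightarrow> 'b::euclidean_space"
  assumes meas: "\<And>n. s n \<in> borel_measurable lebesgue" "f \<in> borel_measurable lebesgue"
    and g: "square_integrable g"
    and bound: "\<And>n x. norm (s n x) \<le> norm (g x)"
    and lim: "\<And>x. (\<lambda>n. s n x) \<longlonglongrightarrow> f x"
  shows "(\<lambda>n. abs_L2 (s n)) \<longlonglongrightarrow> abs_L2 f"
proof -
  note [measurable] = meas
  have fb: "norm (f x) \<le> norm (g x)" for x
    by (rule Lim_bounded[OF tendsto_norm[OF lim]]) (use bound in auto)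
  have sq: "square_integrable (s n)" "square_integrable f" for n
    by (rule square_integrable_bound[OF _ g]; use bound fb in auto)+
  have "(\<lambda>n. LINT x|lebesgue. (norm (s n x - f x))\<^sup>2) \<longlonglongrightarrow> (LINT (x::real)|lebesgue. 0::real)"
  proof (rule integral_dominated_convergence)
    show "integrable lebesgue (\<lambda>x. 4 * (norm (g x))\<^sup>2)"
      using g by (simp add: square_integrable_def)
    have "(\<lambda>n. (norm (s n x - f x))\<^sup>2) \<longlonglongrightarrow> 0\<^sup>2" for x
      by (intro tendsto_power tendsto_norm_zero LIM_zero lim)
    then show "AE x in lebesgue. (\<lambda>n. (norm (s n x - f x))\<^sup>2) \<longlonglongrightarrow> 0"
      by simp
    have "norm ((norm (s n x - f x))\<^sup>2) \<le> 4 * (norm (g x))\<^sup>2" for n x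
    proof -
      have "norm (s n x - f x) \<le> 2 * norm (g x)"
        using norm_triangle_ineq4[of "s n x" "f x"] bound[of n x] fb[of x] by linarith
      from power_mono[OF this, of 2] show ?thesis
        by (simp add: power_mult_distrib)
    qed
    then show "AE x in lebesgue. norm ((norm (s n x - f x))\<^sup>2) \<le> 4 * (norm (g x))\<^sup>2" for n
      by simp
  qed measurable
  moreover have "(norm (abs_L2 (s n) - abs_L2 f))\<^sup>2 = (LINT x|lebesgue. (norm (s n x - f x))\<^sup>2)" for n
    unfolding abs_L2_diff[OF sq, symmetric] by (rule norm_abs_L2[OF square_integrable_diff[OF sq]])
  ultimately have "(\<lambda>n. (norm (abs_L2 (s n) - abs_L2 f))\<^sup>2) \<longlonglongrightarrow> 0"
    by simp
  from tendsto_real_sqrt[OF this] have "(\<lambda>n. norm (abs_L2 (s n) - abs_L2 f)) \<longlonglongrightarrow> 0"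
    by simp
  then show ?thesis
    unfolding tendsto_norm_zero_iff LIM_zero_iff .
qed

text \<open>The supports are shrunk by \<open>\<epsilon> n\<close> so that the approximants are test functions on \<open>(a,b)\<close> even if
  \<open>\<alpha> = a\<close> or \<open>\<beta> = b\<close>.\<close>

lemma bump_tendsto_indicator:
  fixes \<alpha> \<beta> :: real
  assumes "\<alpha> < \<beta>"
  defines "\<epsilon> \<equiv> \<lambda>n::nat. (\<beta> - \<alpha>) / (real n + 3)"
  shows "(\<lambda>n. bump (\<alpha> + \<epsilon> n) (\<beta> - \<epsilon> n) (real n + 1) x) \<longlonglongrightarrow> indicator {\<alpha><..<\<beta>} x"
proof (cases "x \<in> {\<alpha><..<\<beta>}")
  case False
  have "\<epsilon> n > 0" for n
    using assms by (simp add: \<epsilon>_def)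
  moreover have "bump (\<alpha> + \<epsilon> n) (\<beta> - \<epsilon> n) (real n + 1) x = 0" if "\<epsilon> n > 0" for n
    using False \<open>\<epsilon> n > 0\<close> by (intro bump_eq_0) auto
  ultimately show ?thesis
    using False by simp
next
  case True
  have flat: "(\<lambda>n. flat 1 ((real n + 1) * (y - \<epsilon> n))) \<longlonglongrightarrow> 1" if "y > 0" for y
  proof -
    have "\<epsilon> \<longlonglongrightarrow> 0"
      unfolding \<epsilon>_def by real_asymp
    then have d: "(\<lambda>n. y - \<epsilon> n) \<longlonglongrightarrow> y"
      by (auto intro!: tendsto_eq_intros)
    have "filterlim (\<lambda>n. (y - \<epsilon> n) * (real n + 1)) at_top sequentially"
      by (rule filterlim_tendsto_pos_mult_at_top[OF d that]) real_asymp
    then have lim: "filterlim (\<lambda>n. (real n + 1) * (y - \<epsilon> n)) at_top sequentially"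
      by (simp add: mult.commute)
    have "((\<lambda>z::real. exp (- (1 / z))) \<longlongrightarrow> 1) at_top"
      by real_asymp
    then have "(flat 1 \<longlongrightarrow> 1) at_top"
      by (rule Lim_transform_eventually)
        (auto simp: flat_def intro: eventually_mono[OF eventually_gt_at_top[of 0]])
    from filterlim_compose[OF this lim] show ?thesis .
  qed
  have "(\<lambda>n. flat 1 ((real n + 1) * (x - \<alpha> - \<epsilon> n)) * flat 1 ((real n + 1) * (\<beta> - x - \<epsilon> n))) \<longlonglongrightarrow> 1 * 1"
    using True by (intro tendsto_mult flat) auto
  then show ?thesis
    using True by (simp add: bump_def algebra_simps)
qed

lemma bump_test_function:
  assumes "a < \<alpha>" "\<beta> < b" "r > 0"
  shows "bump \<alpha> \<beta> r \<in> test_functions a b"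
proof (rule test_functionI[OF smooth_bump assms(1,2)])
  show "\<alpha> \<le> x \<and> x \<le> \<beta>" if "bump \<alpha> \<beta> r x \<noteq> 0" for x
    using bump_eq_0[OF assms(3), of \<alpha> x \<beta>] that by (cases "\<alpha> < x \<and> x < \<beta>") auto
qed

text \<open>The closure \<open>T\<close> of the test functions is a closed subspace. It contains the indicator functions of
  intervals as limits of bumps, hence by Dynkin's lemma those of Borel sets, hence those of Lebesgue
  measurable sets and all simple functions, which are dense.\<close>

theorem test_functions_dense:
  fixes u :: "'b::euclidean_space L2"
  assumes ab: "a < b" and u: "u \<in> L2_on a b"
  shows "u \<in> closure (abs_L2 ` test_functions a b)"
proof -
  define T :: "'b L2 set" where "T = closure (abs_L2 ` test_functions a b)"
  have T0: "0 \<in> T"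
  proof -
    have "abs_L2 (\<lambda>_. 0) \<in> T"
      unfolding T_def by (intro closure_subset[THEN subsetD] imageI subspace_test_functions)
    then show ?thesis
      by (simp add: abs_L2_0)
  qed
  have img_add: "p + q \<in> abs_L2 ` test_functions a b"
    if pq: "p \<in> abs_L2 ` test_functions a b" "q \<in> abs_L2 ` test_functions a b" for p q :: "'b L2"
  proof -
    obtain \<phi> \<psi> where \<phi>: "\<phi> \<in> test_functions a b" "p = abs_L2 \<phi>"
      and \<psi>: "\<psi> \<in> test_functions a b" "q = abs_L2 \<psi>"
      using pq by blast
    have "p + q = abs_L2 (\<lambda>x. \<phi> x + \<psi> x)"
      unfolding \<phi>(2) \<psi>(2) using \<phi>(1) \<psi>(1) ab
      by (intro abs_L2_add[symmetric] test_function_square_integrable)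
    then show ?thesis
      using subspace_test_functions(2)[OF \<phi>(1) \<psi>(1)] by blast
  qed
  have img_scale: "r *\<^sub>R p \<in> abs_L2 ` test_functions a b"
    if p: "p \<in> abs_L2 ` test_functions a b" for p :: "'b L2" and r
  proof -
    obtain \<phi> where \<phi>: "\<phi> \<in> test_functions a b" "p = abs_L2 \<phi>"
      using p by blast
    have "r *\<^sub>R p = abs_L2 (\<lambda>x. r *\<^sub>R \<phi> x)"
      unfolding \<phi>(2) using \<phi>(1) ab by (intro abs_L2_scaleR[symmetric] test_function_square_integrable)
    then show ?thesis
      using subspace_test_functions(4)[OF \<phi>(1)] by blast
  qed
  have T_add: "p + q \<in> T" if pq: "p \<in> T" "q \<in> T" for p q
  proof -
    obtain s where s: "\<forall>n. s n \<in> abs_L2 ` test_functions a b" "s \<longlonglongrightarrow> p"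
      using pq(1) unfolding T_def closure_sequential by blast
    obtain t where t: "\<forall>n. t n \<in> abs_L2 ` test_functions a b" "t \<longlonglongrightarrow> q"
      using pq(2) unfolding T_def closure_sequential by blast
    have "\<forall>n. s n + t n \<in> abs_L2 ` test_functions a b"
      by (intro allI img_add s(1)[rule_format] t(1)[rule_format])
    then show ?thesis
      unfolding T_def closure_sequential
      by (intro exI[of _ "\<lambda>n. s n + t n"] conjI tendsto_add s t)
  qed
  have T_scale: "r *\<^sub>R p \<in> T" if p: "p \<in> T" for p r
  proof -
    obtain s where s: "\<forall>n. s n \<in> abs_L2 ` test_functions a b" "s \<longlonglongrightarrow> p"
      using p unfolding T_def closure_sequential by blast
    have "\<forall>n. r *\<^sub>R s n \<in> abs_L2 ` test_functions a b"
      by (intro allI img_scale s(1)[rule_format])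
    then show ?thesis
      unfolding T_def closure_sequential
      by (intro exI[of _ "\<lambda>n. r *\<^sub>R s n"] conjI tendsto_scaleR tendsto_const s)
  qed
  have T_diff: "u - v \<in> T" if "u \<in> T" "v \<in> T" for u v
    using T_add[OF that(1) T_scale[OF that(2), of "-1"]] by simp
  have T_lim: "l \<in> T" if "\<And>n. s n \<in> T" "s \<longlonglongrightarrow> l" for s l
    unfolding T_def by (rule closed_sequentially[OF closed_closure _ that(2)])
      (use that(1) in \<open>simp add: T_def\<close>)
  define I where "I E v = (\<lambda>x. indicator (E \<inter> {a<..<b}) x *\<^sub>R v)" for E :: "real set" and v :: 'b
  have I_bound: "norm (I E v x) \<le> norm (indicator {a..b} x *\<^sub>R v)" for E v x
    by (auto simp: I_def indicator_def)
  have I_sq: "square_integrable (\<lambda>x. indicator {a..b} x *\<^sub>R v)" for v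
  proof (rule square_integrable_bounded_support[of _ "norm v" a b])
    show "(\<lambda>x. indicator {a..b} x *\<^sub>R v) \<in> borel_measurable lebesgue"
      by (intro borel_measurable_scaleR borel_measurable_indicator borel_measurable_const) auto
  qed (auto simp: indicator_def)
  have I_meas: "I E v \<in> borel_measurable lebesgue" if "E \<in> sets lebesgue" for E v
    unfolding I_def using that
    by (intro borel_measurable_scaleR borel_measurable_indicator borel_measurable_const) auto
  have I_si: "square_integrable (I E v)" if "E \<in> sets lebesgue" for E v
    by (rule square_integrable_bound[OF I_meas[OF that] I_sq[of v]]) (use I_bound in auto)
  have interval: "abs_L2 (I {\<alpha><..<\<beta>} v) \<in> T" for \<alpha> \<beta> v
  proof -
    define \<alpha>' \<beta>' where "\<alpha>' = max a \<alpha>" and "\<beta>' = min b \<beta>"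
    have eq: "I {\<alpha><..<\<beta>} v = (\<lambda>x. indicator {\<alpha>'<..<\<beta>'} x *\<^sub>R v)"
      by (auto simp: I_def \<alpha>'_def \<beta>'_def indicator_def fun_eq_iff)
    show ?thesis
    proof (cases "\<alpha>' < \<beta>'")
      case False
      then have "I {\<alpha><..<\<beta>} v = (\<lambda>_. 0)"
        unfolding eq by (auto simp: indicator_def fun_eq_iff)
      then show ?thesis
        using T0 by (simp add: abs_L2_0)
    next
      case True
      define \<epsilon> where "\<epsilon> n = (\<beta>' - \<alpha>') / (real n + 3)" for n :: nat
      define s where "s n = bump (\<alpha>' + \<epsilon> n) (\<beta>' - \<epsilon> n) (real n + 1)" for n
      have \<epsilon>: "\<epsilon> n > 0" for n
        using True by (simp add: \<epsilon>_def)
      have sT: "s n \<in> test_functions a b" for n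
        unfolding s_def using \<epsilon>[of n]
        by (intro bump_test_function) (auto simp: \<alpha>'_def \<beta>'_def max_def min_def)
      have "(\<lambda>n. abs_L2 (\<lambda>x. s n x *\<^sub>R v)) \<longlonglongrightarrow> abs_L2 (I {\<alpha><..<\<beta>} v)"
      proof (rule L2_dominated_convergence[OF _ _ I_sq[of v]])
        show "(\<lambda>x. s n x *\<^sub>R v) \<in> borel_measurable lebesgue" for n
          using smooth_measurable[OF test_function_smooth[OF sT[of n]]] by measurable
        show "norm (s n x *\<^sub>R v) \<le> norm (indicator {a..b} x *\<^sub>R v)" for n x
        proof (cases "x \<in> {a..b}")
          case True
          then show ?thesis
            using bump_bounds[of "\<alpha>' + \<epsilon> n" "\<beta>' - \<epsilon> n" "real n + 1" x]
            by (simp add: s_def mult_left_le_one_le)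
        next
          case False
          then have "s n x = 0"
            unfolding s_def using \<epsilon>[of n] by (intro bump_eq_0) (auto simp: \<alpha>'_def \<beta>'_def)
          then show ?thesis
            by simp
        qed
        show "(\<lambda>n. s n x *\<^sub>R v) \<longlonglongrightarrow> I {\<alpha><..<\<beta>} v x" for x
          unfolding eq s_def \<epsilon>_def by (intro tendsto_intros bump_tendsto_indicator True)
      qed (rule I_meas, simp)
      moreover have "abs_L2 (\<lambda>x. s n x *\<^sub>R v) \<in> T" for n
        unfolding T_def using subspace_test_functions(3)[OF sT] closure_subset by blast
      ultimately show ?thesis
        by (rule T_lim[rotated])
    qed
  qed
  have borel: "\<forall>v. abs_L2 (I E v) \<in> T" if "E \<in> sets borel" for E
  proof -
    define G :: "real set set" where "G = range (\<lambda>(\<alpha>, \<beta>). {\<alpha><..<\<beta>})"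
    have gen: "sets borel = sigma_sets UNIV G"
      unfolding borel_eq_box box_real by (simp add: G_def)
    have stable: "Int_stable G"
    proof (rule Int_stableI)
      fix A B assume "A \<in> G" "B \<in> G"
      then obtain \<alpha> \<beta> \<gamma> \<delta> where "A = {\<alpha><..<\<beta>}" "B = {\<gamma><..<\<delta>}"
        by (auto simp: G_def)
      then have "A \<inter> B = {max \<alpha> \<gamma><..<min \<beta> \<delta>}"
        by auto
      then show "A \<inter> B \<in> G"
        unfolding G_def by (auto intro!: image_eqI[of _ _ "(max \<alpha> \<gamma>, min \<beta> \<delta>)"])
    qed
    have leb: "A \<in> sets lebesgue" if "A \<in> sigma_sets UNIV G" for A
      using that unfolding gen[symmetric] by simp
    show ?thesis
    proof (rule sigma_sets_induct_disjoint[OF stable, of UNIV E])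
      show "\<forall>v. abs_L2 (I A v) \<in> T" if "A \<in> G" for A
        using that interval by (auto simp: G_def)
      show "\<forall>v. abs_L2 (I {} v) \<in> T"
        using T0 by (simp add: I_def abs_L2_0)
      show "\<forall>v. abs_L2 (I (UNIV - A) v) \<in> T"
        if A: "A \<in> sigma_sets UNIV G" "\<forall>v. abs_L2 (I A v) \<in> T" for A
      proof
        fix v
        have "I (UNIV - A) v = (\<lambda>x. I {a<..<b} v x - I A v x)"
          by (auto simp: I_def indicator_def fun_eq_iff)
        then have "abs_L2 (I (UNIV - A) v) = abs_L2 (I {a<..<b} v) - abs_L2 (I A v)"
          using I_si[OF leb[OF A(1)]] I_si[of "{a<..<b}"] by (simp add: abs_L2_diff)
        then show "abs_L2 (I (UNIV - A) v) \<in> T"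
          using T_diff interval A(2) by simp
      qed
      show "\<forall>v. abs_L2 (I (\<Union>i. A i) v) \<in> T"
        if A: "disjoint_family A" "range A \<subseteq> sigma_sets UNIV G" "\<And>i. \<forall>v. abs_L2 (I (A i) v) \<in> T"
        for A :: "nat \<Rightarrow> real set"
      proof
        fix v
        have Ai: "A i \<in> sets lebesgue" for i
          using A(2) leb by blast
        have step: "abs_L2 (I (\<Union>i<n. A i) v) \<in> T" for n
        proof (induction n)
          case 0
          then show ?case
            using T0 by (simp add: I_def abs_L2_0)
        next
          case (Suc n)
          have "A n \<inter> (\<Union>i<n. A i) = {}"
            using A(1) by (auto simp: disjoint_family_on_def) (metis IntI empty_iff less_irrefl)
          then have "I (\<Union>i<Suc n. A i) v = (\<lambda>x. I (A n) v x + I (\<Union>i<n. A i) v x)"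
            by (auto simp: I_def indicator_def fun_eq_iff lessThan_Suc)
          moreover have "(\<Union>i<n. A i) \<in> sets lebesgue"
            using Ai by auto
          ultimately show ?case
            using Suc T_add A(3) I_si Ai by (simp add: abs_L2_add)
        qed
        show "abs_L2 (I (\<Union>i. A i) v) \<in> T"
        proof (rule T_lim[OF step L2_dominated_convergence[OF _ _ I_sq I_bound]])
          show "(\<lambda>n. I (\<Union>i<n. A i) v x) \<longlonglongrightarrow> I (\<Union>i. A i) v x" for x
          proof (cases "x \<in> (\<Union>i. A i)")
            case False
            then show ?thesis
              by (simp add: I_def indicator_def)
          next
            case True
            then obtain k where "x \<in> A k"
              by auto
            then have "I (\<Union>i<n. A i) v x = I (\<Union>i. A i) v x" if "n \<ge> Suc k" for n
              using that True by (auto simp: I_def indicator_def)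
            then show ?thesis
              by (intro tendsto_eventually eventually_sequentiallyI[of "Suc k"])
          qed
        qed (use Ai in \<open>auto intro!: I_meas\<close>)
      qed
    qed (use that in \<open>auto simp: G_def gen\<close>)
  qed
  have leb: "abs_L2 (I E v) \<in> T" if E: "E \<in> sets lebesgue" for E v
  proof -
    obtain C N where CN: "fsigma C" "N \<in> null_sets lebesgue" "C \<union> N = E"
      using lebesgue_set_almost_fsigma[OF E] by metis
    have C: "C \<in> sets borel"
      using CN(1) by (auto simp: fsigma.simps)
    have "AE x in lebesgue. I E v x = I C v x"
      by (rule AE_I'[OF CN(2)]) (use CN(3) in \<open>auto simp: I_def indicator_def\<close>)
    then have "abs_L2 (I E v) = abs_L2 (I C v)"
      using E C by (intro abs_L2_eqI I_si) auto
    then show ?thesis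
      using borel[OF C] by simp
  qed
  obtain F where F: "\<And>i. simple_function lebesgue (F i)"
    "\<And>x. (\<lambda>i. F i x) \<longlonglongrightarrow> rep_L2 u x" "\<And>i x. norm (F i x) \<le> 2 * norm (rep_L2 u x)"
    using borel_measurable_implies_sequence_metric[OF rep_L2_measurable, of u 0]
    by (auto simp: dist_norm)
  define s where "s i x = indicator {a<..<b} x *\<^sub>R F i x" for i x
  have sT: "abs_L2 (s i) \<in> T" for i
  proof -
    have fin: "finite (range (F i))"
      using simple_functionD(1)[OF F(1)] by simp
    have meas: "F i -` {y} \<in> sets lebesgue" for y
      using simple_functionD(2)[OF F(1), of i "{y}"] by simp
    have eq: "s i = (\<lambda>x. \<Sum>y\<in>range (F i). I (F i -` {y}) y x)"
    proof
      fix x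
      have "(\<Sum>y\<in>range (F i). I (F i -` {y}) y x)
          = (\<Sum>y\<in>range (F i). if y = F i x then indicator {a<..<b} x *\<^sub>R y else 0)"
        by (intro sum.cong) (auto simp: I_def indicator_def)
      also have "\<dots> = s i x"
        using fin by (simp add: s_def)
      finally show "s i x = (\<Sum>y\<in>range (F i). I (F i -` {y}) y x)" ..
    qed
    have "square_integrable (\<lambda>x. \<Sum>y\<in>Y. I (F i -` {y}) y x) \<and>
        abs_L2 (\<lambda>x. \<Sum>y\<in>Y. I (F i -` {y}) y x) \<in> T" if "finite Y" for Y
      using that
    proof induction
      case empty
      then show ?case
        using T0 by (simp add: abs_L2_0 square_integrable_0)
    next
      case (insert y Y)
      then show ?case
        using I_si[OF meas, of y y] leb[OF meas, of y y] T_add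
        by (simp add: abs_L2_add square_integrable_add)
    qed
    then show ?thesis
      unfolding eq using fin by simp
  qed
  define f where "f x = indicator {a<..<b} x *\<^sub>R rep_L2 u x" for x
  have f_meas: "f \<in> borel_measurable lebesgue"
    unfolding f_def by (intro borel_measurable_scaleR borel_measurable_indicator rep_L2_measurable) auto
  have "(\<lambda>i. abs_L2 (s i)) \<longlonglongrightarrow> abs_L2 f"
  proof (rule L2_dominated_convergence)
    show "square_integrable (\<lambda>x. 2 *\<^sub>R rep_L2 u x)"
      by (intro square_integrable_scaleR square_integrable_rep)
    show "s i \<in> borel_measurable lebesgue" for i
      unfolding s_def
      by (intro borel_measurable_scaleR borel_measurable_indicator borel_measurable_simple_function F) auto
    show "f \<in> borel_measurable lebesgue"
      by (rule f_meas)
    show "norm (s i x) \<le> norm (2 *\<^sub>R rep_L2 u x)" for i x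
      using F(3)[of i x] by (auto simp: s_def indicator_def)
    show "(\<lambda>i. s i x) \<longlonglongrightarrow> f x" for x
      unfolding s_def f_def by (intro tendsto_intros F)
  qed
  moreover have "abs_L2 f = u"
  proof -
    have "AE x in lebesgue. f x = rep_L2 u x"
      using u by (auto simp: L2_on_def f_def indicator_def elim!: eventually_mono)
    moreover have "square_integrable f"
      by (rule square_integrable_bound[OF f_meas square_integrable_rep[of u]])
        (auto simp: f_def indicator_def)
    ultimately show ?thesis
      using abs_L2_eqI[OF _ square_integrable_rep] abs_rep_L2 by metis
  qed
  ultimately have "u \<in> T"
    using T_lim[OF sT] by simp
  then show ?thesis
    by (simp add: T_def)
qed

section \<open>Absolutely continuous functions as indefinite integrals\<close>

text \<open>The integral is obtained in the sense of Henstock and Kurzweil. Let \<open>N\<close> be the null set where the derivative fails and redefine \<open>g = 0\<close> there. In a fine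
  tagged division, the pieces tagged outside \<open>N\<close> are controlled by the derivative, as in the fundamental
  theorem of calculus; those tagged in \<open>N\<close> lie in an open set of small measure, so that absolute
  continuity bounds the total increment of \<open>f\<close> over them.\<close>

lemma abs_continuous_FTC:
  fixes f g :: "real \<Rightarrow> 'b::banach"
  assumes ab: "a \<le> b" and ac: "abs_continuous_on a b f"
    and der: "AE x in lebesgue. x \<in> {a<..<b} \<longrightarrow> (f has_vector_derivative g x) (at x)"
  shows "(g has_integral (f b - f a)) {a..b}"
proof -
  define N where "N = {x \<in> {a..b}. \<not> (f has_vector_derivative g x) (at x)}"
  have "negligible N"
  proof -
    have "negligible {x. \<not> (x \<in> {a<..<b} \<longrightarrow> (f has_vector_derivative g x) (at x))}"
      using der by (simp add: eventually_ae_filter_negligible) (meson negligible_subset)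
    then have "negligible ({x. \<not> (x \<in> {a<..<b} \<longrightarrow> (f has_vector_derivative g x) (at x))} \<union> {a, b})"
      by simp
    then show ?thesis
      by (rule negligible_subset) (auto simp: N_def)
  qed
  define g' where "g' x = (if x \<in> N then 0 else g x)" for x
  have "(g' has_integral (f b - f a)) (cbox a b)"
    unfolding has_integral
  proof (intro allI impI)
    fix e :: real assume e: "e > 0"
\<comment> \<open>The error \<open>e\<close> is split evenly between the pieces tagged outside and inside \<open>N\<close>.\<close>
    define e1 where "e1 = e / (2 * (b - a + 1))"
    have e1: "e1 > 0" "e1 * (b - a) < e / 2"
      using e ab by (auto simp: e1_def field_simps)
    obtain \<delta> where \<delta>: "\<delta> > 0" and small: "\<And>I. finite I \<Longrightarrow> \<forall>(x, y)\<in>I. a \<le> x \<and> x < y \<and> y \<le> b \<Longrightarrow>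
        disjoint_family_on (\<lambda>(x, y). {x<..<y}) I \<Longrightarrow> (\<Sum>(x, y)\<in>I. y - x) < \<delta> \<Longrightarrow>
        (\<Sum>(x, y)\<in>I. norm (f y - f x)) < e / 2"
      using ac[unfolded abs_continuous_on_def, rule_format, of "e/2"] e by (auto simp: Ball_def)
    obtain U where U: "open U" "N \<subseteq> U" and U\<delta>: "emeasure lebesgue U < ennreal \<delta>"
    proof -
      have N: "N \<in> null_sets lebesgue"
        using \<open>negligible N\<close> by (simp add: negligible_iff_null_sets)
      then obtain U where U: "open U" "N \<subseteq> U" "emeasure lebesgue (U - N) < ennreal \<delta>"
        using sets_lebesgue_outer_open[OF null_setsD2[OF N] \<delta>] by metis
      have "emeasure lebesgue U = emeasure lebesgue (U - N)"
        using emeasure_Diff_null_set[OF N, of U] U(1) by simp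
      with U show ?thesis
        by (intro that[of U]) auto
    qed
    have "\<exists>d>0. \<forall>y. \<bar>y - x\<bar> < d \<longrightarrow> norm (f y - f x - (y - x) *\<^sub>R g' x) \<le> e1 * \<bar>y - x\<bar>"
      if "x \<in> {a..b} - N" for x
    proof -
      have "(f has_vector_derivative g' x) (at x)"
        using that by (simp add: N_def g'_def)
      then show ?thesis
        using e1(1) unfolding has_vector_derivative_def has_derivative_at_alt real_norm_def by blast
    qed
    then obtain d where d: "\<And>x. x \<in> {a..b} - N \<Longrightarrow> d x > 0"
      "\<And>x y. x \<in> {a..b} - N \<Longrightarrow> \<bar>y - x\<bar> < d x \<Longrightarrow>
         norm (f y - f x - (y - x) *\<^sub>R g' x) \<le> e1 * \<bar>y - x\<bar>"
      by metis
    define \<gamma> where "\<gamma> x = (if x \<in> N then U else if x \<in> {a..b} then ball x (d x) else UNIV)" for x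
    show "\<exists>\<gamma>. gauge \<gamma> \<and> (\<forall>\<D>. \<D> tagged_division_of cbox a b \<and> \<gamma> fine \<D> \<longrightarrow>
        norm ((\<Sum>(x, K)\<in>\<D>. measure lborel K *\<^sub>R g' x) - (f b - f a)) < e)"
    proof (intro exI[of _ \<gamma>] conjI allI impI; (elim conjE)?)
      show "gauge \<gamma>"
        using U d(1) by (auto simp: gauge_def \<gamma>_def)
      fix p assume p: "p tagged_division_of cbox a b" and fine: "\<gamma> fine p"
      note pD = tagged_division_ofD[OF p]
      have interval: "\<exists>u v. K = {u..v} \<and> u \<le> v \<and> a \<le> u \<and> v \<le> b \<and> Inf K = u \<and> Sup K = v \<and> measure lborel K = v - u"
        if xK: "(x, K) \<in> p" for x K
      proof -
        obtain u v where K: "K = {u..v}"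
          using pD(4)[OF xK] by auto
        moreover have "x \<in> K" "K \<subseteq> {a..b}"
          using pD(2,3)[OF xK] by auto
        ultimately show ?thesis
          by (intro exI[of _ u] exI[of _ v]) auto
      qed
      define B where "B = {(x, K) \<in> p. x \<in> N}"
      define err where "err = (\<lambda>(x, K). measure lborel K *\<^sub>R g' x - (f (Sup K) - f (Inf K)))"
      have B: "B \<subseteq> p" "finite B"
        using pD(1) by (auto simp: B_def intro: finite_subset)
      have "(\<Sum>(x, K)\<in>p. measure lborel K *\<^sub>R g' x) - (f b - f a) = sum err p"
        using additive_tagged_division_1[OF ab, of p f] p
        by (simp add: err_def split_def sum_subtractf)
      also have "\<dots> = sum err (p - B) + sum err B"
        by (rule sum.subset_diff[OF B(1) pD(1)])
      also have "norm \<dots> \<le> norm (sum err (p - B)) + norm (sum err B)"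
        by (rule norm_triangle_ineq)
      also have "norm (sum err (p - B)) \<le> (\<Sum>(x, K)\<in>p - B. e1 * (Sup K - Inf K))"
      proof (rule sum_norm_le)
        fix z assume z: "z \<in> p - B"
        obtain x K where xK: "z = (x, K)"
          by fastforce
        with z have xp: "(x, K) \<in> p" and xN: "x \<notin> N"
          by (auto simp: B_def)
        obtain u v where uv: "K = {u..v}" "u \<le> v" "a \<le> u" "v \<le> b" "Inf K = u" "Sup K = v" "measure lborel K = v - u"
          using interval[OF xp] by auto
        have x: "u \<le> x" "x \<le> v"
          using pD(2)[OF xp] uv by auto
        then have x': "x \<in> {a..b} - N"
          using uv xN by auto
        have "K \<subseteq> ball x (d x)"
          using fineD[OF fine xp] x' by (auto simp: \<gamma>_def)
        then have "dist x u < d x" "dist x v < d x"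
          using uv by auto
        then have "norm (f v - f x - (v - x) *\<^sub>R g' x) \<le> e1 * \<bar>v - x\<bar>"
          "norm (f u - f x - (u - x) *\<^sub>R g' x) \<le> e1 * \<bar>u - x\<bar>"
          using d(2)[OF x'] by (auto simp: dist_real_def abs_minus_commute)
        moreover have "err z = (f u - f x - (u - x) *\<^sub>R g' x) - (f v - f x - (v - x) *\<^sub>R g' x)"
          by (simp add: err_def xK uv algebra_simps)
        ultimately have "norm (err z) \<le> e1 * \<bar>u - x\<bar> + e1 * \<bar>v - x\<bar>"
          by (smt (verit) norm_triangle_ineq4)
        also have "\<dots> = e1 * (v - u)"
          using x by (simp add: algebra_simps)
        finally show "norm (err z) \<le> (case z of (x, K) \<Rightarrow> e1 * (Sup K - Inf K))"
          by (simp add: xK uv)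
      qed
      also have "\<dots> \<le> (\<Sum>(x, K)\<in>p. e1 * (Sup K - Inf K))"
      proof (rule sum_mono2[OF pD(1)])
        show "0 \<le> (case z of (x, K) \<Rightarrow> e1 * (Sup K - Inf K))" if "z \<in> p - (p - B)" for z
          using that interval[of "fst z" "snd z"] e1 by (auto simp: split_def)
      qed auto
      also have "\<dots> = e1 * (b - a)"
        using additive_tagged_division_1[OF ab, of p "\<lambda>x. x"] p
        by (simp add: split_def sum_distrib_left[symmetric])
      also have "norm (sum err B) < e / 2"
      proof -
\<comment> \<open>Degenerate pieces contribute nothing, and only the others determine their interval uniquely.\<close>
        define B' where "B' = {(x, K) \<in> B. Inf K < Sup K}"
        define J where "J z = (Inf (snd z), Sup (snd z))" for z :: "real \<times> real set"
        have B': "B' \<subseteq> B" "finite B'"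
          using B(2) by (auto simp: B'_def intro: finite_subset)
        have inj: "z = z'" if z: "z \<in> B'" "z' \<in> B'" and meet: "{fst (J z)<..<snd (J z)} \<inter> {fst (J z')<..<snd (J z')} \<noteq> {}"
          for z z'
        proof -
          obtain x K x' K' where eq: "z = (x, K)" "z' = (x', K')"
            by fastforce
          have mem: "(x, K) \<in> p" "(x', K') \<in> p"
            using z B B' eq by auto
          obtain u v where uv: "K = {u..v}" "Inf K = u" "Sup K = v"
            using interval[OF mem(1)] by auto
          obtain u' v' where uv': "K' = {u'..v'}" "Inf K' = u'" "Sup K' = v'"
            using interval[OF mem(2)] by auto
          have "interior K \<inter> interior K' \<noteq> {}"
          proof -
            have "interior K = {u<..<v}" "interior K' = {u'<..<v'}"
              by (simp_all add: uv(1) uv'(1))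
            with meet show ?thesis
              by (simp add: J_def eq uv(2,3) uv'(2,3))
          qed
          then show ?thesis
            using pD(5)[OF mem] eq by auto
        qed
        have lt: "fst (J z) < snd (J z)" if "z \<in> B'" for z
          using that by (auto simp: B'_def J_def)
        have J_inj: "inj_on J B'"
        proof (rule inj_onI)
          fix z z' assume "z \<in> B'" "z' \<in> B'" "J z = J z'"
          then show "z = z'"
            using lt[of z'] by (intro inj) auto
        qed
        have fin: "finite (J ` B')"
          using B' by simp
        have bounds: "\<forall>(x, y)\<in>J ` B'. a \<le> x \<and> x < y \<and> y \<le> b"
        proof
          fix i assume "i \<in> J ` B'"
          then obtain z where z: "z \<in> B'" "i = J z"
            by blast
          then have zp: "(fst z, snd z) \<in> p"
            using B(1) B'(1) by auto
          obtain u v where uv: "a \<le> u" "v \<le> b" "Inf (snd z) = u" "Sup (snd z) = v"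
            using interval[OF zp] by auto
          show "case i of (x, y) \<Rightarrow> a \<le> x \<and> x < y \<and> y \<le> b"
            using lt[OF z(1)] uv by (simp add: z(2) J_def)
        qed
        have disj: "disjoint_family_on (\<lambda>(x, y). {x<..<y}) (J ` B')"
          unfolding disjoint_family_on_def
        proof (intro ballI impI)
          fix i j assume "i \<in> J ` B'" "j \<in> J ` B'" and ij: "i \<noteq> j"
          then obtain z z' where z: "z \<in> B'" "z' \<in> B'" "i = J z" "j = J z'"
            by blast
          show "(case i of (x, y) \<Rightarrow> {x<..<y}) \<inter> (case j of (x, y) \<Rightarrow> {x<..<y}) = {}"
          proof (rule ccontr)
            assume "\<not> ?thesis"
            then have "z = z'"
              unfolding split_def z(3,4) by (rule inj[OF z(1,2)])
            with z ij show False
              by simp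
          qed
        qed
        have "(\<Sum>(x, y)\<in>J ` B'. y - x) < \<delta>"
        proof -
          have "(\<Sum>(x, y)\<in>J ` B'. y - x) = (\<Sum>i\<in>J ` B'. measure lebesgue (case i of (x, y) \<Rightarrow> {x<..<y}))"
            using bounds by (intro sum.cong) (auto simp: split_def)
          also have "ennreal \<dots> = emeasure lebesgue (\<Union>i\<in>J ` B'. case i of (x, y) \<Rightarrow> {x<..<y})"
          proof -
            have "emeasure lebesgue (\<Union>i\<in>J ` B'. case i of (x, y) \<Rightarrow> {x<..<y})
                = (\<Sum>i\<in>J ` B'. emeasure lebesgue (case i of (x, y) \<Rightarrow> {x<..<y}))"
              by (rule sum_emeasure[OF _ disj fin, symmetric]) (auto simp: split_def)
            also have "\<dots> = (\<Sum>i\<in>J ` B'. ennreal (measure lebesgue (case i of (x, y) \<Rightarrow> {x<..<y})))"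
            proof (intro sum.cong refl emeasure_eq_ennreal_measure)
              fix i assume "i \<in> J ` B'"
              then obtain z where z: "z \<in> B'" "i = J z"
                by blast
              show "emeasure lebesgue (case i of (x, y) \<Rightarrow> {x<..<y}) \<noteq> top"
                using less_imp_le[OF lt[OF z(1)]] by (simp add: z(2) split_def)
            qed
            also have "\<dots> = ennreal (\<Sum>i\<in>J ` B'. measure lebesgue (case i of (x, y) \<Rightarrow> {x<..<y}))"
              by (rule sum_ennreal) simp
            finally show ?thesis
              by simp
          qed
          also have "\<dots> \<le> emeasure lebesgue U"
          proof (rule emeasure_mono)
            have "{fst (J z)<..<snd (J z)} \<subseteq> U" if z: "z \<in> B'" for z
            proof -
              obtain x K where eq: "z = (x, K)"
                by fastforce
              have xp: "(x, K) \<in> p" and "x \<in> N"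
                using z B' eq by (auto simp: B_def)
              then have "K \<subseteq> U"
                using fineD[OF fine xp] by (auto simp: \<gamma>_def)
              moreover obtain u v where "K = {u..v}" "Inf K = u" "Sup K = v"
                using interval[OF xp] by auto
              ultimately show ?thesis
                by (auto simp: J_def eq)
            qed
            then show "(\<Union>i\<in>J ` B'. case i of (x, y) \<Rightarrow> {x<..<y}) \<subseteq> U"
              unfolding split_def by blast
          qed (use U in simp)
          finally show ?thesis
            using U\<delta> \<delta> by (metis ennreal_less_iff le_less_trans less_imp_le linorder_not_less ennreal_leI)
        qed
        from small[OF fin bounds disj this]
        have "(\<Sum>z\<in>B'. norm (f (Sup (snd z)) - f (Inf (snd z)))) < e / 2"
          using J_inj by (simp add: split_def sum.reindex) (simp add: J_def)
        moreover have "norm (sum err B) \<le> (\<Sum>z\<in>B. norm (f (Sup (snd z)) - f (Inf (snd z))))"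
          by (intro sum_norm_le) (auto simp: err_def B_def g'_def norm_minus_commute)
        moreover have "\<dots> = (\<Sum>z\<in>B'. norm (f (Sup (snd z)) - f (Inf (snd z))))"
        proof (rule sum.mono_neutral_right[OF B(2) B'(1)], intro ballI)
          fix z assume z: "z \<in> B - B'"
          obtain x K where eq: "z = (x, K)"
            by fastforce
          have "(x, K) \<in> p" "\<not> Inf K < Sup K"
            using z B eq by (auto simp: B'_def)
          then have "Inf K = Sup K"
            using interval[of x K] by auto
          then show "norm (f (Sup (snd z)) - f (Inf (snd z))) = 0"
            by (simp add: eq)
        qed
        ultimately show ?thesis
          by linarith
      qed
      finally show "norm ((\<Sum>(x, K)\<in>p. measure lborel K *\<^sub>R g' x) - (f b - f a)) < e"
        using e1(2) by linarith
    qed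
  qed
  then show ?thesis
    unfolding box_real by (rule has_integral_spike[OF \<open>negligible N\<close>, rotated]) (auto simp: g'_def)
qed

lemma abs_continuous_on_subinterval:
  assumes "abs_continuous_on a b f" "a \<le> c" "d \<le> b"
  shows "abs_continuous_on c d f"
  unfolding abs_continuous_on_def
proof (intro allI impI)
  fix \<epsilon> :: real assume "\<epsilon> > 0"
  then obtain \<delta> where \<delta>: "\<delta> > 0" and small: "\<forall>I. finite I \<and> (\<forall>(x, y)\<in>I. a \<le> x \<and> x < y \<and> y \<le> b) \<and>
      disjoint_family_on (\<lambda>(x, y). {x<..<y}) I \<and> (\<Sum>(x, y)\<in>I. y - x) < \<delta> \<longrightarrow>
      (\<Sum>(x, y)\<in>I. norm (f y - f x)) < \<epsilon>"
    using assms(1) unfolding abs_continuous_on_def by blast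
  show "\<exists>\<delta>>0. \<forall>I. finite I \<and> (\<forall>(x, y)\<in>I. c \<le> x \<and> x < y \<and> y \<le> d) \<and>
      disjoint_family_on (\<lambda>(x, y). {x<..<y}) I \<and> (\<Sum>(x, y)\<in>I. y - x) < \<delta> \<longrightarrow>
      (\<Sum>(x, y)\<in>I. norm (f y - f x)) < \<epsilon>"
  proof (intro exI[of _ \<delta>] conjI allI impI)
    fix I assume I: "finite I \<and> (\<forall>(x, y)\<in>I. c \<le> x \<and> x < y \<and> y \<le> d) \<and>
      disjoint_family_on (\<lambda>(x, y). {x<..<y}) I \<and> (\<Sum>(x, y)\<in>I. y - x) < \<delta>"
    have "\<forall>(x, y)\<in>I. a \<le> x \<and> x < y \<and> y \<le> b"
    proof
      fix i assume "i \<in> I"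
      with I have "case i of (x, y) \<Rightarrow> c \<le> x \<and> x < y \<and> y \<le> d"
        by blast
      then show "case i of (x, y) \<Rightarrow> a \<le> x \<and> x < y \<and> y \<le> b"
        using assms(2,3) by (auto simp: split_def)
    qed
    with I show "(\<Sum>(x, y)\<in>I. norm (f y - f x)) < \<epsilon>"
      by (intro small[rule_format] conjI) simp_all
  qed (rule \<delta>)
qed

text \<open>This is absolute continuity with derivative \<open>f\<close> almost everywhere, in the integral form in which it is
  used for the product rule and for weak derivatives.\<close>

definition primitive_on :: "real \<Rightarrow> real \<Rightarrow> (real \<Rightarrow> 'b::euclidean_space) \<Rightarrow> (real \<Rightarrow> 'b) \<Rightarrow> bool" where
  "primitive_on a b F f \<longleftrightarrow> f absolutely_integrable_on {a..b} \<and>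
     (\<forall>x\<in>{a..b}. F x = F a + integral {a..x} f)"

lemma primitive_onD:
  assumes "primitive_on a b F f"
  shows "f absolutely_integrable_on {a..b}" "x \<in> {a..b} \<Longrightarrow> F x = F a + integral {a..x} f"
  using assms unfolding primitive_on_def by blast+

lemma primitive_on_continuous:
  assumes "primitive_on a b F f"
  shows "continuous_on {a..b} F"
proof -
  have "f integrable_on {a..b}"
    by (rule set_lebesgue_integral_eq_integral(1)[OF primitive_onD(1)[OF assms]])
  then have "continuous_on {a..b} (\<lambda>x. F a + integral {a..x} f)"
    by (intro continuous_intros indefinite_integral_continuous_1)
  then show ?thesis
    by (rule continuous_on_eq) (rule primitive_onD(2)[OF assms, symmetric])
qed

lemma integral_split:
  fixes f :: "real \<Rightarrow> 'b::euclidean_space"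
  assumes "f absolutely_integrable_on {a..b}" "a \<le> u" "u \<le> v" "v \<le> b"
  shows "integral {u..v} f = integral {a..v} f - integral {a..u} f"
proof -
  have "f integrable_on {a..v}"
    by (rule integrable_on_subinterval[OF set_lebesgue_integral_eq_integral(1)[OF assms(1)]])
      (use assms in auto)
  then show ?thesis
    using Henstock_Kurzweil_Integration.integral_combine[of a u v f] assms by (simp add: algebra_simps)
qed

lemma absolutely_integrable_subinterval:
  fixes f :: "real \<Rightarrow> 'b::euclidean_space"
  assumes "f absolutely_integrable_on {a..b}" "a \<le> u" "v \<le> b"
  shows "f absolutely_integrable_on {u..v}"
  by (rule set_integrable_subset[OF assms(1)]) (use assms in auto)

lemma primitive_on_diff:
  assumes "primitive_on a b F f" "a \<le> u" "u \<le> v" "v \<le> b"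
  shows "F v - F u = integral {u..v} f"
proof -
  have "F v = F a + integral {a..v} f" "F u = F a + integral {a..u} f"
    by (rule primitive_onD(2)[OF assms(1)]; use assms in auto)+
  then show ?thesis
    using integral_split[OF primitive_onD(1)[OF assms(1)] assms(2-)] by simp
qed

text \<open>The majorant is additive, so that the bounds over the pieces of a fine partition telescope.\<close>

lemma local_bound_imp_global_bound:
  fixes E :: "real \<Rightarrow> 'b::real_normed_vector" and V :: "real \<Rightarrow> real"
  assumes \<delta>: "\<delta> > 0" and ab: "a \<le> b"
    and loc: "\<And>u v. a \<le> u \<Longrightarrow> u \<le> v \<Longrightarrow> v \<le> b \<Longrightarrow> v - u < \<delta> \<Longrightarrow> norm (E v - E u) \<le> V v - V u"
  shows "norm (E b - E a) \<le> V b - V a"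
proof -
  obtain n :: nat where n: "(b - a) / \<delta> < real n"
    using reals_Archimedean2 by blast
  have n0: "n > 0"
  proof -
    have "0 \<le> (b - a) / \<delta>"
      using \<delta> ab by simp
    with n show ?thesis
      by simp
  qed
  define w where "w = (b - a) / real n"
  define x where "x i = a + real i * w" for i
  have step: "w < \<delta>" "0 \<le> w" and nw: "real n * w = b - a"
    using n n0 \<delta> ab by (auto simp: w_def field_simps)
  have "norm (E (x i) - E a) \<le> V (x i) - V a" if "i \<le> n" for i
    using that
  proof (induction i)
    case (Suc i)
    have le: "x (Suc i) = x i + w" "a \<le> x i"
      using step(2) by (simp_all add: x_def algebra_simps)
    have "real (Suc i) * w \<le> real n * w"
      using Suc.prems step(2) by (intro mult_right_mono) auto
    then have "x (Suc i) \<le> b"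
      unfolding nw by (simp add: x_def)
    then have "norm (E (x (Suc i)) - E (x i)) \<le> V (x (Suc i)) - V (x i)"
      using step le by (intro loc) auto
    then show ?case
      using Suc norm_triangle_ineq[of "E (x (Suc i)) - E (x i)" "E (x i) - E a"] by simp
  qed (simp add: x_def)
  from this[of n] show ?thesis
    by (simp add: x_def nw)
qed

lemma scaled_epsilon_bounds:
  fixes K w \<epsilon> :: real
  assumes "K > 0" "w \<ge> 0" "\<epsilon> > 0"
  shows "\<epsilon> / (K * (w + 1)) > 0" "K * (\<epsilon> / (K * (w + 1))) * w \<le> \<epsilon>"
proof -
  show "\<epsilon> / (K * (w + 1)) > 0"
    using assms by simp
  have "K * (\<epsilon> / (K * (w + 1))) * w = \<epsilon> * (w / (w + 1))"
    using assms by simp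
  also have "\<dots> \<le> \<epsilon> * 1"
    using assms by (intro mult_left_mono) auto
  finally show "K * (\<epsilon> / (K * (w + 1))) * w \<le> \<epsilon>"
    by simp
qed

text \<open>Let \<open>E\<close> be the difference of the two sides of the integrated product rule. On a short interval
  \<open>[u,v]\<close> its increment is the integral of \<open>B (f s) (G v - G s) + B (F u - F s) (g s)\<close>, which by uniform
  continuity of \<open>F\<close> and \<open>G\<close> is at most \<open>K \<epsilon>'\<close> times the integral of \<open>norm (f s) + norm (g s)\<close>. Summing over a
  partition shows that \<open>E\<close> is constant.\<close>

lemma primitive_on_bilinear:
  fixes B :: "'b::euclidean_space \<Rightarrow> 'c::euclidean_space \<Rightarrow> 'd::euclidean_space"
  assumes bil: "bounded_bilinear B" and ab: "a \<le> b"
    and F: "primitive_on a b F f" and G: "primitive_on a b G g"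
  shows "primitive_on a b (\<lambda>x. B (F x) (G x)) (\<lambda>x. B (F x) (g x) + B (f x) (G x))"
proof -
  interpret B: bounded_bilinear B
    by (rule bil)
  have bil': "bilinear B" "bilinear (\<lambda>y x. B x y)"
    using bil B.flip by (auto simp: bilinear_conv_bounded_bilinear)
  note cF = primitive_on_continuous[OF F] and cG = primitive_on_continuous[OF G]
  note fi = primitive_onD(1)[OF F] and gi = primitive_onD(1)[OF G]
  have meas: "h \<in> borel_measurable (lebesgue_on {a..b})" "bounded (h ` {a..b})"
    if "continuous_on {a..b} h" for h :: "real \<Rightarrow> 'z::euclidean_space"
    using that by (auto intro!: continuous_imp_measurable_on_sets_lebesgue compact_imp_bounded
        compact_continuous_image)
  have int1: "(\<lambda>x. B (F x) (g x)) absolutely_integrable_on {a..b}"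
    by (rule absolutely_integrable_bounded_measurable_product[OF bil'(1) meas(1)[OF cF] _ meas(2)[OF cF] gi]) simp
  have int2: "(\<lambda>x. B (f x) (G x)) absolutely_integrable_on {a..b}"
    by (rule absolutely_integrable_bounded_measurable_product[OF bil'(2) meas(1)[OF cG] _ meas(2)[OF cG] fi]) simp
  define k where "k x = B (F x) (g x) + B (f x) (G x)" for x
  have k: "k absolutely_integrable_on {a..b}"
    unfolding k_def by (intro set_integral_add int1 int2)
  obtain K where K: "K > 0" "\<And>x y. norm (B x y) \<le> norm x * norm y * K"
    using B.pos_bounded by auto
  define E where "E x = B (F x) (G x) - integral {a..x} k" for x
  define V where "V x = integral {a..x} (\<lambda>s. norm (f s) + norm (g s))" for x
  have Vi: "(\<lambda>s. norm (f s) + norm (g s)) absolutely_integrable_on {a..b}"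
    by (intro set_integral_add absolutely_integrable_norm[unfolded o_def] fi gi)
  have const: "E c = E a" if c: "c \<in> {a..b}" for c
  proof -
    have "norm (E c - E a) \<le> \<epsilon>" if "\<epsilon> > 0" for \<epsilon>
    proof -
      define \<epsilon>' where "\<epsilon>' = \<epsilon> / (K * (V c - V a + 1))"
      have Vc: "V c - V a \<ge> 0"
      proof -
        have "(\<lambda>s. norm (f s) + norm (g s)) integrable_on {a..c}"
          by (rule set_lebesgue_integral_eq_integral(1)[OF absolutely_integrable_subinterval[OF Vi]])
            (use c in auto)
        then have "0 \<le> V c"
          unfolding V_def by (rule integral_nonneg) simp
        then show ?thesis
          by (simp add: V_def)
      qed
      have \<epsilon>': "\<epsilon>' > 0" "K * \<epsilon>' * (V c - V a) \<le> \<epsilon>"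
        unfolding \<epsilon>'_def by (rule scaled_epsilon_bounds[OF K(1) Vc \<open>\<epsilon> > 0\<close>])+
      have "uniformly_continuous_on {a..b} F" "uniformly_continuous_on {a..b} G"
        using cF cG by (auto intro: compact_uniformly_continuous)
      note uc = this[unfolded uniformly_continuous_on_def, rule_format, OF \<epsilon>'(1)]
      obtain \<delta>1 where \<delta>1: "\<delta>1 > 0"
        and d1: "\<forall>x\<in>{a..b}. \<forall>y\<in>{a..b}. dist y x < \<delta>1 \<longrightarrow> dist (F y) (F x) < \<epsilon>'"
        using uc(1) by blast
      obtain \<delta>2 where \<delta>2: "\<delta>2 > 0"
        and d2: "\<forall>x\<in>{a..b}. \<forall>y\<in>{a..b}. dist y x < \<delta>2 \<longrightarrow> dist (G y) (G x) < \<epsilon>'"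
        using uc(2) by blast
      have "norm (E c - E a) \<le> K * \<epsilon>' * V c - K * \<epsilon>' * V a"
      proof (rule local_bound_imp_global_bound[of "min \<delta>1 \<delta>2"])
        fix u v assume uv: "a \<le> u" "u \<le> v" "v \<le> c" "v - u < min \<delta>1 \<delta>2"
        then have vb: "v \<le> b"
          using c by simp
        have sub: "h integrable_on {u..v}" if "h absolutely_integrable_on {a..b}"
          for h :: "real \<Rightarrow> 'z::euclidean_space"
          by (rule set_lebesgue_integral_eq_integral(1)[OF absolutely_integrable_subinterval[OF that uv(1) vb]])
        have hi: "((\<lambda>s. B (f s) (G v) + B (F u) (g s) - k s) has_integral
            B (integral {u..v} f) (G v) + B (F u) (integral {u..v} g) - integral {u..v} k) {u..v}"
          by (rule has_integral_diff[OF has_integral_add[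
              OF has_integral_linear[OF integrable_integral[OF sub[OF fi]] B.bounded_linear_left[of "G v"], unfolded o_def]
                has_integral_linear[OF integrable_integral[OF sub[OF gi]] B.bounded_linear_right[of "F u"], unfolded o_def]]
              integrable_integral[OF sub[OF k]]])
        have "E v - E u = B (F v - F u) (G v) + B (F u) (G v - G u) - integral {u..v} k"
          using integral_split[OF k uv(1,2) vb] by (simp add: E_def B.diff_left B.diff_right)
        then have Euv: "((\<lambda>s. B (f s) (G v) + B (F u) (g s) - k s) has_integral (E v - E u)) {u..v}"
          using hi by (simp add: primitive_on_diff[OF F uv(1,2) vb] primitive_on_diff[OF G uv(1,2) vb])
        have "norm (integral {u..v} (\<lambda>s. B (f s) (G v) + B (F u) (g s) - k s))
            \<le> integral {u..v} (\<lambda>s. K * \<epsilon>' * (norm (f s) + norm (g s)))"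
        proof (rule integral_norm_bound_integral)
          show "(\<lambda>s. B (f s) (G v) + B (F u) (g s) - k s) integrable_on {u..v}"
            by (rule has_integral_integrable[OF Euv])
          show "(\<lambda>s. K * \<epsilon>' * (norm (f s) + norm (g s))) integrable_on {u..v}"
            by (intro integrable_on_mult_right sub Vi)
          fix s assume s: "s \<in> {u..v}"
          have ds: "dist v s < min \<delta>1 \<delta>2" "dist u s < min \<delta>1 \<delta>2" and mem: "u \<in> {a..b}" "v \<in> {a..b}" "s \<in> {a..b}"
            using s uv vb by (auto simp: dist_real_def)
          have "norm (G v - G s) \<le> \<epsilon>'" "norm (F u - F s) \<le> \<epsilon>'"
            using d1[rule_format, OF mem(3,1)] d2[rule_format, OF mem(3,2)] ds by (auto simp: dist_norm)
          have "B (f s) (G v) + B (F u) (g s) - k s = B (f s) (G v - G s) + B (F u - F s) (g s)"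
            by (simp add: k_def B.diff_left B.diff_right)
          then have "norm (B (f s) (G v) + B (F u) (g s) - k s)
              \<le> norm (f s) * norm (G v - G s) * K + norm (F u - F s) * norm (g s) * K"
            using norm_triangle_ineq[of "B (f s) (G v - G s)" "B (F u - F s) (g s)"]
              K(2)[of "f s" "G v - G s"] K(2)[of "F u - F s" "g s"] by simp
          also have "\<dots> \<le> norm (f s) * \<epsilon>' * K + \<epsilon>' * norm (g s) * K"
            using \<open>norm (G v - G s) \<le> \<epsilon>'\<close> \<open>norm (F u - F s) \<le> \<epsilon>'\<close> K(1)
            by (intro add_mono mult_right_mono mult_left_mono) auto
          finally show "norm (B (f s) (G v) + B (F u) (g s) - k s) \<le> K * \<epsilon>' * (norm (f s) + norm (g s))"
            by (simp add: algebra_simps)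
        qed
        also have "\<dots> = K * \<epsilon>' * (V v - V u)"
          unfolding V_def using integral_split[OF Vi uv(1,2) vb] by simp
        finally show "norm (E v - E u) \<le> K * \<epsilon>' * V v - K * \<epsilon>' * V u"
          using integral_unique[OF Euv] by (simp add: right_diff_distrib)
      qed (use \<delta>1 \<delta>2 c in auto)
      with \<epsilon>'(2) show ?thesis
        by (simp add: right_diff_distrib)
    qed
    then have "norm (E c - E a) \<le> 0"
      by (rule field_le_epsilon) simp
    then show ?thesis
      by simp
  qed
  show ?thesis
    unfolding primitive_on_def
  proof (intro conjI ballI)
    show "(\<lambda>x. B (F x) (g x) + B (f x) (G x)) absolutely_integrable_on {a..b}"
      using k by (simp add: k_def[abs_def])
    show "B (F x) (G x) = B (F a) (G a) + integral {a..x} (\<lambda>x. B (F x) (g x) + B (f x) (G x))"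
      if "x \<in> {a..b}" for x
      using const[OF that] by (simp add: E_def k_def[abs_def] algebra_simps)
  qed
qed

lemma abs_continuous_primitive_on:
  fixes f g :: "real \<Rightarrow> 'b::euclidean_space"
  assumes ab: "a \<le> b" and ac: "abs_continuous_on a b f"
    and der: "AE x in lebesgue. x \<in> {a<..<b} \<longrightarrow> (f has_vector_derivative g x) (at x)"
    and bound: "\<And>x. x \<in> {a..b} \<Longrightarrow> norm (g x) \<le> M"
  shows "primitive_on a b f g"
  unfolding primitive_on_def
proof (intro conjI ballI)
  show "g absolutely_integrable_on {a..b}"
    by (rule absolutely_integrable_integrable_bound[of _ _ "\<lambda>_. M"])
      (use bound abs_continuous_FTC[OF ab ac der] in auto)
  fix x assume x: "x \<in> {a..b}"
  have "(g has_integral (f x - f a)) {a..x}"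
  proof (rule abs_continuous_FTC)
    show "abs_continuous_on a x f"
      by (rule abs_continuous_on_subinterval[OF ac]) (use x in auto)
    show "AE y in lebesgue. y \<in> {a<..<x} \<longrightarrow> (f has_vector_derivative g y) (at y)"
      using der by eventually_elim (use x in auto)
  qed (use x in auto)
  then show "f x = f a + integral {a..x} g"
    by (simp add: integral_unique)
qed

section \<open>Functions with a weak derivative\<close>

lemma square_integrable_imp_absolutely_integrable:
  fixes f :: "real \<Rightarrow> 'b::euclidean_space"
  assumes f: "square_integrable f"
  shows "f absolutely_integrable_on {a..b}"
  unfolding set_integrable_def
proof (rule Bochner_Integration.integrable_bound)
  have meas: "f \<in> borel_measurable lebesgue" and int: "integrable lebesgue (\<lambda>x. (norm (f x))\<^sup>2)"
    using f by (auto simp: square_integrable_def)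
  have "integrable lebesgue (indicator {a..b} :: real \<Rightarrow> real)"
    by (rule integrable_real_indicator) (auto simp: emeasure_lborel_Icc_eq)
  then show "integrable lebesgue (\<lambda>x. indicator {a..b} x + (norm (f x))\<^sup>2)"
    using int by (rule Bochner_Integration.integrable_add)
  show "(\<lambda>x. indicator {a..b} x *\<^sub>R f x) \<in> borel_measurable lebesgue"
    by (intro borel_measurable_scaleR borel_measurable_indicator meas) auto
  have "norm (indicator {a..b} x *\<^sub>R f x) \<le> norm (indicator {a..b} x + (norm (f x))\<^sup>2)" for x
  proof -
    have "norm (f x) \<le> 1 + (norm (f x))\<^sup>2"
      using sum_squares_bound[of 1 "norm (f x)"] norm_ge_zero[of "f x"] unfolding power_one by linarith
    then show ?thesis
      by (auto simp: indicator_def)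
  qed
  then show "AE x in lebesgue. norm (indicator {a..b} x *\<^sub>R f x)
      \<le> norm (indicator {a..b} x + (norm (f x))\<^sup>2)"
    by simp
qed

lemma rep_L2_absolutely_integrable: "rep_L2 u absolutely_integrable_on {a..b}"
  by (rule square_integrable_imp_absolutely_integrable[OF square_integrable_rep])

lemma continuous_scaleR_absolutely_integrable:
  fixes f :: "real \<Rightarrow> 'b::euclidean_space" and \<psi> :: "real \<Rightarrow> real"
  assumes "continuous_on {a..b} \<psi>" "f absolutely_integrable_on {a..b}"
  shows "(\<lambda>x. \<psi> x *\<^sub>R f x) absolutely_integrable_on {a..b}"
proof (rule absolutely_integrable_bounded_measurable_product[where h = "(*\<^sub>R)" and f = \<psi>, OF _ _ _ _ assms(2)])
  show "bilinear ((*\<^sub>R) :: real \<Rightarrow> 'b \<Rightarrow> 'b)"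
    by (simp add: bilinear_conv_bounded_bilinear bounded_bilinear_scaleR)
  show "\<psi> \<in> borel_measurable (lebesgue_on {a..b})"
    by (rule continuous_imp_measurable_on_sets_lebesgue[OF assms(1)]) simp
  show "bounded (\<psi> ` {a..b})"
    by (intro compact_imp_bounded compact_continuous_image assms) simp
qed simp

lemma smooth_primitive_on:
  fixes \<phi> :: "real \<Rightarrow> 'b::euclidean_space"
  assumes "smooth \<phi>"
  shows "primitive_on a b \<phi> (vderiv \<phi>)"
  unfolding primitive_on_def
proof (intro conjI ballI)
  show "vderiv \<phi> absolutely_integrable_on {a..b}"
    by (rule absolutely_integrable_continuous_real[OF smooth_continuous_on[OF smooth_vderiv[OF assms]]])
  fix x assume "x \<in> {a..b}"
  then have "(vderiv \<phi> has_integral (\<phi> x - \<phi> a)) {a..x}"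
    by (intro fundamental_theorem_of_calculus
        has_vector_derivative_at_within[OF smooth_has_vderiv[OF assms]]) simp
  from integral_unique[OF this] show "\<phi> x = \<phi> a + integral {a..x} (vderiv \<phi>)"
    by simp
qed

lemma test_function_endpoints:
  assumes "\<phi> \<in> test_functions a b" "a < b"
  shows "\<phi> a = 0" "\<phi> b = 0"
proof -
  obtain \<alpha> \<beta> where \<alpha>\<beta>: "a < \<alpha>" "\<alpha> < \<beta>" "\<beta> < b" and supp: "\<And>x. \<phi> x \<noteq> 0 \<Longrightarrow> \<alpha> < x \<and> x < \<beta>"
    using test_functionE[OF assms] by metis
  show "\<phi> a = 0"
    using supp[of a] \<alpha>\<beta> by (cases "\<phi> a = 0") simp_all
  show "\<phi> b = 0"
    using supp[of b] \<alpha>\<beta> by (cases "\<phi> b = 0") simp_all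
qed

lemma set_lebesgue_integral_open_interval:
  fixes f :: "real \<Rightarrow> 'b::euclidean_space"
  assumes "f absolutely_integrable_on {a..b}"
  shows "(LINT x:{a<..<b}|lebesgue. f x) = integral {a..b} f"
proof -
  have "f absolutely_integrable_on {a<..<b}"
    by (rule set_integrable_subset[OF assms]) auto
  then show ?thesis
    unfolding integral_open_interval_real by (rule set_lebesgue_integral_eq_integral(2))
qed

lemma weak_derivative_integral:
  fixes u v :: "'b::euclidean_space L2"
  assumes "weak_derivative a b u v" "\<phi> \<in> test_functions a b"
  shows "integral {a..b} (\<lambda>x. vderiv \<phi> x *\<^sub>R rep_L2 u x) = - integral {a..b} (\<lambda>x. \<phi> x *\<^sub>R rep_L2 v x)"
proof -
  note s = test_function_smooth[OF assms(2)]
  have "(\<lambda>x. vderiv \<phi> x *\<^sub>R rep_L2 u x) absolutely_integrable_on {a..b}"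
    "(\<lambda>x. \<phi> x *\<^sub>R rep_L2 v x) absolutely_integrable_on {a..b}"
    by (rule continuous_scaleR_absolutely_integrable[OF smooth_continuous_on[OF smooth_vderiv[OF s]]
          rep_L2_absolutely_integrable])
      (rule continuous_scaleR_absolutely_integrable[OF smooth_continuous_on[OF s]
          rep_L2_absolutely_integrable])
  note eq = this[THEN set_lebesgue_integral_open_interval, symmetric]
  show ?thesis
    unfolding eq by (rule assms(1)[unfolded weak_derivative_def, THEN bspec, OF assms(2)])
qed

text \<open>The vanishing integral makes the antiderivative return to \<open>0\<close> on the right of the support.\<close>

lemma test_function_antiderivative:
  fixes \<phi> :: "real \<Rightarrow> real"
  assumes ab: "a < b" and \<phi>: "\<phi> \<in> test_functions a b" and zero: "integral {a..b} \<phi> = 0"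
  defines "\<Psi> \<equiv> \<lambda>x. integral {a..x} \<phi>"
  shows "\<Psi> \<in> test_functions a b" "vderiv \<Psi> = \<phi>"
proof -
  note s = test_function_smooth[OF \<phi>]
  obtain \<alpha> \<beta> where \<alpha>\<beta>: "a < \<alpha>" "\<alpha> < \<beta>" "\<beta> < b" and supp: "\<And>x. \<phi> x \<noteq> 0 \<Longrightarrow> \<alpha> < x \<and> x < \<beta>"
    using test_functionE[OF \<phi> ab] by metis
  have left: "\<Psi> x = 0" if "x \<le> \<alpha>" for x
  proof -
    have "\<phi> y = 0" if "y \<in> {a..x}" for y
      using supp[of y] that \<open>x \<le> \<alpha>\<close> by (cases "\<phi> y = 0") simp_all
    then have "integral {a..x} \<phi> = integral {a..x} (\<lambda>_. 0)"
      by (rule Henstock_Kurzweil_Integration.integral_cong)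
    then show ?thesis
      by (simp add: \<Psi>_def)
  qed
  have right: "\<Psi> x = integral {a..\<beta>} \<phi>" if "\<beta> \<le> x" for x
  proof -
    have "integral {\<beta>..x} \<phi> = 0"
    proof -
      have "\<phi> y = 0" if "y \<in> {\<beta>..x}" for y
        using supp[of y] that by (cases "\<phi> y = 0") simp_all
      then have "integral {\<beta>..x} \<phi> = integral {\<beta>..x} (\<lambda>_. 0)"
        by (rule Henstock_Kurzweil_Integration.integral_cong)
      then show ?thesis
        by simp
    qed
    moreover have "integral {\<beta>..x} \<phi> = integral {a..x} \<phi> - integral {a..\<beta>} \<phi>"
      using \<alpha>\<beta> that by (intro integral_split[where a = a and b = x])
        (auto intro!: absolutely_integrable_continuous_real smooth_continuous_on s)
    ultimately show ?thesis
      by (simp add: \<Psi>_def)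
  qed
  have right0: "\<Psi> x = 0" if "\<beta> \<le> x" for x
    using right[of b] right[OF that] \<alpha>\<beta> zero by (simp add: \<Psi>_def)
  have d: "(\<Psi> has_vector_derivative \<phi> x) (at x)" for x
  proof (cases "x < \<alpha>")
    case True
    have "\<phi> x = 0"
      using supp[of x] True by (cases "\<phi> x = 0") simp_all
    then have "((\<lambda>_. 0) has_vector_derivative \<phi> x) (at x)"
      by simp
    then show ?thesis
      by (rule has_vector_derivative_transform_within_open[of _ _ _ "{..<\<alpha>}"])
        (use True left in auto)
  next
    case False
    have "(\<Psi> has_vector_derivative \<phi> x) (at x within {a..x + 1})"
      unfolding \<Psi>_def using False \<alpha>\<beta>
      by (intro integral_has_vector_derivative smooth_continuous_on s) auto
    then have "(\<Psi> has_vector_derivative \<phi> x) (at x within {a<..<x + 1})"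
      by (rule has_vector_derivative_within_subset) auto
    then show ?thesis
      using False \<alpha>\<beta> by (simp add: at_within_open[of x "{a<..<x + 1}"])
  qed
  show "vderiv \<Psi> = \<phi>"
    by (rule vderivI[OF d])
  show "\<Psi> \<in> test_functions a b"
  proof (rule test_functionI[OF smoothI_vderiv[OF d s] \<alpha>\<beta>(1,3)])
    show "\<alpha> \<le> x \<and> x \<le> \<beta>" if "\<Psi> x \<noteq> 0" for x
      using left[of x] right0[of x] that by (cases "x \<le> \<alpha>"; cases "\<beta> \<le> x") auto
  qed
qed

lemma integral_bump_pos:
  assumes "a < \<alpha>" "\<alpha> < \<beta>" "\<beta> < b" "r > 0"
  shows "integral {a..b} (bump \<alpha> \<beta> r) > 0"
proof -
  have cont: "continuous_on {a..b} (bump \<alpha> \<beta> r)"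
    by (intro smooth_continuous_on smooth_bump)
  then have int: "bump \<alpha> \<beta> r integrable_on {a..b}"
    by (rule integrable_continuous_real)
  have "integral {a..b} (bump \<alpha> \<beta> r) \<ge> 0"
    by (rule integral_nonneg[OF int]) (rule bump_bounds)
  moreover have "integral {a..b} (bump \<alpha> \<beta> r) \<noteq> 0"
  proof
    assume "integral {a..b} (bump \<alpha> \<beta> r) = 0"
    then have "(bump \<alpha> \<beta> r has_integral 0) (cbox a b)"
      using integrable_integral[OF int] by simp
    then have "bump \<alpha> \<beta> r ((\<alpha> + \<beta>) / 2) = 0"
      using has_integral_0_cbox_imp_0[of a b "bump \<alpha> \<beta> r" "(\<alpha> + \<beta>) / 2"] cont bump_bounds assms
      by (simp add: box_ne_empty)
    moreover have "bump \<alpha> \<beta> r ((\<alpha> + \<beta>) / 2) > 0"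
      using assms by (simp add: bump_pos)
    ultimately show False
      by simp
  qed
  ultimately show ?thesis
    by simp
qed

text \<open>The fundamental lemma of the calculus of variations: testing componentwise shows that \<open>y\<close> is
  orthogonal to a dense set, hence to itself.\<close>

lemma orthogonal_to_test_functions:
  fixes y :: "'b::euclidean_space L2"
  assumes ab: "a < b" and y: "y \<in> L2_on a b"
    and orth: "\<And>\<psi> :: real \<Rightarrow> real. \<psi> \<in> test_functions a b \<Longrightarrow>
      integral {a..b} (\<lambda>x. \<psi> x *\<^sub>R rep_L2 y x) = 0"
  shows "y = 0"
proof -
  have "inner (abs_L2 \<phi>) y = 0" if \<phi>: "\<phi> \<in> test_functions a b" for \<phi> :: "real \<Rightarrow> 'b"
  proof -
    note s = test_function_smooth[OF \<phi>]
    have ii: "(\<lambda>x. (\<phi> x \<bullet> i) *\<^sub>R rep_L2 y x) absolutely_integrable_on {a..b}" for i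
      by (intro continuous_scaleR_absolutely_integrable rep_L2_absolutely_integrable continuous_intros
          smooth_continuous_on s)
    have test: "(\<lambda>x. \<phi> x \<bullet> i) \<in> test_functions a b" for i
    proof (rule test_functionI_compact)
      show "smooth (\<lambda>x. \<phi> x \<bullet> i)"
        by (rule smooth_bilinear[OF bounded_bilinear_inner s smooth_const])
      show "compact (closure {x. \<phi> x \<noteq> 0})" "closure {x. \<phi> x \<noteq> 0} \<subseteq> {a<..<b}"
        using \<phi> unfolding test_functions_iff by blast+
      show "x \<in> closure {x. \<phi> x \<noteq> 0}" if "\<phi> x \<bullet> i \<noteq> 0" for x
      proof -
        have "\<phi> x \<noteq> 0"
          using that by auto
        then show ?thesis
          using closure_subset[of "{x. \<phi> x \<noteq> 0}"] by blast
      qed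
    qed
    have int: "integral {a..b} (\<lambda>x. (\<phi> x \<bullet> i) * (rep_L2 y x \<bullet> i)) = 0" for i
      using integral_linear[OF set_lebesgue_integral_eq_integral(1)[OF ii] bounded_linear_inner_left, of i i]
        orth[OF test, of i] by (simp add: o_def)
    have int': "(\<lambda>x. (\<phi> x \<bullet> i) * (rep_L2 y x \<bullet> i)) integrable_on {a..b}" for i
      using integrable_linear[OF set_lebesgue_integral_eq_integral(1)[OF ii] bounded_linear_inner_left, of i i]
      by (simp add: o_def)
    have "inner (abs_L2 \<phi>) y = (LINT x|lebesgue. \<phi> x \<bullet> rep_L2 y x)"
      using inner_abs_L2[OF test_function_square_integrable[OF \<phi> ab] square_integrable_rep[of y]]
      by (simp add: abs_rep_L2)
    also have "\<dots> = (LINT x:{a..b}|lebesgue. \<phi> x \<bullet> rep_L2 y x)"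
    proof -
      have zero: "\<phi> x = 0" if "x \<notin> {a..b}" for x
      proof (rule ccontr)
        assume "\<phi> x \<noteq> 0"
        then have "x \<in> {a<..<b}"
          using \<phi> closure_subset[of "{x. \<phi> x \<noteq> 0}"] unfolding test_functions_iff by blast
        with that show False
          by simp
      qed
      have "\<phi> x \<bullet> rep_L2 y x = indicator {a..b} x *\<^sub>R (\<phi> x \<bullet> rep_L2 y x)" for x
        by (cases "x \<in> {a..b}") (simp_all add: zero)
      then show ?thesis
        unfolding set_lebesgue_integral_def by (rule Bochner_Integration.integral_cong[OF refl])
    qed
    also have "\<dots> = integral {a..b} (\<lambda>x. \<phi> x \<bullet> rep_L2 y x)"
    proof (rule set_lebesgue_integral_eq_integral(2))
      have "integrable lebesgue (\<lambda>x. \<phi> x \<bullet> rep_L2 y x)"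
        by (rule square_integrable_inner[OF test_function_square_integrable[OF \<phi> ab] square_integrable_rep])
      then show "(\<lambda>x. \<phi> x \<bullet> rep_L2 y x) absolutely_integrable_on {a..b}"
        unfolding set_integrable_def by (intro integrable_mult_indicator) auto
    qed
    also have "\<dots> = integral {a..b} (\<lambda>x. \<Sum>i\<in>Basis. (\<phi> x \<bullet> i) * (rep_L2 y x \<bullet> i))"
      by (simp add: euclidean_inner[symmetric])
    also have "\<dots> = 0"
      by (simp add: integral_sum int int')
    finally show ?thesis .
  qed
  then have "abs_L2 ` test_functions a b \<subseteq> {p. inner p y = 0}"
    by auto
  then have "closure (abs_L2 ` test_functions a b) \<subseteq> {p. inner p y = 0}"
    by (rule closure_minimal) (intro closed_Collect_eq continuous_intros)
  then have "inner y y = 0"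
    using test_functions_dense[OF ab y] by blast
  then show ?thesis
    by simp
qed

text \<open>The lemma of du Bois-Reymond. With an antiderivative \<open>Z\<close> of \<open>v\<close>, the product rule shows that \<open>u - Z\<close> is
  annihilated by the derivatives of all test functions. A test function is such a derivative when its
  integral vanishes, which subtracting a multiple of a fixed bump \<open>\<rho>\<close> achieves; thus \<open>u - Z - c\<close> is
  annihilated by every test function, for a suitable constant \<open>c\<close>.\<close>

theorem weak_derivative_primitive_on:
  fixes u v :: "'b::euclidean_space L2"
  assumes ab: "a < b" and uv: "weak_derivative a b u v"
  obtains W where "primitive_on a b W (rep_L2 v)"
    "AE x in lebesgue. x \<in> {a<..<b} \<longrightarrow> W x = rep_L2 u x"
proof -
  define Z where "Z x = integral {a..x} (rep_L2 v)" for x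
  have Z: "primitive_on a b Z (rep_L2 v)"
    unfolding primitive_on_def using rep_L2_absolutely_integrable by (simp add: Z_def)
  note cZ = primitive_on_continuous[OF Z]
\<comment> \<open>\<open>Z\<close> is one antiderivative of \<open>v\<close>; it remains to see that \<open>u - Z\<close> is constant.\<close>
  have rest: "(\<lambda>x. rep_L2 u x - Z x) absolutely_integrable_on {a..b}"
    by (intro set_integral_diff rep_L2_absolutely_integrable absolutely_integrable_continuous_real cZ)
  have HK: "(\<lambda>x. \<psi> x *\<^sub>R f x) integrable_on {a..b}"
    if "smooth \<psi>" "f absolutely_integrable_on {a..b}" for \<psi> :: "real \<Rightarrow> real" and f :: "real \<Rightarrow> 'b"
    by (intro set_lebesgue_integral_eq_integral(1) continuous_scaleR_absolutely_integrable
        smooth_continuous_on that)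
  have deriv0: "integral {a..b} (\<lambda>x. vderiv \<phi> x *\<^sub>R (rep_L2 u x - Z x)) = 0"
    if \<phi>: "\<phi> \<in> test_functions a b" for \<phi>
  proof -
    note s = test_function_smooth[OF \<phi>]
    note P = primitive_on_bilinear[OF bounded_bilinear_scaleR less_imp_le[OF ab] smooth_primitive_on[OF s] Z]
    have "integral {a..b} (\<lambda>x. \<phi> x *\<^sub>R rep_L2 v x + vderiv \<phi> x *\<^sub>R Z x) = 0"
      using primitive_onD(2)[OF P, of b] ab by (simp add: test_function_endpoints[OF \<phi> ab])
    then have "integral {a..b} (\<lambda>x. \<phi> x *\<^sub>R rep_L2 v x) + integral {a..b} (\<lambda>x. vderiv \<phi> x *\<^sub>R Z x) = 0"
      by (subst (asm) Henstock_Kurzweil_Integration.integral_add)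
        (intro HK s smooth_vderiv rep_L2_absolutely_integrable absolutely_integrable_continuous_real cZ)+
    moreover have "integral {a..b} (\<lambda>x. vderiv \<phi> x *\<^sub>R (rep_L2 u x - Z x))
        = integral {a..b} (\<lambda>x. vderiv \<phi> x *\<^sub>R rep_L2 u x) - integral {a..b} (\<lambda>x. vderiv \<phi> x *\<^sub>R Z x)"
      unfolding scaleR_diff_right
      by (rule Henstock_Kurzweil_Integration.integral_diff)
        (intro HK s smooth_vderiv rep_L2_absolutely_integrable absolutely_integrable_continuous_real cZ)+
    ultimately show ?thesis
      using weak_derivative_integral[OF uv \<phi>] by (simp add: neg_eq_iff_add_eq_0)
  qed
  define \<rho> where "\<rho> = bump (a + (b - a) / 3) (b - (b - a) / 3) 1"
  define r where "r = integral {a..b} \<rho>"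
  have \<rho>: "\<rho> \<in> test_functions a b" "smooth \<rho>"
    unfolding \<rho>_def using ab by (auto intro!: bump_test_function smooth_bump)
  have r: "r > 0"
    unfolding r_def \<rho>_def using ab by (intro integral_bump_pos) (auto simp: field_simps)
  define c where "c = (1 / r) *\<^sub>R integral {a..b} (\<lambda>x. \<rho> x *\<^sub>R (rep_L2 u x - Z x))"
  have orth: "integral {a..b} (\<lambda>x. \<psi> x *\<^sub>R (rep_L2 u x - Z x - c)) = 0"
    if \<psi>: "\<psi> \<in> test_functions a b" for \<psi> :: "real \<Rightarrow> real"
  proof -
    note s = test_function_smooth[OF \<psi>]
    define k where "k = integral {a..b} \<psi> / r"
    define \<phi> where "\<phi> x = \<psi> x + (- k) *\<^sub>R \<rho> x" for x
    have \<phi>: "\<phi> \<in> test_functions a b"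
      unfolding \<phi>_def by (intro subspace_test_functions(2,4) \<psi> \<rho>)
    have int: "h integrable_on {a..b}" if "smooth h" for h :: "real \<Rightarrow> real"
      by (intro integrable_continuous_real smooth_continuous_on that)
    have "integral {a..b} \<phi> = integral {a..b} \<psi> + integral {a..b} (\<lambda>x. (- k) *\<^sub>R \<rho> x)"
      unfolding \<phi>_def using int[OF s] integrable_cmul[OF int[OF \<rho>(2)]]
      by (rule Henstock_Kurzweil_Integration.integral_add)
    also have "\<dots> = 0"
      using r by (simp add: k_def r_def[symmetric])
    finally have "integral {a..b} \<phi> = 0" .
    note anti = test_function_antiderivative[OF ab \<phi> this]
    have "0 = integral {a..b} (\<lambda>x. \<phi> x *\<^sub>R (rep_L2 u x - Z x))"
      using deriv0[OF anti(1)] unfolding anti(2) by simp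
    also have "\<dots> = integral {a..b} (\<lambda>x. \<psi> x *\<^sub>R (rep_L2 u x - Z x) + (- k) *\<^sub>R (\<rho> x *\<^sub>R (rep_L2 u x - Z x)))"
      by (simp add: \<phi>_def scaleR_diff_left)
    also have "\<dots> = integral {a..b} (\<lambda>x. \<psi> x *\<^sub>R (rep_L2 u x - Z x))
        + integral {a..b} (\<lambda>x. (- k) *\<^sub>R (\<rho> x *\<^sub>R (rep_L2 u x - Z x)))"
      by (rule Henstock_Kurzweil_Integration.integral_add[OF HK[OF s rest] integrable_cmul[OF HK[OF \<rho>(2) rest]]])
    also have "integral {a..b} (\<lambda>x. (- k) *\<^sub>R (\<rho> x *\<^sub>R (rep_L2 u x - Z x))) = - (integral {a..b} \<psi> *\<^sub>R c)"
      unfolding integral_cmul by (simp add: c_def k_def)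
    finally have "integral {a..b} (\<lambda>x. \<psi> x *\<^sub>R (rep_L2 u x - Z x)) = integral {a..b} \<psi> *\<^sub>R c"
      by simp
    moreover have "integral {a..b} (\<lambda>x. \<psi> x *\<^sub>R c) = integral {a..b} \<psi> *\<^sub>R c"
      using integral_linear[OF int[OF s] bounded_linear_scaleR_left, of c] by (simp add: o_def)
    moreover have "integral {a..b} (\<lambda>x. \<psi> x *\<^sub>R (rep_L2 u x - Z x - c))
        = integral {a..b} (\<lambda>x. \<psi> x *\<^sub>R (rep_L2 u x - Z x)) - integral {a..b} (\<lambda>x. \<psi> x *\<^sub>R c)"
      unfolding scaleR_diff_right[of _ "_ - _"]
      by (rule Henstock_Kurzweil_Integration.integral_diff[OF HK[OF s rest]])
        (intro HK s absolutely_integrable_continuous_real continuous_on_const)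
    ultimately show ?thesis
      by simp
  qed
  define g where "g x = indicator {a<..<b} x *\<^sub>R rep_L2 u x - indicator {a<..<b} x *\<^sub>R (Z x + c)" for x
  have g_sq: "square_integrable g"
    unfolding g_def[abs_def]
  proof (rule square_integrable_diff)
    show "square_integrable (\<lambda>x. indicator {a<..<b} x *\<^sub>R rep_L2 u x)"
    proof (rule square_integrable_bound[OF _ square_integrable_rep[of u]])
      show "(\<lambda>x. indicator {a<..<b} x *\<^sub>R rep_L2 u x) \<in> borel_measurable lebesgue"
        by (intro borel_measurable_scaleR borel_measurable_indicator rep_L2_measurable) auto
    qed (auto simp: indicator_def)
    have cont: "continuous_on {a..b} (\<lambda>x. Z x + c)"
      by (intro continuous_intros cZ)
    have "bounded ((\<lambda>x. Z x + c) ` {a..b})"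
      by (intro compact_imp_bounded compact_continuous_image cont) simp
    then obtain B where B: "\<forall>x\<in>{a..b}. norm (Z x + c) \<le> B"
      by (auto simp: bounded_iff)
    show "square_integrable (\<lambda>x. indicator {a<..<b} x *\<^sub>R (Z x + c))"
    proof (rule square_integrable_bounded_support[of _ "max B 0" a b])
      have "(\<lambda>x. indicator {a<..<b} x *\<^sub>R (Z x + c)) \<in> borel_measurable borel"
        by (rule borel_measurable_continuous_on_indicator[OF _ continuous_on_subset[OF cont]]) auto
      then show "(\<lambda>x. indicator {a<..<b} x *\<^sub>R (Z x + c)) \<in> borel_measurable lebesgue"
        by (simp add: measurable_completion)
      show "norm (indicator {a<..<b} x *\<^sub>R (Z x + c)) \<le> max B 0" for x
        using B by (cases "x \<in> {a<..<b}") (auto simp: le_max_iff_disj)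
    qed auto
  qed
  have rep: "AE x in lebesgue. rep_L2 (abs_L2 g) x = g x"
    by (rule rep_abs_L2[OF g_sq])
  have "abs_L2 g = 0"
  proof (rule orthogonal_to_test_functions[OF ab])
    show "abs_L2 g \<in> L2_on a b"
      using rep by (auto simp: L2_on_def g_def elim!: eventually_mono)
    fix \<psi> :: "real \<Rightarrow> real" assume \<psi>: "\<psi> \<in> test_functions a b"
    obtain N where N: "negligible N" "\<And>x. x \<notin> N \<Longrightarrow> rep_L2 (abs_L2 g) x = g x"
      using rep unfolding eventually_ae_filter negligible_iff_null_sets by auto
    have "integral {a..b} (\<lambda>x. \<psi> x *\<^sub>R rep_L2 (abs_L2 g) x)
        = integral {a..b} (\<lambda>x. \<psi> x *\<^sub>R (rep_L2 u x - Z x - c))"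
      by (rule integral_spike[of "N \<union> {a, b}"]) (use N in \<open>auto simp: g_def\<close>)
    then show "integral {a..b} (\<lambda>x. \<psi> x *\<^sub>R rep_L2 (abs_L2 g) x) = 0"
      using orth[OF \<psi>] by simp
  qed
  then have "AE x in lebesgue. g x = 0"
    using abs_L2_eq_iff[OF g_sq square_integrable_0] by (simp add: abs_L2_0)
  then have "AE x in lebesgue. x \<in> {a<..<b} \<longrightarrow> Z x + c = rep_L2 u x"
    by eventually_elim (auto simp: g_def)
  moreover have "primitive_on a b (\<lambda>x. Z x + c) (rep_L2 v)"
    unfolding primitive_on_def using rep_L2_absolutely_integrable by (simp add: Z_def)
  ultimately show ?thesis
    using that by blast
qed

lemma continuous_AE_eq_imp_eq:
  fixes f g :: "real \<Rightarrow> 'b::real_normed_vector"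
  assumes ab: "a < b" and "continuous_on {a..b} f" "continuous_on {a..b} g"
    and ae: "AE x in lebesgue. x \<in> {a<..<b} \<longrightarrow> f x = g x" and x: "x \<in> {a..b}"
  shows "f x = g x"
proof -
  define E where "E = {x \<in> {a..b}. f x - g x = 0}"
  have closed: "closed E"
    unfolding E_def by (intro continuous_closed_preimage_constant continuous_intros assms closed_atLeastAtMost)
  have "AE x\<in>{a<..<b} in lebesgue. x \<in> E"
    using ae by eventually_elim (auto simp: E_def)
  then have "{a<..<b} \<subseteq> E"
    using mem_closed_if_AE_lebesgue_open[OF open_greaterThanLessThan closed] by blast
  then have "closure {a<..<b} \<subseteq> E"
    using closed by (rule closure_minimal)
  then have "x \<in> E"
    using x ab by (auto simp: closure_greaterThanLessThan)
  then show ?thesis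
    by (simp add: E_def)
qed

lemma point_eval_eq:
  assumes ab: "a < b" and W: "continuous_on {a..b} W"
    and ae: "AE x in lebesgue. x \<in> {a<..<b} \<longrightarrow> W x = rep_L2 u x" and x: "x \<in> {a..b}"
  shows "point_eval a b u x = W x"
  unfolding point_eval_def
proof (rule the_equality)
  show "\<exists>w. continuous_on {a..b} w \<and> (AE x in lebesgue. x \<in> {a<..<b} \<longrightarrow> w x = rep_L2 u x) \<and> w x = W x"
    using W ae by blast
  fix y assume "\<exists>w. continuous_on {a..b} w \<and> (AE x in lebesgue. x \<in> {a<..<b} \<longrightarrow> w x = rep_L2 u x) \<and> w x = y"
  then obtain w where w: "continuous_on {a..b} w"
    "AE x in lebesgue. x \<in> {a<..<b} \<longrightarrow> w x = rep_L2 u x" "w x = y"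
    by blast
  have "AE x in lebesgue. x \<in> {a<..<b} \<longrightarrow> w x = W x"
    using w(2) ae by eventually_elim simp
  then have "w x = W x"
    by (rule continuous_AE_eq_imp_eq[OF ab w(1) W _ x])
  with w(3) show "y = W x"
    by simp
qed

section \<open>Skew-symmetric linear systems\<close>

text \<open>For solutions of \<open>P V' = S V\<close> and \<open>P W' = S W - F\<close>, the terms with \<open>S\<close> in the derivative of \<open>V \<bullet> P W\<close> cancel
  because \<open>S\<close> is skew, and only \<open>- (V \<bullet> F)\<close> remains.\<close>

lemma Lagrange_identity:
  fixes P :: "'e::euclidean_space \<Rightarrow> 'e" and S :: "real \<Rightarrow> 'e \<Rightarrow> 'e"
  assumes P: "linear P" "\<And>y z. P y \<bullet> z = y \<bullet> P z"
    and S: "\<And>x y z. x \<in> {a<..<b} \<Longrightarrow> S x y \<bullet> z = - (y \<bullet> S x z)"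
    and V: "primitive_on a b V v" "AE x in lebesgue. x \<in> {a<..<b} \<longrightarrow> P (v x) = S x (V x)"
    and W: "primitive_on a b W w" "AE x in lebesgue. x \<in> {a<..<b} \<longrightarrow> P (w x) = S x (W x) - F x"
    and xy: "a \<le> x" "x \<le> y" "y \<le> b"
  shows "V y \<bullet> P (W y) - V x \<bullet> P (W x) = - integral {x..y} (\<lambda>s. V s \<bullet> F s)"
proof -
  have bl: "bounded_linear P"
    using P(1) by (simp add: linear_conv_bounded_linear)
  have bil: "bounded_bilinear (\<lambda>y z. y \<bullet> P z)"
    by (rule bounded_bilinear.comp[OF bounded_bilinear_inner bounded_linear_ident bl])
  have ab: "a \<le> b"
    using xy by simp
  have "AE s in lebesgue. s \<in> {a<..<b} \<longrightarrow> V s \<bullet> P (w s) + v s \<bullet> P (W s) = - (V s \<bullet> F s)"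
    using V(2) W(2)
  proof eventually_elim
    case (elim s)
    show ?case
    proof
      assume s: "s \<in> {a<..<b}"
      have "v s \<bullet> P (W s) = S s (V s) \<bullet> W s"
        using elim(1) s P(2)[of "v s" "W s"] by simp
      also have "\<dots> = - (V s \<bullet> S s (W s))"
        by (rule S[OF s])
      finally show "V s \<bullet> P (w s) + v s \<bullet> P (W s) = - (V s \<bullet> F s)"
        using elim(2) s by (simp add: inner_diff_right)
    qed
  qed
  then obtain N where N: "negligible N"
    "\<And>s. s \<notin> N \<Longrightarrow> s \<in> {a<..<b} \<Longrightarrow> V s \<bullet> P (w s) + v s \<bullet> P (W s) = - (V s \<bullet> F s)"
    unfolding eventually_ae_filter negligible_iff_null_sets by auto
  have "V y \<bullet> P (W y) - V x \<bullet> P (W x) = integral {x..y} (\<lambda>s. V s \<bullet> P (w s) + v s \<bullet> P (W s))"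
    by (rule primitive_on_diff[OF primitive_on_bilinear[OF bil ab V(1) W(1)] xy])
  also have "\<dots> = integral {x..y} (\<lambda>s. - (V s \<bullet> F s))"
    by (rule integral_spike[of "N \<union> {a, b}"]) (use N xy in auto)
  finally show ?thesis
    by simp
qed

text \<open>This is \<open>\<Phi>\<^sup>* P \<Phi> = P\<close>, the case \<open>F = 0\<close> of the preceding identity.\<close>

lemma skew_system_conservation:
  fixes P :: "'e::euclidean_space \<Rightarrow> 'e" and S :: "real \<Rightarrow> 'e \<Rightarrow> 'e" and \<Psi> :: "real \<Rightarrow> 'e \<Rightarrow> 'e"
  assumes P: "linear P" "\<And>y z. P y \<bullet> z = y \<bullet> P z"
    and S: "\<And>x y z. x \<in> {a<..<b} \<Longrightarrow> S x y \<bullet> z = - (y \<bullet> S x z)"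
    and \<Psi>: "\<And>\<xi>. primitive_on a b (\<lambda>x. \<Psi> x \<xi>) (\<psi> \<xi>)"
      "\<And>\<xi>. AE x in lebesgue. x \<in> {a<..<b} \<longrightarrow> P (\<psi> \<xi> x) = S x (\<Psi> x \<xi>)" "\<And>\<xi>. \<Psi> a \<xi> = \<xi>"
    and x: "x \<in> {a..b}"
  shows "\<Psi> x \<xi> \<bullet> P (\<Psi> x \<zeta>) = \<xi> \<bullet> P \<zeta>"
proof -
  have "AE x in lebesgue. x \<in> {a<..<b} \<longrightarrow> P (\<psi> \<zeta> x) = S x (\<Psi> x \<zeta>) - 0"
    using \<Psi>(2)[of \<zeta>] by simp
  from Lagrange_identity[OF P S \<Psi>(1,2) \<Psi>(1) this, of a x \<xi>] x show ?thesis
    by (simp add: \<Psi>(3))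
qed

text \<open>Conservation turns the bound \<open>K\<close> for the fundamental solution \<open>\<Psi> x\<close> into one for its inverse. Lagrange's
  identity between \<open>x\<close> and \<open>\<eta>\<close> bounds \<open>\<Psi> x \<xi> \<bullet> P (W x)\<close> for every \<open>\<xi>\<close>, and the \<open>\<xi>\<close> with
  \<open>\<Psi> x \<xi> = P (W x)\<close> gives the claim. The constant depends only on \<open>P\<close> and \<open>K\<close>, not on \<open>S\<close>; this is what
  makes it uniform in the frequency.\<close>

theorem skew_system_estimate:
  fixes P :: "'e::euclidean_space \<Rightarrow> 'e" and S :: "real \<Rightarrow> 'e \<Rightarrow> 'e" and \<Psi> :: "real \<Rightarrow> 'e \<Rightarrow> 'e"
  assumes P: "linear P" "\<And>y z. P y \<bullet> z = y \<bullet> P z"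
    and p: "p \<ge> 0" "\<And>y. norm (P y) \<le> p * norm y" and q: "q \<ge> 0" "\<And>y. norm y \<le> q * norm (P y)"
    and S: "\<And>x y z. x \<in> {a<..<b} \<Longrightarrow> S x y \<bullet> z = - (y \<bullet> S x z)"
    and \<Psi>: "\<And>\<xi>. primitive_on a b (\<lambda>x. \<Psi> x \<xi>) (\<psi> \<xi>)"
      "\<And>\<xi>. AE x in lebesgue. x \<in> {a<..<b} \<longrightarrow> P (\<psi> \<xi> x) = S x (\<Psi> x \<xi>)" "\<And>\<xi>. \<Psi> a \<xi> = \<xi>"
      "\<And>x. linear (\<Psi> x)"
    and K: "K \<ge> 0" "\<And>x \<xi>. x \<in> {a..b} \<Longrightarrow> norm (\<Psi> x \<xi>) \<le> K * norm \<xi>"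
    and W: "primitive_on a b W w" "AE x in lebesgue. x \<in> {a<..<b} \<longrightarrow> P (w x) = S x (W x) - F x"
    and F: "F absolutely_integrable_on {a..b}"
    and \<eta>: "\<eta> \<in> {a, b}" and x: "x \<in> {a..b}"
  shows "norm (W x) \<le> q * (K * (q * (K * p))) * (p + 1) * (norm (W \<eta>) + integral {a..b} (\<lambda>s. norm (F s)))"
proof -
  define I where "I = integral {a..b} (\<lambda>s. norm (F s))"
  have Fn: "(\<lambda>s. norm (F s)) absolutely_integrable_on {a..b}"
    using absolutely_integrable_norm[OF F] by (simp add: o_def)
  have Fi: "(\<lambda>s. norm (F s)) integrable_on {a..b}"
    by (rule set_lebesgue_integral_eq_integral(1)[OF Fn])
  have I0: "I \<ge> 0"
    unfolding I_def by (rule integral_nonneg[OF Fi]) simp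
  have flux: "\<bar>\<Psi> x \<xi> \<bullet> P (W x)\<bar> \<le> K * norm \<xi> * (p * norm (W \<eta>) + I)" for \<xi>
  proof -
    have VF: "(\<lambda>s. \<Psi> s \<xi> \<bullet> F s) absolutely_integrable_on {a..b}"
    proof (rule absolutely_integrable_bounded_measurable_product[where h = "(\<bullet>)" and f = "\<lambda>s. \<Psi> s \<xi>",
          OF _ _ _ _ F])
      have cont: "continuous_on {a..b} (\<lambda>s. \<Psi> s \<xi>)"
        by (rule primitive_on_continuous[OF \<Psi>(1)])
      show "(\<lambda>s. \<Psi> s \<xi>) \<in> borel_measurable (lebesgue_on {a..b})"
        by (rule continuous_imp_measurable_on_sets_lebesgue[OF cont]) simp
      show "bounded ((\<lambda>s. \<Psi> s \<xi>) ` {a..b})"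
        by (intro compact_imp_bounded compact_continuous_image cont) simp
      show "bilinear ((\<bullet>) :: 'e \<Rightarrow> 'e \<Rightarrow> real)"
        by (simp add: bilinear_conv_bounded_bilinear bounded_bilinear_inner)
    qed simp
    have part: "\<bar>integral {u..v} (\<lambda>s. \<Psi> s \<xi> \<bullet> F s)\<bar> \<le> K * norm \<xi> * I"
      if uv: "a \<le> u" "u \<le> v" "v \<le> b" for u v
    proof -
      have sub: "h integrable_on {u..v}" if "h absolutely_integrable_on {a..b}" for h :: "real \<Rightarrow> real"
        by (rule set_lebesgue_integral_eq_integral(1)[OF absolutely_integrable_subinterval[OF that uv(1,3)]])
      have "norm (integral {u..v} (\<lambda>s. \<Psi> s \<xi> \<bullet> F s)) \<le> integral {u..v} (\<lambda>s. K * norm \<xi> * norm (F s))"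
      proof (rule integral_norm_bound_integral[OF sub[OF VF] integrable_on_mult_right[OF sub[OF Fn]]])
        fix s assume "s \<in> {u..v}"
        then have "norm (\<Psi> s \<xi>) \<le> K * norm \<xi>"
          using uv by (intro K) auto
        then have "norm (\<Psi> s \<xi>) * norm (F s) \<le> K * norm \<xi> * norm (F s)"
          by (intro mult_right_mono) auto
        then show "norm (\<Psi> s \<xi> \<bullet> F s) \<le> K * norm \<xi> * norm (F s)"
          using Cauchy_Schwarz_ineq2[of "\<Psi> s \<xi>" "F s"] by simp
      qed
      also have "\<dots> = K * norm \<xi> * integral {u..v} (\<lambda>s. norm (F s))"
        by simp
      also have "\<dots> \<le> K * norm \<xi> * I"
        unfolding I_def using uv K(1)
        by (intro mult_left_mono integral_subset_le sub Fn Fi) auto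
      finally show ?thesis
        by simp
    qed
    have "\<eta> \<in> {a..b}"
      using \<eta> x by auto
    have diff: "\<bar>\<Psi> x \<xi> \<bullet> P (W x) - \<Psi> \<eta> \<xi> \<bullet> P (W \<eta>)\<bar> \<le> K * norm \<xi> * I"
    proof (cases "\<eta> = a")
      case True
      show ?thesis
        using Lagrange_identity[OF P S \<Psi>(1,2) W, of a x \<xi>] part[of a x] x True by simp
    next
      case False
      with \<eta> have "\<eta> = b"
        by simp
      then show ?thesis
        using Lagrange_identity[OF P S \<Psi>(1,2) W, of x b \<xi>] part[of x b] x by simp
    qed
    have "\<bar>\<Psi> \<eta> \<xi> \<bullet> P (W \<eta>)\<bar> \<le> norm (\<Psi> \<eta> \<xi>) * norm (P (W \<eta>))"
      by (rule Cauchy_Schwarz_ineq2)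
    also have "\<dots> \<le> (K * norm \<xi>) * (p * norm (W \<eta>))"
      by (intro mult_mono K p \<open>\<eta> \<in> {a..b}\<close> mult_nonneg_nonneg) auto
    finally show ?thesis
      using diff by (simp add: distrib_left)
  qed
  note cons = skew_system_conservation[OF P S \<Psi>(1,2,3) x]
  have lower: "norm \<xi> \<le> q * (K * p * norm (\<Psi> x \<xi>))" for \<xi>
  proof -
    have "norm (P \<xi>) * norm (P \<xi>) = \<Psi> x (P \<xi>) \<bullet> P (\<Psi> x \<xi>)"
      using cons[of "P \<xi>" \<xi>] by (simp add: dot_square_norm power2_eq_square)
    also have "\<dots> \<le> norm (\<Psi> x (P \<xi>)) * norm (P (\<Psi> x \<xi>))"
      by (rule norm_cauchy_schwarz)
    also have "\<dots> \<le> (K * norm (P \<xi>)) * (p * norm (\<Psi> x \<xi>))"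
      by (intro mult_mono K x p mult_nonneg_nonneg) auto
    finally have "norm (P \<xi>) * norm (P \<xi>) \<le> (K * p * norm (\<Psi> x \<xi>)) * norm (P \<xi>)"
      by (simp add: algebra_simps)
    then have "norm (P \<xi>) \<le> K * p * norm (\<Psi> x \<xi>)"
      using K p by (cases "norm (P \<xi>) = 0") (auto dest: mult_right_le_imp_le)
    then have "q * norm (P \<xi>) \<le> q * (K * p * norm (\<Psi> x \<xi>))"
      by (rule mult_left_mono) (rule q)
    with q(2)[of \<xi>] show ?thesis
      by linarith
  qed
  have "inj (\<Psi> x)"
    unfolding linear_injective_0[OF \<Psi>(4)]
  proof (intro allI impI)
    fix \<xi> assume "\<Psi> x \<xi> = 0"
    then show "\<xi> = 0"
      using lower[of \<xi>] by simp
  qed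
  then have "surj (\<Psi> x)"
    using linear_injective_imp_surjective[OF \<Psi>(4)[of x]] by simp
  then obtain \<xi> where \<xi>: "\<Psi> x \<xi> = P (W x)"
    by (metis surjD)
  define B where "B = K * (q * (K * p)) * (p * norm (W \<eta>) + I)"
  have B0: "B \<ge> 0"
    unfolding B_def using K p q I0 by (intro mult_nonneg_nonneg add_nonneg_nonneg) auto
  have "norm (P (W x)) * norm (P (W x)) = \<bar>\<Psi> x \<xi> \<bullet> P (W x)\<bar>"
    by (simp add: \<xi> dot_square_norm power2_eq_square)
  also have "\<dots> \<le> K * norm \<xi> * (p * norm (W \<eta>) + I)"
    by (rule flux)
  also have "\<dots> \<le> K * (q * (K * p * norm (P (W x)))) * (p * norm (W \<eta>) + I)"
    using lower[of \<xi>] K(1) p(1) I0 unfolding \<xi>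
    by (intro mult_right_mono mult_left_mono add_nonneg_nonneg mult_nonneg_nonneg) auto
  finally have "norm (P (W x)) * norm (P (W x)) \<le> B * norm (P (W x))"
    by (simp add: B_def mult_ac)
  then have "norm (P (W x)) \<le> B"
    using B0 by (cases "norm (P (W x)) = 0") (auto dest: mult_right_le_imp_le)
  then have "q * norm (P (W x)) \<le> q * B"
    by (rule mult_left_mono) (rule q)
  then have "norm (W x) \<le> q * B"
    using q(2)[of "W x"] by linarith
  also have "\<dots> \<le> q * (K * (q * (K * p)) * ((p + 1) * (norm (W \<eta>) + I)))"
    unfolding B_def
  proof (intro mult_left_mono mult_nonneg_nonneg q K p)
    have "0 \<le> p * I"
      using p I0 by simp
    then show "p * norm (W \<eta>) + I \<le> (p + 1) * (norm (W \<eta>) + I)"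
      by (simp add: algebra_simps)
  qed
  finally show ?thesis
    by (simp add: I_def mult.assoc)
qed

section \<open>Matrix-valued multiplication operators and the energy inner product\<close>

lemma matrix_inv_cancel:
  fixes A :: "'a::semiring_1^'n^'n"
  assumes "invertible A"
  shows "A ** matrix_inv A = mat 1" "matrix_inv A ** A = mat 1"
  using someI_ex[OF assms[unfolded invertible_def]] unfolding matrix_inv_def by auto

lemma inner_matrix_transpose:
  fixes A :: "real^'n^'n"
  shows "(A *v x) \<bullet> y = x \<bullet> (transpose A *v y)"
  by (metis dot_lmul_matrix inner_commute transpose_matrix_vector)

lemma bounded_bilinear_matrix_vector:
  "bounded_bilinear ((*v) :: real^'n^'m \<Rightarrow> real^'n \<Rightarrow> real^'m)"
  unfolding bilinear_conv_bounded_bilinear[symmetric] bilinear_def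
proof (intro conjI allI)
  show "linear ((*v) A)" for A :: "real^'n^'m"
    by (rule matrix_vector_mul_linear)
  show "linear (\<lambda>A :: real^'n^'m. A *v x)" for x
    by (rule linearI) (simp_all add: matrix_vector_mult_add_rdistrib scaleR_matrix_vector_assoc)
qed

lemma borel_measurable_matrix_vector:
  fixes A :: "real \<Rightarrow> real^'n^'m"
  assumes "A \<in> borel_measurable N" "f \<in> borel_measurable N"
  shows "(\<lambda>x. A x *v f x) \<in> borel_measurable N"
  by (rule borel_measurable_continuous_Pair[OF assms])
    (intro bounded_bilinear.continuous_on[OF bounded_bilinear_matrix_vector] continuous_intros)

lemma mult_on_square_integrable:
  fixes A :: "real \<Rightarrow> real^'n^'n"
  assumes meas: "A \<in> borel_measurable (lebesgue_on {a<..<b})"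
    and bound: "\<And>x v. x \<in> {a<..<b} \<Longrightarrow> norm (A x *v v) \<le> B * norm v"
  shows "square_integrable (\<lambda>x. indicator {a<..<b} x *\<^sub>R (A x *v rep_L2 u x))"
proof (rule square_integrable_bound)
  show "square_integrable (\<lambda>x. B *\<^sub>R rep_L2 u x)"
    by (intro square_integrable_scaleR square_integrable_rep)
  have "rep_L2 u \<in> borel_measurable (lebesgue_on {a<..<b})"
    by (rule measurable_restrict_space1[OF rep_L2_measurable])
  from borel_measurable_matrix_vector[OF meas this]
  show "(\<lambda>x. indicator {a<..<b} x *\<^sub>R (A x *v rep_L2 u x)) \<in> borel_measurable lebesgue"
    by (subst (asm) borel_measurable_restrict_space_iff) auto
  have "norm (indicator {a<..<b} x *\<^sub>R (A x *v rep_L2 u x)) \<le> norm (B *\<^sub>R rep_L2 u x)" for x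
  proof (cases "x \<in> {a<..<b}")
    case True
    have "norm (A x *v rep_L2 u x) \<le> \<bar>B\<bar> * norm (rep_L2 u x)"
      using bound[OF True, of "rep_L2 u x"] mult_right_mono[OF abs_ge_self[of B] norm_ge_zero[of "rep_L2 u x"]]
      by linarith
    then show ?thesis
      using True by simp
  qed simp
  then show "AE x in lebesgue. norm (indicator {a<..<b} x *\<^sub>R (A x *v rep_L2 u x)) \<le> norm (B *\<^sub>R rep_L2 u x)"
    by simp
qed

lemma mult_on_rep:
  fixes A :: "real \<Rightarrow> real^'n^'n"
  assumes meas: "A \<in> borel_measurable (lebesgue_on {a<..<b})"
    and bound: "\<And>x v. x \<in> {a<..<b} \<Longrightarrow> norm (A x *v v) \<le> B * norm v"
  shows "AE x in lebesgue. rep_L2 (mult_on a b A u) x = indicator {a<..<b} x *\<^sub>R (A x *v rep_L2 u x)"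
  unfolding mult_on_def by (rule rep_abs_L2[OF mult_on_square_integrable[OF meas bound]])

lemma mult_on_const_rep:
  fixes P :: "real^'n^'n"
  shows "AE x in lebesgue. rep_L2 (mult_on a b (\<lambda>_. P) u) x = indicator {a<..<b} x *\<^sub>R (P *v rep_L2 u x)"
proof -
  obtain B where "\<And>v. norm (P *v v) \<le> norm v * B"
    using bounded_linear.bounded[OF matrix_vector_mul_bounded_linear[of P]] by blast
  then show ?thesis
    by (intro mult_on_rep[of _ _ _ B]) (auto simp: mult.commute)
qed

lemma linear_mult_on:
  fixes A :: "real \<Rightarrow> real^'n^'n"
  assumes meas: "A \<in> borel_measurable (lebesgue_on {a<..<b})"
    and bound: "\<And>x v. x \<in> {a<..<b} \<Longrightarrow> norm (A x *v v) \<le> B * norm v"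
  shows "mult_on a b A (u + v) = mult_on a b A u + mult_on a b A v"
    and "mult_on a b A (r *\<^sub>R u) = r *\<^sub>R mult_on a b A u"
proof -
  have rep: "AE x in lebesgue. rep_L2 (mult_on a b A u) x = indicator {a<..<b} x *\<^sub>R (A x *v rep_L2 u x)" for u
    by (rule mult_on_rep[OF meas bound])
  show "mult_on a b A (u + v) = mult_on a b A u + mult_on a b A v"
  proof (rule L2_eqI)
    show "AE x in lebesgue. rep_L2 (mult_on a b A (u + v)) x = rep_L2 (mult_on a b A u + mult_on a b A v) x"
      using rep[of u] rep[of v] rep[of "u + v"] rep_L2_add[of u v]
        rep_L2_add[of "mult_on a b A u" "mult_on a b A v"]
      by eventually_elim (simp add: matrix_vector_right_distrib scaleR_add_right)
  qed
  show "mult_on a b A (r *\<^sub>R u) = r *\<^sub>R mult_on a b A u"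
  proof (rule L2_eqI)
    show "AE x in lebesgue. rep_L2 (mult_on a b A (r *\<^sub>R u)) x = rep_L2 (r *\<^sub>R mult_on a b A u) x"
      using rep[of u] rep[of "r *\<^sub>R u"] rep_L2_scaleR[of r u] rep_L2_scaleR[of r "mult_on a b A u"]
      by eventually_elim (simp add: matrix_vector_mult_scaleR)
  qed
qed

lemma subspace_L2_on: "subspace (L2_on a b :: 'b::euclidean_space L2 set)"
proof (rule subspaceI)
  have "AE x in lebesgue. rep_L2 (0 :: 'b L2) x = 0"
    using rep_abs_L2[OF square_integrable_0] by (simp add: abs_L2_0)
  then show "(0 :: 'b L2) \<in> L2_on a b"
    unfolding L2_on_def mem_Collect_eq by eventually_elim simp
next
  fix u v :: "'b L2" assume "u \<in> L2_on a b" "v \<in> L2_on a b"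
  then show "u + v \<in> L2_on a b"
    using rep_L2_add[of u v] unfolding L2_on_def mem_Collect_eq by eventually_elim simp
next
  fix u :: "'b L2" and r assume "u \<in> L2_on a b"
  then show "r *\<^sub>R u \<in> L2_on a b"
    using rep_L2_scaleR[of r u] unfolding L2_on_def mem_Collect_eq by eventually_elim simp
qed

locale energy_density =
  fixes a b m M :: real and \<H> :: "real \<Rightarrow> real^'n^'n"
  assumes ab: "a < b" and meas: "\<H> \<in> borel_measurable (lebesgue_on {a<..<b})" and m: "m > 0"
    and sym: "\<And>x. x \<in> {a<..<b} \<Longrightarrow> transpose (\<H> x) = \<H> x"
    and lower: "\<And>x v. x \<in> {a<..<b} \<Longrightarrow> m * (norm v)\<^sup>2 \<le> (\<H> x *v v) \<bullet> v"
    and upper: "\<And>x v. x \<in> {a<..<b} \<Longrightarrow> (\<H> x *v v) \<bullet> v \<le> M * (norm v)\<^sup>2"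
begin

lemma sym_inner: "x \<in> {a<..<b} \<Longrightarrow> (\<H> x *v v) \<bullet> w = v \<bullet> (\<H> x *v w)"
  using inner_matrix_transpose[of "\<H> x" v w] sym by simp

lemma norm_le: "norm (\<H> x *v v) \<le> M * norm v" if x: "x \<in> {a<..<b}"
proof -
  interpret ip: semi_inner "\<lambda>v w. (\<H> x *v v) \<bullet> w"
  proof
    show "(\<H> x *v v) \<bullet> w = (\<H> x *v w) \<bullet> v" for v w
      using sym_inner[OF x, of v w] by (simp add: inner_commute)
    show "0 \<le> (\<H> x *v v) \<bullet> v" for v
      using lower[OF x, of v] m by (smt (verit) mult_nonneg_nonneg zero_le_power2)
  qed (simp_all add: matrix_vector_right_distrib matrix_vector_mult_scaleR inner_add_left)
  have "(norm (\<H> x *v v))\<^sup>2 = (\<H> x *v v) \<bullet> (\<H> x *v v)"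
    by (simp add: power2_norm_eq_inner)
  also have "\<dots> \<le> ip.seminorm v * ip.seminorm (\<H> x *v v)"
    by (rule ip.Cauchy_Schwarz)
  also have "\<dots> \<le> sqrt (M * (norm v)\<^sup>2) * sqrt (M * (norm (\<H> x *v v))\<^sup>2)"
    unfolding ip.seminorm_def by (intro mult_mono real_sqrt_le_mono upper x)
      (auto simp: ip.nonneg intro: order_trans[OF ip.nonneg upper[OF x]])
  also have "\<dots> = \<bar>M\<bar> * norm v * norm (\<H> x *v v)"
    by (simp add: real_sqrt_mult)
  finally have *: "norm (\<H> x *v v) * norm (\<H> x *v v) \<le> (\<bar>M\<bar> * norm v) * norm (\<H> x *v v)"
    by (simp add: power2_eq_square)
  have **: "norm (\<H> x *v v) \<le> \<bar>M\<bar> * norm v"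
  proof (cases "norm (\<H> x *v v) = 0")
    case True
    then show ?thesis
      by simp
  next
    case False
    then have "norm (\<H> x *v v) > 0"
      by simp
    with * show ?thesis
      by (rule mult_right_le_imp_le)
  qed
  show ?thesis
  proof (cases "v = 0")
    case True
    then show ?thesis
      by simp
  next
    case False
    have "0 < m * (norm v)\<^sup>2"
      using False m by simp
    also have "\<dots> \<le> M * (norm v)\<^sup>2"
      using lower[OF x, of v] upper[OF x, of v] by linarith
    finally have "M > 0"
      using False by (simp add: zero_less_mult_iff)
    with ** show ?thesis
      by simp
  qed
qed

abbreviation G :: "real \<Rightarrow> real^'n^'n" where
  "G x \<equiv> matrix_inv (\<H> x)"

lemma invertible: "invertible (\<H> x)" if x: "x \<in> {a<..<b}"
proof -
  have "v = 0" if "\<H> x *v v = 0" for v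
  proof -
    have "m * (norm v)\<^sup>2 \<le> 0"
      using lower[OF x, of v] that by simp
    with m show ?thesis
      by (simp add: mult_le_0_iff)
  qed
  then obtain B where "B ** \<H> x = mat 1"
    using matrix_left_invertible_ker[of "\<H> x"] by blast
  then show ?thesis
    unfolding invertible_def using matrix_left_right_inverse[of B "\<H> x"] by blast
qed

lemma inverse_cancel:
  assumes "x \<in> {a<..<b}"
  shows "\<H> x *v (G x *v v) = v" "G x *v (\<H> x *v v) = v"
  using matrix_inv_cancel[OF invertible[OF assms]] by (simp_all add: matrix_vector_mul_assoc)

lemma inverse_sym:
  assumes x: "x \<in> {a<..<b}"
  shows "(G x *v v) \<bullet> w = v \<bullet> (G x *v w)"
  using sym_inner[OF x, of "G x *v v" "G x *v w"] by (simp add: inverse_cancel[OF x])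

lemma inverse_norm_le:
  assumes x: "x \<in> {a<..<b}"
  shows "norm (G x *v v) \<le> (1/m) * norm v"
proof -
  define w where "w = G x *v v"
  have "m * (norm w)\<^sup>2 \<le> v \<bullet> w"
    using lower[OF x, of w] by (simp add: w_def inverse_cancel[OF x])
  also have "\<dots> \<le> norm v * norm w"
    by (rule norm_cauchy_schwarz)
  finally have "(m * norm w) * norm w \<le> norm v * norm w"
    by (simp add: power2_eq_square)
  then have "m * norm w \<le> norm v"
    using m by (cases "norm w = 0") (auto dest: mult_right_le_imp_le)
  then show ?thesis
    using m by (simp add: w_def field_simps)
qed

text \<open>The iteration \<open>s \<mapsto> s + \<tau> (f - \<H> s)\<close> consists of measurable functions and converges pointwise to
  \<open>\<H>\<inverse> f\<close>.\<close>

lemma inverse_measurable: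
  assumes f: "f \<in> borel_measurable (lebesgue_on {a<..<b})"
  shows "(\<lambda>x. G x *v f x) \<in> borel_measurable (lebesgue_on {a<..<b})"
proof -
\<comment> \<open>Any step with \<open>\<tau> M\<^sup>2 \<le> m\<close> gives \<open>\<bar>e - \<tau> \<H> e\<bar>\<^sup>2 \<le> (1 - \<tau> m) \<bar>e\<bar>\<^sup>2\<close>; the summand \<open>m\<^sup>2\<close> ensures \<open>\<tau> m \<le> 1\<close>.\<close>
  define \<tau> where "\<tau> = m / (M\<^sup>2 + m\<^sup>2)"
  define \<rho> where "\<rho> = 1 - \<tau> * m"
  have den: "M\<^sup>2 + m\<^sup>2 > 0"
    using m by (simp add: add_nonneg_pos)
  then have \<tau>: "\<tau> > 0" and \<tau>M: "\<tau> * M\<^sup>2 \<le> m" and \<tau>m: "\<tau> * m \<le> 1"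
    using m by (simp_all add: \<tau>_def field_simps power2_eq_square)
  have \<rho>: "0 \<le> \<rho>" "\<rho> < 1"
    using \<tau> \<tau>m m by (simp_all add: \<rho>_def)
  define s where "s = rec_nat (\<lambda>_. 0) (\<lambda>_ g x. g x + \<tau> *\<^sub>R (f x - \<H> x *v g x))"
  have s_simps: "s 0 = (\<lambda>_. 0)" "s (Suc k) = (\<lambda>x. s k x + \<tau> *\<^sub>R (f x - \<H> x *v s k x))" for k
    by (simp_all add: s_def)
  have s_meas: "s k \<in> borel_measurable (lebesgue_on {a<..<b})" for k
  proof (induction k)
    case (Suc k)
    have "(\<lambda>x. f x - \<H> x *v s k x) \<in> borel_measurable (lebesgue_on {a<..<b})"
      by (rule borel_measurable_diff[OF f borel_measurable_matrix_vector[OF meas Suc]])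
    then show ?case
      unfolding s_simps by (rule borel_measurable_add[OF Suc borel_measurable_scaleR[OF borel_measurable_const]])
  qed (simp add: s_simps)
  show ?thesis
  proof (rule borel_measurable_LIMSEQ_metric[OF s_meas])
    fix x assume "x \<in> space (lebesgue_on {a<..<b})"
    then have x: "x \<in> {a<..<b}"
      by simp
    define e where "e k = s k x - G x *v f x" for k
    have step: "(norm (e (Suc k)))\<^sup>2 \<le> \<rho> * (norm (e k))\<^sup>2" for k
    proof -
      define y where "y = \<H> x *v e k"
      have "e (Suc k) = e k - \<tau> *\<^sub>R y"
        by (simp add: e_def y_def s_simps matrix_vector_mult_diff_distrib inverse_cancel[OF x] algebra_simps)
      then have "(norm (e (Suc k)))\<^sup>2 = (e k - \<tau> *\<^sub>R y) \<bullet> (e k - \<tau> *\<^sub>R y)"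
        by (simp add: power2_norm_eq_inner)
      also have "\<dots> = (norm (e k))\<^sup>2 - 2 * \<tau> * (y \<bullet> e k) + \<tau>\<^sup>2 * (norm y)\<^sup>2"
        unfolding power2_norm_eq_inner
        by (simp add: inner_diff_left inner_diff_right inner_commute[of "e k" y] power2_eq_square algebra_simps)
      also have "\<dots> \<le> (norm (e k))\<^sup>2 - 2 * \<tau> * (m * (norm (e k))\<^sup>2) + \<tau>\<^sup>2 * (M\<^sup>2 * (norm (e k))\<^sup>2)"
      proof -
        have "2 * \<tau> * (m * (norm (e k))\<^sup>2) \<le> 2 * \<tau> * (y \<bullet> e k)"
          unfolding y_def using \<tau> by (intro mult_left_mono lower x) auto
        moreover have "(norm y)\<^sup>2 \<le> M\<^sup>2 * (norm (e k))\<^sup>2"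
          using power_mono[OF norm_le[OF x, of "e k"], of 2] by (simp add: y_def power_mult_distrib)
        then have "\<tau>\<^sup>2 * (norm y)\<^sup>2 \<le> \<tau>\<^sup>2 * (M\<^sup>2 * (norm (e k))\<^sup>2)"
          by (intro mult_left_mono) auto
        ultimately show ?thesis
          by linarith
      qed
      also have "\<tau>\<^sup>2 * (M\<^sup>2 * (norm (e k))\<^sup>2) \<le> \<tau> * m * (norm (e k))\<^sup>2"
        using mult_right_mono[OF mult_left_mono[OF \<tau>M, of \<tau>], of "(norm (e k))\<^sup>2"] \<tau>
        by (simp add: power2_eq_square mult_ac)
      finally show ?thesis
        by (simp add: \<rho>_def algebra_simps)
    qed
    have "(norm (e k))\<^sup>2 \<le> \<rho> ^ k * (norm (e 0))\<^sup>2" for k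
    proof (induction k)
      case (Suc k)
      have "(norm (e (Suc k)))\<^sup>2 \<le> \<rho> * (norm (e k))\<^sup>2"
        by (rule step)
      also have "\<dots> \<le> \<rho> * (\<rho> ^ k * (norm (e 0))\<^sup>2)"
        by (intro mult_left_mono Suc \<rho>)
      finally show ?case
        by (simp add: mult.assoc)
    qed simp
    moreover have "(\<lambda>k. \<rho> ^ k * (norm (e 0))\<^sup>2) \<longlonglongrightarrow> 0"
      using tendsto_mult_left_zero[OF LIMSEQ_realpow_zero[OF \<rho>]] by simp
    ultimately have "(\<lambda>k. (norm (e k))\<^sup>2) \<longlonglongrightarrow> 0"
      by (intro tendsto_sandwich[of "\<lambda>_. 0" "\<lambda>k. (norm (e k))\<^sup>2" sequentially "\<lambda>k. \<rho> ^ k * (norm (e 0))\<^sup>2"]) auto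
    from tendsto_real_sqrt[OF this] have "(\<lambda>k. norm (e k)) \<longlonglongrightarrow> 0"
      by simp
    then show "(\<lambda>k. s k x) \<longlonglongrightarrow> G x *v f x"
      unfolding e_def tendsto_norm_zero_iff LIM_zero_iff .
  qed
qed

lemma \<H>_square_integrable: "square_integrable (\<lambda>x. indicator {a<..<b} x *\<^sub>R (\<H> x *v rep_L2 u x))"
  by (rule mult_on_square_integrable[OF meas norm_le])

lemma \<H>_rep: "AE x in lebesgue. rep_L2 (mult_on a b \<H> u) x = indicator {a<..<b} x *\<^sub>R (\<H> x *v rep_L2 u x)"
  by (rule mult_on_rep[OF meas norm_le])

lemma \<H>_linear:
  "mult_on a b \<H> (u + v) = mult_on a b \<H> u + mult_on a b \<H> v"
  "mult_on a b \<H> (r *\<^sub>R u) = r *\<^sub>R mult_on a b \<H> u"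
  by (rule linear_mult_on(1)[OF meas norm_le], assumption)
    (rule linear_mult_on(2)[OF meas norm_le])

lemma \<H>_in_L2_on: "mult_on a b \<H> u \<in> L2_on a b"
  using \<H>_rep[of u] by (auto simp: L2_on_def elim!: eventually_mono)

lemma inner_H_integral: "inner_H a b \<H> u v
    = (LINT x|lebesgue. (indicator {a<..<b} x *\<^sub>R (\<H> x *v rep_L2 u x)) \<bullet> rep_L2 v x)"
  unfolding inner_H_def mult_on_def
  using inner_abs_L2[OF \<H>_square_integrable square_integrable_rep[of v], of u]
  by (simp add: abs_rep_L2)

lemma semi_inner_H: "semi_inner (inner_H a b \<H>)"
proof
  show "inner_H a b \<H> (u + v) w = inner_H a b \<H> u w + inner_H a b \<H> v w" for u v w
    by (simp add: inner_H_def \<H>_linear inner_add_left)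
  show "inner_H a b \<H> (r *\<^sub>R u) v = r * inner_H a b \<H> u v" for u v r
    by (simp add: inner_H_def \<H>_linear)
  show "inner_H a b \<H> u v = inner_H a b \<H> v u" for u v
    unfolding inner_H_integral
  proof (intro Bochner_Integration.integral_cong refl)
    fix x
    show "(indicator {a<..<b} x *\<^sub>R (\<H> x *v rep_L2 u x)) \<bullet> rep_L2 v x
        = (indicator {a<..<b} x *\<^sub>R (\<H> x *v rep_L2 v x)) \<bullet> rep_L2 u x"
      using sym_inner[of x "rep_L2 u x" "rep_L2 v x"]
      by (cases "x \<in> {a<..<b}") (simp_all add: inner_commute[of _ "rep_L2 u x"])
  qed
  show "0 \<le> inner_H a b \<H> u u" for u
    unfolding inner_H_integral
  proof (rule Bochner_Integration.integral_nonneg)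
    fix x
    show "0 \<le> (indicator {a<..<b} x *\<^sub>R (\<H> x *v rep_L2 u x)) \<bullet> rep_L2 u x"
    proof (cases "x \<in> {a<..<b}")
      case True
      have "0 \<le> m * (norm (rep_L2 u x))\<^sup>2"
        using m by simp
      with lower[OF True, of "rep_L2 u x"] True show ?thesis
        by simp
    qed simp
  qed
qed

lemma inner_H_lower:
  assumes u: "u \<in> L2_on a b"
  shows "m * (norm u)\<^sup>2 \<le> inner_H a b \<H> u u"
proof -
  have "m * (norm u)\<^sup>2 = (LINT x|lebesgue. m * (norm (rep_L2 u x))\<^sup>2)"
    by (simp add: power2_norm_eq_inner inner_L2)
  also have "\<dots> \<le> inner_H a b \<H> u u"
    unfolding inner_H_integral
  proof (rule integral_mono_AE)
    show "integrable lebesgue (\<lambda>x. m * (norm (rep_L2 u x))\<^sup>2)"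
      using square_integrable_rep[of u] by (simp add: square_integrable_def)
    show "integrable lebesgue (\<lambda>x. (indicator {a<..<b} x *\<^sub>R (\<H> x *v rep_L2 u x)) \<bullet> rep_L2 u x)"
      by (rule square_integrable_inner[OF \<H>_square_integrable square_integrable_rep])
    show "AE x in lebesgue. m * (norm (rep_L2 u x))\<^sup>2
        \<le> (indicator {a<..<b} x *\<^sub>R (\<H> x *v rep_L2 u x)) \<bullet> rep_L2 u x"
      using u unfolding L2_on_def mem_Collect_eq
    proof eventually_elim
      case (elim x)
      then show ?case
        using lower[of x "rep_L2 u x"] by (cases "x \<in> {a<..<b}") auto
    qed
  qed
  finally show ?thesis .
qed

text \<open>From \<open>m \<parallel>u\<parallel>\<^sup>2 \<le> \<langle>\<H> u, u\<rangle> \<le> \<parallel>\<H> u\<parallel> \<parallel>u\<parallel>\<close>. Estimates and approximations are obtained for \<open>\<H> u\<close>; this is how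
  they are passed on to the energy norm of \<open>u\<close>.\<close>

lemma inner_H_upper:
  assumes u: "u \<in> L2_on a b"
  shows "inner_H a b \<H> u u \<le> (norm (mult_on a b \<H> u))\<^sup>2 / m"
proof -
  define v where "v = mult_on a b \<H> u"
  have cs: "inner_H a b \<H> u u \<le> norm v * norm u"
    unfolding inner_H_def v_def by (rule norm_cauchy_schwarz)
  have "(m * norm u) * norm u \<le> norm v * norm u"
    using inner_H_lower[OF u] cs by (simp add: power2_eq_square)
  then have "m * norm u \<le> norm v"
    using m by (cases "norm u = 0") (auto dest: mult_right_le_imp_le)
  then have "norm v * (m * norm u) \<le> norm v * norm v"
    by (rule mult_left_mono) simp
  then have "norm v * norm u \<le> (norm v)\<^sup>2 / m"
    using m by (simp add: field_simps power2_eq_square)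
  with cs show ?thesis
    by (simp add: v_def)
qed

text \<open>Approximate \<open>\<H> u\<close> by a test function \<open>\<phi>\<close> and take \<open>v = \<H>\<inverse> \<phi>\<close>.\<close>

lemma H1_0_preimage_dense:
  assumes u: "u \<in> L2_on a b" and e: "e > 0"
  shows "\<exists>v \<in> L2_on a b. mult_on a b \<H> v \<in> H1_0 a b \<and> norm_H a b \<H> (u - v) < e"
proof -
  have "mult_on a b \<H> u \<in> closure (abs_L2 ` test_functions a b)"
    by (rule test_functions_dense[OF ab \<H>_in_L2_on])
  then have "\<exists>p \<in> abs_L2 ` test_functions a b. dist p (mult_on a b \<H> u) < e * sqrt m"
    unfolding closure_approachable using e m by simp
  then obtain \<phi> where \<phi>: "\<phi> \<in> test_functions a b"
    and close: "dist (abs_L2 \<phi>) (mult_on a b \<H> u) < e * sqrt m"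
    by blast
  note \<phi>_sq = test_function_square_integrable[OF \<phi> ab]
  define f where "f x = indicator {a<..<b} x *\<^sub>R (G x *v \<phi> x)" for x
  have f_sq: "square_integrable f"
  proof (rule square_integrable_bound[OF _ square_integrable_scaleR[OF \<phi>_sq, of "1/m"]])
    have "\<phi> \<in> borel_measurable (lebesgue_on {a<..<b})"
      using \<phi>_sq by (intro measurable_restrict_space1) (simp add: square_integrable_def)
    from inverse_measurable[OF this] show "f \<in> borel_measurable lebesgue"
      unfolding f_def[abs_def] by (subst (asm) borel_measurable_restrict_space_iff) auto
    have "norm (f x) \<le> norm ((1/m) *\<^sub>R \<phi> x)" for x
    proof (cases "x \<in> {a<..<b}")
      case True
      then show ?thesis
        using inverse_norm_le[OF True, of "\<phi> x"] m by (simp add: f_def)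
    qed (simp add: f_def)
    then show "AE x in lebesgue. norm (f x) \<le> norm ((1/m) *\<^sub>R \<phi> x)"
      by simp
  qed
  define v where "v = abs_L2 f"
  have v: "v \<in> L2_on a b"
    using rep_abs_L2[OF f_sq] by (auto simp: L2_on_def v_def f_def elim!: eventually_mono)
  have Hv: "mult_on a b \<H> v = abs_L2 \<phi>"
  proof (rule L2_eqI)
    have zero: "\<phi> x = 0" if "x \<notin> {a<..<b}" for x
      using that \<phi> closure_subset[of "{x. \<phi> x \<noteq> 0}"] unfolding test_functions_iff by blast
    show "AE x in lebesgue. rep_L2 (mult_on a b \<H> v) x = rep_L2 (abs_L2 \<phi>) x"
      using \<H>_rep[of v] rep_abs_L2[OF f_sq] rep_abs_L2[OF \<phi>_sq]
    proof eventually_elim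
      case (elim x)
      then show ?case
        by (cases "x \<in> {a<..<b}") (simp_all add: v_def f_def inverse_cancel zero)
    qed
  qed
  have "abs_L2 \<phi> \<in> H1_0 a b"
  proof -
    have "(abs_L2 \<phi>, abs_L2 (vderiv \<phi>)) \<in> (\<lambda>\<phi>. (abs_L2 \<phi>, abs_L2 (vderiv \<phi>))) ` test_functions a b"
      using \<phi> by (rule imageI)
    then show ?thesis
      unfolding H1_0_def mem_Collect_eq by (intro exI subsetD[OF closure_subset])
  qed
  then have H10: "mult_on a b \<H> v \<in> H1_0 a b"
    by (simp only: Hv)
  have "norm_H a b \<H> (u - v) < e"
  proof -
    have mem: "u - v \<in> L2_on a b"
      using subspace_diff[OF subspace_L2_on u v] .
    have "mult_on a b \<H> (u - v) = mult_on a b \<H> u - mult_on a b \<H> v"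
      using \<H>_linear(1)[of u "(-1) *\<^sub>R v"] \<H>_linear(2)[of "-1" v] by simp
    then have "norm (mult_on a b \<H> (u - v)) < e * sqrt m"
      using close unfolding Hv dist_norm by (simp add: norm_minus_commute)
    then have "(norm (mult_on a b \<H> (u - v)))\<^sup>2 < (e * sqrt m)\<^sup>2"
      by (intro power_strict_mono) auto
    then have "(norm (mult_on a b \<H> (u - v)))\<^sup>2 / m < e\<^sup>2"
      using m by (simp add: power_mult_distrib field_simps)
    with inner_H_upper[OF mem] have "inner_H a b \<H> (u - v) (u - v) < e\<^sup>2"
      by linarith
    then have "norm_H a b \<H> (u - v) < sqrt (e\<^sup>2)"
      unfolding norm_H_def by (rule real_sqrt_less_mono)
    with e show ?thesis
      by simp
  qed
  with v H10 show ?thesis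
    by (intro bexI[of _ v] conjI)
qed

end

section \<open>Complexification\<close>

text \<open>Complex vectors are written as pairs of real ones, since the energy space and the generator are real.
  The real inner product of \<open>\<complex>\<^sup>n\<close> is used throughout, for which multiplication by \<open>i\<close> is skew.\<close>

definition cvec :: "real^'n \<Rightarrow> real^'n \<Rightarrow> complex^'n" where
  "cvec x y = (\<chi> k. Complex (x $ k) (y $ k))"

lemma cvec_exhaust: obtains x y where "z = cvec x y"
proof
  show "z = cvec (\<chi> k. Re (z $ k)) (\<chi> k. Im (z $ k))"
    by (simp add: cvec_def vec_eq_iff)
qed

lemma cvec_add: "cvec x y + cvec x' y' = cvec (x + x') (y + y')"
  by (simp add: cvec_def vec_eq_iff complex_eq_iff)

lemma cvec_diff: "cvec x y - cvec x' y' = cvec (x - x') (y - y')"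
  by (simp add: cvec_def vec_eq_iff complex_eq_iff)

lemma cvec_scaleR: "r *\<^sub>R cvec x y = cvec (r *\<^sub>R x) (r *\<^sub>R y)"
  by (simp add: cvec_def vec_eq_iff complex_eq_iff)

lemma cvec_i: "(\<i> * complex_of_real t) *s cvec x y = cvec (- (t *\<^sub>R y)) (t *\<^sub>R x)"
  by (simp add: cvec_def vec_eq_iff complex_eq_iff)

lemma inner_cvec: "cvec x y \<bullet> cvec x' y' = x \<bullet> x' + y \<bullet> y'"
  by (simp add: cvec_def inner_vec_def inner_complex_def sum.distrib)

lemma norm_cvec: "(norm (cvec x y))\<^sup>2 = (norm x)\<^sup>2 + (norm y)\<^sup>2"
  by (simp add: power2_norm_eq_inner inner_cvec)

lemma cmat_cvec: "cmat M *v cvec x y = cvec (M *v x) (M *v y)"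
  by (simp add: cvec_def cmat_def matrix_vector_mult_def vec_eq_iff complex_eq_iff)

lemma norm_cmat_le:
  assumes "\<And>v. norm (M *v v) \<le> B * norm v" "B \<ge> 0"
  shows "norm (cmat M *v z) \<le> B * norm z"
proof -
  obtain x y where z: "z = cvec x y"
    by (rule cvec_exhaust)
  have "(norm (cmat M *v z))\<^sup>2 = (norm (M *v x))\<^sup>2 + (norm (M *v y))\<^sup>2"
    by (simp add: z cmat_cvec norm_cvec)
  also have "\<dots> \<le> (B * norm x)\<^sup>2 + (B * norm y)\<^sup>2"
    by (intro add_mono power_mono assms) auto
  also have "\<dots> = (B * norm z)\<^sup>2"
    by (simp add: z power_mult_distrib norm_cvec distrib_left)
  finally show ?thesis
    using assms(2) by (intro power2_le_imp_le[of "norm (cmat M *v z)"]) auto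
qed

lemma mat_vector: "mat c *v y = c *s y"
  by (simp add: mat_def matrix_vector_mult_def vec_eq_iff mult_delta_left)

lemma mat_matrix_vector: "(mat c ** A) *v z = c *s (A *v z)"
  by (simp add: mat_vector matrix_vector_mul_assoc[symmetric])

lemma bounded_linear_matrix_apply: "bounded_linear (\<lambda>A :: complex^'n^'m. A *v z)"
  unfolding linear_conv_bounded_linear[symmetric]
  by (rule linearI)
    (simp_all add: matrix_vector_mult_def vec_eq_iff distrib_right sum.distrib scaleR_sum_right)

lemma primitive_on_bounded_linear:
  fixes L :: "'b::euclidean_space \<Rightarrow> 'c::euclidean_space"
  assumes "primitive_on a b F f" and L: "bounded_linear L"
  shows "primitive_on a b (\<lambda>x. L (F x)) (\<lambda>x. L (f x))"
  unfolding primitive_on_def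
proof (intro conjI ballI)
  note int = primitive_onD(1)[OF assms(1)]
  show "(\<lambda>x. L (f x)) absolutely_integrable_on {a..b}"
    using absolutely_integrable_linear[OF int L] by (simp add: o_def)
  fix x assume x: "x \<in> {a..b}"
  have "f integrable_on {a..x}"
    by (rule set_lebesgue_integral_eq_integral(1)[OF absolutely_integrable_subinterval[OF int]])
      (use x in auto)
  from integral_linear[OF this L] have "integral {a..x} (\<lambda>x. L (f x)) = L (integral {a..x} f)"
    by (simp add: o_def)
  moreover have "L (F x) = L (F a + integral {a..x} f)"
    by (rule arg_cong[OF primitive_onD(2)[OF assms(1) x]])
  ultimately show "L (F x) = L (F a) + integral {a..x} (\<lambda>x. L (f x))"
    by (simp add: linear_simps[OF L])
qed

lemma primitive_on_add:
  assumes F: "primitive_on a b F f" and G: "primitive_on a b G g"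
  shows "primitive_on a b (\<lambda>x. F x + G x) (\<lambda>x. f x + g x)"
  unfolding primitive_on_def
proof (intro conjI ballI)
  note int = primitive_onD(1)[OF F] primitive_onD(1)[OF G]
  show "(\<lambda>x. f x + g x) absolutely_integrable_on {a..b}"
    by (rule set_integral_add(1)[OF int])
  fix x assume x: "x \<in> {a..b}"
  have "f integrable_on {a..x}" "g integrable_on {a..x}"
    by (rule set_lebesgue_integral_eq_integral(1)[OF absolutely_integrable_subinterval[OF int(1)]],
        use x in auto)
      (rule set_lebesgue_integral_eq_integral(1)[OF absolutely_integrable_subinterval[OF int(2)]],
        use x in auto)
  from Henstock_Kurzweil_Integration.integral_add[OF this]
  show "F x + G x = F a + G a + integral {a..x} (\<lambda>x. f x + g x)"
    using primitive_onD(2)[OF F x] primitive_onD(2)[OF G x] by simp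
qed

lemma bounded_linear_cvec: "bounded_linear (\<lambda>x. cvec x 0)" "bounded_linear (\<lambda>y. cvec 0 y)"
  unfolding linear_conv_bounded_linear[symmetric]
  by (rule linearI; simp add: cvec_add cvec_scaleR)+

lemma primitive_on_cvec:
  assumes "primitive_on a b F f" "primitive_on a b G g"
  shows "primitive_on a b (\<lambda>x. cvec (F x) (G x)) (\<lambda>x. cvec (f x) (g x))"
  using primitive_on_add[OF primitive_on_bounded_linear[OF assms(1) bounded_linear_cvec(1)]
      primitive_on_bounded_linear[OF assms(2) bounded_linear_cvec(2)]]
  by (simp add: cvec_add)

lemma cvec_absolutely_integrable:
  assumes "f absolutely_integrable_on S" "g absolutely_integrable_on S"
  shows "(\<lambda>x. cvec (f x) (g x)) absolutely_integrable_on S"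
  using set_integral_add(1)[OF absolutely_integrable_linear[OF assms(1) bounded_linear_cvec(1)]
      absolutely_integrable_linear[OF assms(2) bounded_linear_cvec(2)]]
  by (simp add: o_def cvec_add)

lemma abs_continuous_on_bounded_linear:
  assumes f: "abs_continuous_on a b f" and L: "bounded_linear L"
  shows "abs_continuous_on a b (\<lambda>x. L (f x))"
  unfolding abs_continuous_on_def
proof (intro allI impI)
  fix \<epsilon> :: real assume "\<epsilon> > 0"
  obtain B where B: "B > 0" "\<And>y. norm (L y) \<le> norm y * B"
    using bounded_linear.pos_bounded[OF L] by blast
  have "\<epsilon> / B > 0"
    using B \<open>\<epsilon> > 0\<close> by simp
  then obtain \<delta> where \<delta>: "\<delta> > 0" and small: "\<forall>I. finite I \<and> (\<forall>(x, y)\<in>I. a \<le> x \<and> x < y \<and> y \<le> b) \<and>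
      disjoint_family_on (\<lambda>(x, y). {x<..<y}) I \<and> (\<Sum>(x, y)\<in>I. y - x) < \<delta> \<longrightarrow>
      (\<Sum>(x, y)\<in>I. norm (f y - f x)) < \<epsilon> / B"
    using f unfolding abs_continuous_on_def by blast
  show "\<exists>\<delta>>0. \<forall>I. finite I \<and> (\<forall>(x, y)\<in>I. a \<le> x \<and> x < y \<and> y \<le> b) \<and>
      disjoint_family_on (\<lambda>(x, y). {x<..<y}) I \<and> (\<Sum>(x, y)\<in>I. y - x) < \<delta> \<longrightarrow>
      (\<Sum>(x, y)\<in>I. norm (L (f y) - L (f x))) < \<epsilon>"
  proof (intro exI[of _ \<delta>] conjI allI impI)
    fix I assume I: "finite I \<and> (\<forall>(x, y)\<in>I. a \<le> x \<and> x < y \<and> y \<le> b) \<and>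
      disjoint_family_on (\<lambda>(x, y). {x<..<y}) I \<and> (\<Sum>(x, y)\<in>I. y - x) < \<delta>"
    have "norm (L (f y) - L (f x)) \<le> norm (f y - f x) * B" for x y
      using B(2)[of "f y - f x"] by (simp add: linear_simps[OF L])
    then have "(\<Sum>(x, y)\<in>I. norm (L (f y) - L (f x))) \<le> (\<Sum>(x, y)\<in>I. norm (f y - f x) * B)"
      by (intro sum_mono) (auto simp: split_def)
    also have "\<dots> = (\<Sum>(x, y)\<in>I. norm (f y - f x)) * B"
      by (simp add: sum_distrib_right split_def)
    also have "\<dots> < \<epsilon> / B * B"
      by (rule mult_strict_right_mono[OF small[rule_format, OF I] B(1)])
    finally show "(\<Sum>(x, y)\<in>I. norm (L (f y) - L (f x))) < \<epsilon>"
      using B(1) by simp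
  qed (rule \<delta>)
qed

context energy_density
begin

text \<open>The coefficient \<open>i t \<H>\<inverse> - P\<^sub>0\<close> of the equation \<open>P\<^sub>1 w' = (i t \<H>\<inverse> - P\<^sub>0) w - f\<close>.\<close>

definition system :: "real^'n^'n \<Rightarrow> real \<Rightarrow> real \<Rightarrow> complex^'n \<Rightarrow> complex^'n" where
  "system P\<^sub>0 t x z = (mat (\<i> * complex_of_real t) ** cmat (G x) - cmat P\<^sub>0) *v z"

lemma system_cvec: "system P\<^sub>0 t x (cvec p q)
    = cvec (- (t *\<^sub>R (G x *v q)) - P\<^sub>0 *v p) (t *\<^sub>R (G x *v p) - P\<^sub>0 *v q)"
  by (simp add: system_def matrix_vector_mult_diff_rdistrib mat_matrix_vector cmat_cvec cvec_i cvec_diff)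

lemma system_skew:
  assumes x: "x \<in> {a<..<b}" and skew: "P\<^sub>0 = - transpose P\<^sub>0"
  shows "system P\<^sub>0 t x y \<bullet> z = - (y \<bullet> system P\<^sub>0 t x z)"
proof -
  obtain p q p' q' where yz: "y = cvec p q" "z = cvec p' q'"
    by (metis cvec_exhaust)
  have P0: "(P\<^sub>0 *v v) \<bullet> w = - (v \<bullet> (P\<^sub>0 *v w))" for v w
  proof -
    have "v \<bullet> (P\<^sub>0 *v w) = v \<bullet> ((- transpose P\<^sub>0) *v w)"
      using skew by (rule arg_cong)
    also have "(- transpose P\<^sub>0) *v w = - (transpose P\<^sub>0 *v w)"
      using matrix_vector_mult_diff_rdistrib[of 0 "transpose P\<^sub>0" w] by simp
    finally show ?thesis
      by (simp add: inner_matrix_transpose del: transpose_matrix_vector)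
  qed
  show ?thesis
    unfolding yz system_cvec inner_cvec
    by (simp add: inner_diff_left inner_diff_right inverse_sym[OF x] P0)
qed

lemma system_bounded:
  obtains B where "B \<ge> 0" "\<And>x z. x \<in> {a<..<b} \<Longrightarrow> norm (system P\<^sub>0 t x z) \<le> B * norm z"
proof -
  obtain B where B: "B > 0" "\<And>z. norm (cmat P\<^sub>0 *v z) \<le> norm z * B"
    using bounded_linear.pos_bounded[OF matrix_vector_mul_bounded_linear[of "cmat P\<^sub>0"]] by blast
  have "norm (system P\<^sub>0 t x z) \<le> (\<bar>t\<bar> * (1/m) + B) * norm z" if x: "x \<in> {a<..<b}" for x z
  proof -
    have i: "norm ((\<i> * complex_of_real t) *s y) = \<bar>t\<bar> * norm y" for y :: "complex^'n"
    proof -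
      obtain p q where y: "y = cvec p q"
        by (rule cvec_exhaust)
      have "(norm ((\<i> * complex_of_real t) *s y))\<^sup>2 = (\<bar>t\<bar> * norm y)\<^sup>2"
        by (simp add: y cvec_i norm_cvec power_mult_distrib distrib_left)
      then show ?thesis
        by (rule power2_eq_imp_eq) simp_all
    qed
    have "norm (system P\<^sub>0 t x z) \<le> \<bar>t\<bar> * norm (cmat (G x) *v z) + norm (cmat P\<^sub>0 *v z)"
      unfolding system_def matrix_vector_mult_diff_rdistrib mat_matrix_vector i[symmetric]
      by (rule norm_triangle_ineq4)
    also have "\<dots> \<le> \<bar>t\<bar> * ((1/m) * norm z) + norm z * B"
      using m by (intro add_mono mult_left_mono norm_cmat_le inverse_norm_le x B) auto
    finally show ?thesis
      by (simp add: algebra_simps)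
  qed
  moreover have "\<bar>t\<bar> * (1/m) + B \<ge> 0"
    using m B by simp
  ultimately show ?thesis
    using that by blast
qed

text \<open>The columns of \<open>\<Phi>\<close> are bounded solutions on the open interval; continuity extends the bound to the end
  points, one of which is \<open>\<eta>\<close>.\<close>

lemma fundamental_solution_estimate:
  assumes P1: "transpose P\<^sub>1 = P\<^sub>1" "invertible P\<^sub>1" and P0: "P\<^sub>0 = - transpose P\<^sub>0"
    and p: "p \<ge> 0" "\<And>v. norm (P\<^sub>1 *v v) \<le> p * norm v"
    and q: "q \<ge> 0" "\<And>v. norm (matrix_inv P\<^sub>1 *v v) \<le> q * norm v"
    and \<Phi>: "fundamental_solution a b (\<lambda>x. cmat (matrix_inv P\<^sub>1) **
              (mat (\<i> * complex_of_real t) ** cmat (G x) - cmat P\<^sub>0)) \<Phi>"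
    and K: "K \<ge> 0" "\<And>x \<xi>. x \<in> {a<..<b} \<Longrightarrow> norm (\<Phi> x *v \<xi>) \<le> K * norm \<xi>"
    and W: "primitive_on a b W w"
      "AE x in lebesgue. x \<in> {a<..<b} \<longrightarrow> cmat P\<^sub>1 *v w x = system P\<^sub>0 t x (W x) - F x"
    and F: "F absolutely_integrable_on {a..b}" and \<eta>: "\<eta> \<in> {a, b}" and x: "x \<in> {a..b}"
  shows "norm (W x) \<le> q * (K * (q * (K * p))) * (p + 1) * (norm (W \<eta>) + integral {a..b} (\<lambda>s. norm (F s)))"
proof -
\<comment> \<open>The derivative is set to \<open>0\<close> at the end points, where \<open>\<H>\<close> is arbitrary.\<close>
  define \<psi> where "\<psi> \<xi> x = (if x \<in> {a<..<b} then cmat (matrix_inv P\<^sub>1) *v system P\<^sub>0 t x (\<Phi> x *v \<xi>) else 0)"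
    for \<xi> x
  have P1_cancel: "cmat P\<^sub>1 *v (cmat (matrix_inv P\<^sub>1) *v z) = z" "cmat (matrix_inv P\<^sub>1) *v (cmat P\<^sub>1 *v z) = z" for z
    by (rule cvec_exhaust[of z]; simp add: cmat_cvec matrix_vector_mul_assoc matrix_inv_cancel[OF P1(2)])+
  obtain B where B: "B \<ge> 0" "\<And>x z. x \<in> {a<..<b} \<Longrightarrow> norm (system P\<^sub>0 t x z) \<le> B * norm z"
    using system_bounded by blast
  have prim: "primitive_on a b (\<lambda>x. \<Phi> x *v \<xi>) (\<psi> \<xi>)" for \<xi>
  proof (rule abs_continuous_primitive_on[of a b _ _ "q * (B * (K * norm \<xi>))"])
    show "abs_continuous_on a b (\<lambda>x. \<Phi> x *v \<xi>)"
      using \<Phi> unfolding fundamental_solution_def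
      by (intro abs_continuous_on_bounded_linear[OF _ bounded_linear_matrix_apply]) blast
    have "AE x in lebesgue. x \<in> {a<..<b} \<longrightarrow> (\<Phi> has_vector_derivative ((cmat (matrix_inv P\<^sub>1) **
              (mat (\<i> * complex_of_real t) ** cmat (G x) - cmat P\<^sub>0)) ** \<Phi> x)) (at x)"
      using \<Phi> unfolding fundamental_solution_def by blast
    then show "AE x in lebesgue. x \<in> {a<..<b} \<longrightarrow> ((\<lambda>x. \<Phi> x *v \<xi>) has_vector_derivative \<psi> \<xi> x) (at x)"
    proof eventually_elim
      case (elim x)
      show ?case
      proof
        assume x: "x \<in> {a<..<b}"
        from bounded_linear.has_vector_derivative[OF bounded_linear_matrix_apply[of \<xi>] elim[rule_format, OF x]]
        show "((\<lambda>x. \<Phi> x *v \<xi>) has_vector_derivative \<psi> \<xi> x) (at x)"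
          using x by (simp add: \<psi>_def system_def matrix_vector_mul_assoc[symmetric])
      qed
    qed
    show "norm (\<psi> \<xi> x) \<le> q * (B * (K * norm \<xi>))" if "x \<in> {a..b}" for x
    proof (cases "x \<in> {a<..<b}")
      case True
      have "norm (\<psi> \<xi> x) \<le> q * norm (system P\<^sub>0 t x (\<Phi> x *v \<xi>))"
        using True q by (simp add: \<psi>_def norm_cmat_le)
      also have "\<dots> \<le> q * (B * norm (\<Phi> x *v \<xi>))"
        by (intro mult_left_mono B q True)
      also have "\<dots> \<le> q * (B * (K * norm \<xi>))"
        by (intro mult_left_mono K B q True)
      finally show ?thesis .
    next
      case False
      then have "\<psi> \<xi> x = 0"
        unfolding \<psi>_def by (rule if_not_P)
      then show ?thesis
        using q(1) B(1) K(1) by simp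
    qed
  qed (use ab in simp)
  have K': "norm (\<Phi> x *v \<xi>) \<le> K * norm \<xi>" if "x \<in> {a..b}" for x \<xi>
  proof (rule continuous_on_closure_norm_le[of "{a<..<b}" "\<lambda>x. \<Phi> x *v \<xi>"])
    show "continuous_on (closure {a<..<b}) (\<lambda>x. \<Phi> x *v \<xi>)"
      using primitive_on_continuous[OF prim[of \<xi>]] ab by simp
  qed (use K that ab in auto)
  show ?thesis
  proof (rule skew_system_estimate[where P = "(*v) (cmat P\<^sub>1)" and S = "system P\<^sub>0 t" and \<Psi> = "\<lambda>x. (*v) (\<Phi> x)"
        and \<psi> = \<psi> and a = a and b = b, OF _ _ p(1) _ q(1) _ _ prim _ _ _ K(1) K' W F \<eta> x])
    show "linear ((*v) (cmat P\<^sub>1))" "linear ((*v) (\<Phi> x))" for x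
      using matrix_vector_mul_bounded_linear by (auto simp: linear_conv_bounded_linear)
    show "(cmat P\<^sub>1 *v y) \<bullet> z = y \<bullet> (cmat P\<^sub>1 *v z)" for y z
    proof -
      obtain u v u' v' where yz: "y = cvec u v" "z = cvec u' v'"
        by (metis cvec_exhaust)
      show ?thesis
        using inner_matrix_transpose[of P\<^sub>1] unfolding yz cmat_cvec inner_cvec P1(1) by simp
    qed
    show "norm (cmat P\<^sub>1 *v y) \<le> p * norm y" for y
      by (rule norm_cmat_le[OF p(2,1)])
    show "norm y \<le> q * norm (cmat P\<^sub>1 *v y)" for y
      using norm_cmat_le[OF q(2,1), of "cmat P\<^sub>1 *v y"] by (simp add: P1_cancel)
    show "system P\<^sub>0 t x y \<bullet> z = - (y \<bullet> system P\<^sub>0 t x z)" if "x \<in> {a<..<b}" for x y z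
      by (rule system_skew[OF that P0])
    show "AE x in lebesgue. x \<in> {a<..<b} \<longrightarrow> cmat P\<^sub>1 *v \<psi> \<xi> x = system P\<^sub>0 t x (\<Phi> x *v \<xi>)" for \<xi>
      by (simp add: \<psi>_def P1_cancel)
    show "\<Phi> a *v \<xi> = \<xi>" for \<xi>
      using \<Phi> by (simp add: fundamental_solution_def)
  qed
qed

end

section \<open>The resolvent on the imaginary axis\<close>

lemma rep_L2_diff: "AE x in lebesgue. rep_L2 (u - v) x = rep_L2 u x - rep_L2 v x"
  using rep_abs_L2[OF square_integrable_diff[OF square_integrable_rep square_integrable_rep], of u v]
  by (simp add: abs_L2_diff square_integrable_rep abs_rep_L2)

lemma norm_L2_power2: "(norm u)\<^sup>2 = (LINT x|lebesgue. (norm (rep_L2 u x))\<^sup>2)"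
  by (simp add: power2_norm_eq_inner inner_L2)

lemma integral_norm_le_norm_L2:
  fixes u :: "'b::euclidean_space L2"
  assumes "a \<le> b"
  shows "integral {a..b} (\<lambda>x. norm (rep_L2 u x)) \<le> sqrt (b - a) * norm u"
proof -
  have ind: "square_integrable (indicator {a..b} :: real \<Rightarrow> real)"
  proof (rule square_integrable_bounded_support[of _ 1 a b])
    show "(indicator {a..b} :: real \<Rightarrow> real) \<in> borel_measurable lebesgue"
      by (rule borel_measurable_indicator) simp
  qed (auto simp: indicator_def)
  have nrm: "square_integrable (\<lambda>x. norm (rep_L2 u x))"
    by (rule square_integrable_bound[OF _ square_integrable_rep[of u]]) auto
  have int: "(\<lambda>x. norm (rep_L2 u x)) absolutely_integrable_on {a..b}"
    by (rule square_integrable_imp_absolutely_integrable[OF nrm])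
  have "integral {a..b} (\<lambda>x. norm (rep_L2 u x)) = (LINT x:{a..b}|lebesgue. norm (rep_L2 u x))"
    by (rule set_lebesgue_integral_eq_integral(2)[OF int, symmetric])
  also have "\<dots> = abs_L2 (indicator {a..b}) \<bullet> abs_L2 (\<lambda>x. norm (rep_L2 u x))"
    unfolding inner_abs_L2[OF ind nrm] set_lebesgue_integral_def by simp
  also have "\<dots> \<le> norm (abs_L2 (indicator {a..b} :: real \<Rightarrow> real)) * norm (abs_L2 (\<lambda>x. norm (rep_L2 u x)))"
    by (rule norm_cauchy_schwarz)
  also have "norm (abs_L2 (\<lambda>x. norm (rep_L2 u x))) = norm u"
  proof (rule power2_eq_imp_eq)
    show "(norm (abs_L2 (\<lambda>x. norm (rep_L2 u x))))\<^sup>2 = (norm u)\<^sup>2"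
      unfolding norm_abs_L2[OF nrm] norm_L2_power2[of u] by simp
  qed simp_all
  also have "norm (abs_L2 (indicator {a..b} :: real \<Rightarrow> real)) = sqrt (b - a)"
  proof (rule power2_eq_imp_eq)
    have "(\<lambda>x. (norm (indicator {a..b} x :: real))\<^sup>2) = indicator {a..b}"
      by (auto simp: indicator_def fun_eq_iff)
    then show "(norm (abs_L2 (indicator {a..b} :: real \<Rightarrow> real)))\<^sup>2 = (sqrt (b - a))\<^sup>2"
      unfolding norm_abs_L2[OF ind] using assms by simp
  qed (use assms in simp_all)
  finally show ?thesis .
qed

lemma norm_L2_le_bound:
  fixes u :: "'b::euclidean_space L2"
  assumes ab: "a \<le> b" and u: "u \<in> L2_on a b"
    and bound: "AE x in lebesgue. x \<in> {a<..<b} \<longrightarrow> norm (rep_L2 u x) \<le> R"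
  shows "(norm u)\<^sup>2 \<le> (b - a) * R\<^sup>2"
proof -
  have "(norm u)\<^sup>2 \<le> (LINT x|lebesgue. R\<^sup>2 * indicator {a..b} x)"
    unfolding norm_L2_power2
  proof (rule integral_mono_AE)
    show "integrable lebesgue (\<lambda>x. (norm (rep_L2 u x))\<^sup>2)"
      using square_integrable_rep[of u] by (simp add: square_integrable_def)
    show "integrable lebesgue (\<lambda>x. R\<^sup>2 * indicator {a..b} x)"
      by (intro integrable_mult_right integrable_real_indicator) (auto simp: emeasure_lborel_Icc_eq)
    show "AE x in lebesgue. (norm (rep_L2 u x))\<^sup>2 \<le> R\<^sup>2 * indicator {a..b} x"
      using bound u[unfolded L2_on_def mem_Collect_eq]
    proof eventually_elim
      case (elim x)
      show ?case
      proof (cases "x \<in> {a<..<b}")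
        case True
        then have "(norm (rep_L2 u x))\<^sup>2 \<le> R\<^sup>2"
          using elim(1) by (intro power_mono) auto
        with True show ?thesis
          by simp
      next
        case False
        then show ?thesis
          using elim(2) by simp
      qed
    qed
  qed
  also have "\<dots> = (b - a) * R\<^sup>2"
    using ab by simp
  finally show ?thesis .
qed

text \<open>Young's inequality \<open>\<kappa> x y \<le> x\<^sup>2 / 2 + (\<kappa> y)\<^sup>2 / 2\<close> lets the dissipated boundary term \<open>X\<close> be absorbed
  into \<open>U\<close>.\<close>

lemma absorb_products:
  fixes U F X :: real
  assumes U: "U = x\<^sub>1\<^sup>2 + x\<^sub>2\<^sup>2" and F: "F = y\<^sub>1\<^sup>2 + y\<^sub>2\<^sup>2" and c: "c > 0" and k: "k \<ge> 0"
    and le: "U \<le> k * (X + l * F)" and diss: "c * X \<le> x\<^sub>1 * y\<^sub>1 + x\<^sub>2 * y\<^sub>2"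
  shows "U \<le> ((k / c)\<^sup>2 + 2 * k * l) * F"
proof -
  define \<kappa> where "\<kappa> = k / c"
  have "k * X = \<kappa> * (c * X)"
    using c by (simp add: \<kappa>_def)
  also have "\<dots> \<le> \<kappa> * (x\<^sub>1 * y\<^sub>1 + x\<^sub>2 * y\<^sub>2)"
    using c k by (intro mult_left_mono diss) (simp add: \<kappa>_def)
  also have "\<dots> \<le> (x\<^sub>1\<^sup>2 + (\<kappa> * y\<^sub>1)\<^sup>2) / 2 + (x\<^sub>2\<^sup>2 + (\<kappa> * y\<^sub>2)\<^sup>2) / 2"
    using sum_squares_bound[of x\<^sub>1 "\<kappa> * y\<^sub>1"] sum_squares_bound[of x\<^sub>2 "\<kappa> * y\<^sub>2"]
    by (simp add: field_simps)
  also have "\<dots> = U / 2 + \<kappa>\<^sup>2 * F / 2"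
    by (simp add: U F power_mult_distrib algebra_simps add_divide_distrib)
  finally show ?thesis
    using le by (simp add: \<kappa>_def algebra_simps)
qed

context energy_density
begin

text \<open>Write \<open>f = - t v - A u\<close> and \<open>g = t u - A v\<close>, so that \<open>f + i g = (i t - A) (u + i v)\<close>, and let \<open>W\<close> be the
  continuous representative of \<open>\<H> (u + i v)\<close>. The equation for \<open>W\<close> bounds it by \<open>norm (W \<eta>)\<close> and the
  integral of the right side. Adding the dissipation inequalities for \<open>u\<close> and \<open>v\<close>, in which the terms
  with \<open>t\<close> cancel, controls \<open>W \<eta>\<close>.\<close>

theorem imaginary_resolvent_bound:
  fixes \<Phi> :: "real \<Rightarrow> real \<Rightarrow> complex^'n^'n" and A :: "(real^'n) L2 \<Rightarrow> (real^'n) L2"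
  assumes P1: "transpose P\<^sub>1 = P\<^sub>1" "invertible P\<^sub>1" and P0: "P\<^sub>0 = - transpose P\<^sub>0"
    and lin: "linear_operator (L2_on a b) D A"
    and form: "\<And>u. u \<in> D \<Longrightarrow> \<exists>w\<in>L2_on a b. weak_derivative a b (mult_on a b \<H> u) w \<and>
           A u = mult_on a b (\<lambda>_. P\<^sub>1) w + mult_on a b (\<lambda>_. P\<^sub>0) (mult_on a b \<H> u)"
    and \<Phi>: "\<And>t. fundamental_solution a b (\<lambda>x. cmat (matrix_inv P\<^sub>1) **
              (mat (\<i> * complex_of_real t) ** cmat (G x) - cmat P\<^sub>0)) (\<Phi> t)"
    and bdd: "bdd_above {onorm ((*v) (\<Phi> t x)) | t x. x \<in> {a<..<b}}"
    and c: "c > 0" and \<eta>: "\<eta> \<in> {a, b}"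
    and diss: "\<And>u. u \<in> D \<Longrightarrow>
           inner_H a b \<H> u (A u) \<le> - c * (norm (point_eval a b (mult_on a b \<H> u) \<eta>))\<^sup>2"
  obtains C where "C > 0" "\<And>t u v. u \<in> D \<Longrightarrow> v \<in> D \<Longrightarrow>
      (norm_H a b \<H> u)\<^sup>2 + (norm_H a b \<H> v)\<^sup>2 \<le>
      C\<^sup>2 * ((norm_H a b \<H> (- (t *\<^sub>R v) - A u))\<^sup>2 + (norm_H a b \<H> (t *\<^sub>R u - A v))\<^sup>2)"
proof -
  interpret E: semi_inner "inner_H a b \<H>"
    by (rule semi_inner_H)
  have N: "norm_H a b \<H> = E.seminorm"
    by (simp add: fun_eq_iff norm_H_def E.seminorm_def)
  note A = linear_operatorD[OF lin]
  have sub: "subspace (L2_on a b :: (real^'n) L2 set)"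
    by (rule subspace_L2_on)
  obtain p where p: "p \<ge> 0" "\<And>v. norm (P\<^sub>1 *v v) \<le> norm v * p"
    using bounded_linear.nonneg_bounded[OF matrix_vector_mul_bounded_linear[of P\<^sub>1]] by blast
  obtain q where q: "q \<ge> 0" "\<And>v. norm (matrix_inv P\<^sub>1 *v v) \<le> norm v * q"
    using bounded_linear.nonneg_bounded[OF matrix_vector_mul_bounded_linear[of "matrix_inv P\<^sub>1"]] by blast
  obtain K\<^sub>0 where K\<^sub>0: "\<And>t x. x \<in> {a<..<b} \<Longrightarrow> onorm ((*v) (\<Phi> t x)) \<le> K\<^sub>0"
    using bdd unfolding bdd_above_def by blast
  define K where "K = max K\<^sub>0 0"
  have K: "K \<ge> 0" "norm (\<Phi> t x *v \<xi>) \<le> K * norm \<xi>" if "x \<in> {a<..<b}" for t x \<xi>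
  proof -
    show "K \<ge> 0"
      by (simp add: K_def)
    have "norm (\<Phi> t x *v \<xi>) \<le> onorm ((*v) (\<Phi> t x)) * norm \<xi>"
      by (rule onorm[OF matrix_vector_mul_bounded_linear])
    also have "\<dots> \<le> K * norm \<xi>"
      using K\<^sub>0[OF that, of t] by (intro mult_right_mono) (auto simp: K_def)
    finally show "norm (\<Phi> t x *v \<xi>) \<le> K * norm \<xi>" .
  qed
  have K0: "K \<ge> 0"
    by (simp add: K_def)
  define C\<^sub>1 where "C\<^sub>1 = q * (K * (q * (K * p))) * (p + 1)"
  have C1: "C\<^sub>1 \<ge> 0"
    unfolding C\<^sub>1_def using p(1) q(1) K0 by simp
  define k where "k = 4 * (b - a) * C\<^sub>1\<^sup>2 / m"
  define l where "l = 2 * (b - a) / m"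
  have k: "k \<ge> 0" and l: "l \<ge> 0"
    using ab m by (simp_all add: k_def l_def)
  have main: "(E.seminorm u)\<^sup>2 + (E.seminorm v)\<^sup>2 \<le> ((k / c)\<^sup>2 + 2 * k * l) *
      ((E.seminorm (- (t *\<^sub>R v) - A u))\<^sup>2 + (E.seminorm (t *\<^sub>R u - A v))\<^sup>2)"
    if uD: "u \<in> D" and vD: "v \<in> D" for t u v
  proof -
    define f where "f = - (t *\<^sub>R v) - A u"
    define g where "g = t *\<^sub>R u - A v"
    have mem: "u \<in> L2_on a b" "v \<in> L2_on a b" "f \<in> L2_on a b" "g \<in> L2_on a b"
      using A(2,3) uD vD unfolding f_def g_def
      by (auto intro!: subspace_diff subspace_neg subspace_scale sub)
    obtain u' where u': "weak_derivative a b (mult_on a b \<H> u) u'"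
      "A u = mult_on a b (\<lambda>_. P\<^sub>1) u' + mult_on a b (\<lambda>_. P\<^sub>0) (mult_on a b \<H> u)"
      using form[OF uD] by blast
    obtain v' where v': "weak_derivative a b (mult_on a b \<H> v) v'"
      "A v = mult_on a b (\<lambda>_. P\<^sub>1) v' + mult_on a b (\<lambda>_. P\<^sub>0) (mult_on a b \<H> v)"
      using form[OF vD] by blast
    obtain W\<^sub>u where Wu: "primitive_on a b W\<^sub>u (rep_L2 u')"
      "AE x in lebesgue. x \<in> {a<..<b} \<longrightarrow> W\<^sub>u x = rep_L2 (mult_on a b \<H> u) x"
      using weak_derivative_primitive_on[OF ab u'(1)] by blast
    obtain W\<^sub>v where Wv: "primitive_on a b W\<^sub>v (rep_L2 v')"
      "AE x in lebesgue. x \<in> {a<..<b} \<longrightarrow> W\<^sub>v x = rep_L2 (mult_on a b \<H> v) x"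
      using weak_derivative_primitive_on[OF ab v'(1)] by blast
    have \<eta>': "\<eta> \<in> {a..b}"
      using \<eta> ab by auto
    have pe: "point_eval a b (mult_on a b \<H> u) \<eta> = W\<^sub>u \<eta>" "point_eval a b (mult_on a b \<H> v) \<eta> = W\<^sub>v \<eta>"
      by (rule point_eval_eq[OF ab primitive_on_continuous[OF Wu(1)] Wu(2) \<eta>'],
          rule point_eval_eq[OF ab primitive_on_continuous[OF Wv(1)] Wv(2) \<eta>'])
    define W where "W x = cvec (W\<^sub>u x) (W\<^sub>v x)" for x
    define w where "w x = cvec (rep_L2 u' x) (rep_L2 v' x)" for x
    define F where "F x = cvec (rep_L2 f x) (rep_L2 g x)" for x
    have prim: "primitive_on a b W w"
      unfolding W_def[abs_def] w_def[abs_def] by (rule primitive_on_cvec[OF Wu(1) Wv(1)])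
    have Fint: "F absolutely_integrable_on {a..b}"
      unfolding F_def[abs_def] by (intro cvec_absolutely_integrable rep_L2_absolutely_integrable)
    have eq: "AE x in lebesgue. x \<in> {a<..<b} \<longrightarrow> cmat P\<^sub>1 *v w x = system P\<^sub>0 t x (W x) - F x"
    proof -
      have f': "AE x in lebesgue. rep_L2 f x = - (t *\<^sub>R rep_L2 v x) - rep_L2 (A u) x"
        using rep_L2_diff[of "(- t) *\<^sub>R v" "A u"] rep_L2_scaleR[of "- t" v]
        by eventually_elim (simp add: f_def)
      have g': "AE x in lebesgue. rep_L2 g x = t *\<^sub>R rep_L2 u x - rep_L2 (A v) x"
        using rep_L2_diff[of "t *\<^sub>R u" "A v"] rep_L2_scaleR[of t u]
        by eventually_elim (simp add: g_def)
      have Au: "AE x in lebesgue. x \<in> {a<..<b} \<longrightarrow> rep_L2 (A u) x = P\<^sub>1 *v rep_L2 u' x + P\<^sub>0 *v W\<^sub>u x"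
        unfolding u'(2)
        using rep_L2_add[of "mult_on a b (\<lambda>_. P\<^sub>1) u'" "mult_on a b (\<lambda>_. P\<^sub>0) (mult_on a b \<H> u)"]
          mult_on_const_rep[of a b P\<^sub>1 u'] mult_on_const_rep[of a b P\<^sub>0 "mult_on a b \<H> u"] Wu(2)
        by eventually_elim simp
      have Av: "AE x in lebesgue. x \<in> {a<..<b} \<longrightarrow> rep_L2 (A v) x = P\<^sub>1 *v rep_L2 v' x + P\<^sub>0 *v W\<^sub>v x"
        unfolding v'(2)
        using rep_L2_add[of "mult_on a b (\<lambda>_. P\<^sub>1) v'" "mult_on a b (\<lambda>_. P\<^sub>0) (mult_on a b \<H> v)"]
          mult_on_const_rep[of a b P\<^sub>1 v'] mult_on_const_rep[of a b P\<^sub>0 "mult_on a b \<H> v"] Wv(2)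
        by eventually_elim simp
      show ?thesis
        using f' g' Au Av Wu(2) Wv(2) \<H>_rep[of u] \<H>_rep[of v]
      proof eventually_elim
        case (elim x)
        show ?case
        proof
          assume x: "x \<in> {a<..<b}"
          have "rep_L2 u x = G x *v W\<^sub>u x" "rep_L2 v x = G x *v W\<^sub>v x"
            using elim(5-8) x by (simp_all add: inverse_cancel(2))
          then show "cmat P\<^sub>1 *v w x = system P\<^sub>0 t x (W x) - F x"
            using elim(1-4) x
            by (simp add: w_def W_def F_def system_cvec cmat_cvec cvec_diff)
        qed
      qed
    qed
    define I where "I = integral {a..b} (\<lambda>s. norm (F s))"
    define R where "R = C\<^sub>1 * (norm (W \<eta>) + sqrt (b - a) * (norm f + norm g))"
    have I: "I \<le> sqrt (b - a) * (norm f + norm g)"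
    proof -
      have ii: "(\<lambda>x. norm (h x)) integrable_on {a..b}" if "h absolutely_integrable_on {a..b}"
        for h :: "real \<Rightarrow> 'z::euclidean_space"
        using that unfolding absolutely_integrable_on_def by blast
      have rfg: "(\<lambda>x. norm (rep_L2 f x)) integrable_on {a..b}" "(\<lambda>x. norm (rep_L2 g x)) integrable_on {a..b}"
        by (rule ii[OF rep_L2_absolutely_integrable])+
      have "I \<le> integral {a..b} (\<lambda>x. norm (rep_L2 f x) + norm (rep_L2 g x))"
        unfolding I_def
      proof (rule integral_le[OF ii[OF Fint] integrable_add[OF rfg]])
        fix x
        have "(norm (F x))\<^sup>2 \<le> (norm (rep_L2 f x) + norm (rep_L2 g x))\<^sup>2"
          by (simp add: F_def norm_cvec power2_sum)
        then show "norm (F x) \<le> norm (rep_L2 f x) + norm (rep_L2 g x)"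
          by (rule power2_le_imp_le) simp
      qed
      also have "\<dots> = integral {a..b} (\<lambda>x. norm (rep_L2 f x)) + integral {a..b} (\<lambda>x. norm (rep_L2 g x))"
        by (rule Henstock_Kurzweil_Integration.integral_add[OF rfg])
      also have "\<dots> \<le> sqrt (b - a) * norm f + sqrt (b - a) * norm g"
        using ab by (intro add_mono integral_norm_le_norm_L2) auto
      finally show ?thesis
        by (simp add: distrib_left)
    qed
    have WR: "norm (W x) \<le> R" if "x \<in> {a<..<b}" for x
    proof -
      have "norm (W x) \<le> C\<^sub>1 * (norm (W \<eta>) + I)"
        unfolding C\<^sub>1_def I_def
        by (rule fundamental_solution_estimate[OF P1 P0 p(1) _ q(1) _ \<Phi>[of t] K0 K(2) prim eq Fint \<eta>])
          (use that p(2) q(2) in \<open>auto simp: mult.commute\<close>)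
      also have "\<dots> \<le> R"
        unfolding R_def using I C1 by (intro mult_left_mono) auto
      finally show ?thesis .
    qed
    have comp: "norm (W\<^sub>u x) \<le> norm (W x)" "norm (W\<^sub>v x) \<le> norm (W x)" for x
      by (rule power2_le_imp_le; simp add: W_def norm_cvec)+
    have "(norm (mult_on a b \<H> u))\<^sup>2 \<le> (b - a) * R\<^sup>2"
    proof (rule norm_L2_le_bound[OF _ \<H>_in_L2_on])
      show "AE x in lebesgue. x \<in> {a<..<b} \<longrightarrow> norm (rep_L2 (mult_on a b \<H> u) x) \<le> R"
        using Wu(2)
      proof eventually_elim
        case (elim x)
        then show ?case
          using comp(1)[of x] WR[of x] by auto
      qed
    qed (use ab in simp)
    then have Nu: "inner_H a b \<H> u u \<le> (b - a) * R\<^sup>2 / m"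
      using inner_H_upper[OF mem(1)] m by (meson divide_right_mono less_imp_le order_trans)
    have "(norm (mult_on a b \<H> v))\<^sup>2 \<le> (b - a) * R\<^sup>2"
    proof (rule norm_L2_le_bound[OF _ \<H>_in_L2_on])
      show "AE x in lebesgue. x \<in> {a<..<b} \<longrightarrow> norm (rep_L2 (mult_on a b \<H> v) x) \<le> R"
        using Wv(2)
      proof eventually_elim
        case (elim x)
        then show ?case
          using comp(2)[of x] WR[of x] by auto
      qed
    qed (use ab in simp)
    then have Nv: "inner_H a b \<H> v v \<le> (b - a) * R\<^sup>2 / m"
      using inner_H_upper[OF mem(2)] m by (meson divide_right_mono less_imp_le order_trans)
    have sq2: "(x + y)\<^sup>2 \<le> 2 * (x\<^sup>2 + y\<^sup>2)" for x y :: real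
      using sum_squares_bound[of x y] by (simp add: power2_sum)
    define Fs where "Fs = (E.seminorm f)\<^sup>2 + (E.seminorm g)\<^sup>2"
    have fg: "(norm f)\<^sup>2 + (norm g)\<^sup>2 \<le> Fs / m"
      using inner_H_lower[OF mem(3)] inner_H_lower[OF mem(4)] m
      by (simp add: Fs_def E.seminorm_power2 field_simps)
    have "R\<^sup>2 \<le> C\<^sub>1\<^sup>2 * (2 * ((norm (W \<eta>))\<^sup>2 + l * Fs))"
    proof -
      have "(sqrt (b - a) * (norm f + norm g))\<^sup>2 = (b - a) * (norm f + norm g)\<^sup>2"
        using ab by (simp add: power_mult_distrib)
      also have "\<dots> \<le> (b - a) * (2 * (Fs / m))"
        using ab sq2[of "norm f" "norm g"] fg by (intro mult_left_mono) auto
      also have "\<dots> = l * Fs"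
        by (simp add: l_def)
      finally have s: "(sqrt (b - a) * (norm f + norm g))\<^sup>2 \<le> l * Fs" .
      show ?thesis
        unfolding R_def power_mult_distrib
        using sq2[of "norm (W \<eta>)" "sqrt (b - a) * (norm f + norm g)"] s
        by (intro mult_left_mono) auto
    qed
    then have "2 * ((b - a) * R\<^sup>2 / m) \<le> 2 * ((b - a) * (C\<^sub>1\<^sup>2 * (2 * ((norm (W \<eta>))\<^sup>2 + l * Fs))) / m)"
      using ab m by (intro mult_left_mono divide_right_mono) auto
    also have "\<dots> = k * ((norm (W \<eta>))\<^sup>2 + l * Fs)"
    proof -
      have "2 * (d * (e * (2 * y)) / m) = 4 * d * e / m * y" for d e y :: real
        by simp
      then show ?thesis
        unfolding k_def .
    qed
    finally have le: "(E.seminorm u)\<^sup>2 + (E.seminorm v)\<^sup>2 \<le> k * ((norm (W \<eta>))\<^sup>2 + l * Fs)"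
      using Nu Nv by (simp add: E.seminorm_power2)
    have "c * (norm (W \<eta>))\<^sup>2 \<le> - inner_H a b \<H> u (A u) - inner_H a b \<H> v (A v)"
      using diss[OF uD] diss[OF vD] unfolding pe by (simp add: W_def norm_cvec distrib_left)
    also have "\<dots> = inner_H a b \<H> u f + inner_H a b \<H> v g"
    proof -
      have "inner_H a b \<H> u f = - t * inner_H a b \<H> u v - inner_H a b \<H> u (A u)"
        using E.diff_right[of u "(- t) *\<^sub>R v" "A u"] E.scale_right[of u "- t" v] by (simp add: f_def)
      moreover have "inner_H a b \<H> v g = t * inner_H a b \<H> v u - inner_H a b \<H> v (A v)"
        using E.diff_right[of v "t *\<^sub>R u" "A v"] E.scale_right[of v t u] by (simp add: g_def)
      ultimately show ?thesis
        using E.commute[of u v] by simp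
    qed
    also have "\<dots> \<le> E.seminorm u * E.seminorm f + E.seminorm v * E.seminorm g"
      by (intro add_mono E.Cauchy_Schwarz)
    finally have d: "c * (norm (W \<eta>))\<^sup>2 \<le> E.seminorm u * E.seminorm f + E.seminorm v * E.seminorm g" .
    show ?thesis
      using absorb_products[OF refl Fs_def c k le d] by (simp add: Fs_def f_def g_def)
  qed
  define C where "C = sqrt ((k / c)\<^sup>2 + 2 * k * l + 1)"
  have pos: "(k / c)\<^sup>2 + 2 * k * l \<ge> 0"
    using k l by simp
  have "C > 0"
    unfolding C_def using pos by simp
  moreover have "C\<^sup>2 = (k / c)\<^sup>2 + 2 * k * l + 1"
    unfolding C_def using pos by simp
  then have "(norm_H a b \<H> u)\<^sup>2 + (norm_H a b \<H> v)\<^sup>2 \<le>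
      C\<^sup>2 * ((norm_H a b \<H> (- (t *\<^sub>R v) - A u))\<^sup>2 + (norm_H a b \<H> (t *\<^sub>R u - A v))\<^sup>2)"
    if "u \<in> D" "v \<in> D" for t u v
    unfolding N using main[OF that, of t] by (simp add: distrib_right add_increasing2)
  ultimately show ?thesis
    using that by blast
qed

end

section \<open>Exponential stability\<close>

theorem theorem5p1:
  fixes a b m M\<^sub>0 c \<eta> :: real
    and P\<^sub>0 P\<^sub>1 :: "real^'n^'n"
    and \<H> :: "real \<Rightarrow> real^'n^'n"
    and D :: "(real^'n) L2 set"
    and A :: "(real^'n) L2 \<Rightarrow> (real^'n) L2"
    and \<Phi> :: "real \<Rightarrow> real \<Rightarrow> complex^'n^'n"
  assumes "a < b"
    and "transpose P\<^sub>1 = P\<^sub>1" and "invertible P\<^sub>1"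
    and "P\<^sub>0 = - transpose P\<^sub>0"
    and "\<H> \<in> borel_measurable (lebesgue_on {a<..<b})"
    and "m > 0" and "M\<^sub>0 > 0"
    and "\<And>x. x \<in> {a<..<b} \<Longrightarrow>
           transpose (\<H> x) = \<H> x \<and> matrix_le (mat m) (\<H> x) \<and> matrix_le (\<H> x) (mat M\<^sub>0)"
    and "linear_operator (L2_on a b) D A"
    and "\<And>u. u \<in> D \<Longrightarrow> \<exists>w\<in>L2_on a b. weak_derivative a b (mult_on a b \<H> u) w \<and>
           A u = mult_on a b (\<lambda>_. P\<^sub>1) w + mult_on a b (\<lambda>_. P\<^sub>0) (mult_on a b \<H> u)"
    and "{u \<in> L2_on a b. mult_on a b \<H> u \<in> H1_0 a b} \<subseteq> D"
    and "D \<subseteq> {u \<in> L2_on a b. mult_on a b \<H> u \<in> H1 a b}"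
    and "\<And>t. fundamental_solution a b
           (\<lambda>x. cmat (matrix_inv P\<^sub>1) **
              (mat (\<i> * complex_of_real t) ** cmat (matrix_inv (\<H> x)) - cmat P\<^sub>0)) (\<Phi> t)"
    and "bdd_above {onorm ((*v) (\<Phi> t x)) | t x. x \<in> {a<..<b}}"
    and "\<exists>S. contraction_semigroup (L2_on a b) (norm_H a b \<H>) S \<and>
           generator_of (L2_on a b) (norm_H a b \<H>) D A S"
    and "c > 0" and "\<eta> \<in> {a, b}"
    and "\<And>u. u \<in> D \<Longrightarrow>
           inner_H a b \<H> u (A u) \<le> - c * (norm (point_eval a b (mult_on a b \<H> u) \<eta>))\<^sup>2"
  shows "\<exists>S. C0_semigroup (L2_on a b) (norm_H a b \<H>) S \<and>
           exponentially_stable (L2_on a b) (norm_H a b \<H>) S \<and>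
           generator_of (L2_on a b) (norm_H a b \<H>) D A S"
proof -
  have scalar: "(mat r *v v) \<bullet> v = r * (norm v)\<^sup>2" for r :: real and v :: "real^'n"
    by (simp add: mat_vector scalar_mult_eq_scaleR power2_norm_eq_inner)
  interpret energy_density a b m M\<^sub>0 \<H>
  proof
    fix x :: real and v :: "real^'n" assume x: "x \<in> {a<..<b}"
    show "transpose (\<H> x) = \<H> x"
      using assms(8)[OF x] by simp
    have "0 \<le> ((\<H> x - mat m) *v v) \<bullet> v" "0 \<le> ((mat M\<^sub>0 - \<H> x) *v v) \<bullet> v"
      using assms(8)[OF x] by (auto simp: matrix_le_def pos_semidef_def)
    then show "m * (norm v)\<^sup>2 \<le> (\<H> x *v v) \<bullet> v" "(\<H> x *v v) \<bullet> v \<le> M\<^sub>0 * (norm v)\<^sup>2"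
      by (simp_all add: matrix_vector_mult_diff_rdistrib inner_diff_left scalar)
  qed (rule assms(1,5,6))+
  interpret E: semi_inner "inner_H a b \<H>"
    by (rule semi_inner_H)
  have N: "norm_H a b \<H> = E.seminorm"
    by (simp add: fun_eq_iff norm_H_def E.seminorm_def)
  obtain S where S: "contraction_semigroup (L2_on a b) (norm_H a b \<H>) S"
    "generator_of (L2_on a b) (norm_H a b \<H>) D A S"
    using assms(15) by blast
  obtain C where C: "C > 0" "\<And>t u v. u \<in> D \<Longrightarrow> v \<in> D \<Longrightarrow>
      (norm_H a b \<H> u)\<^sup>2 + (norm_H a b \<H> v)\<^sup>2 \<le>
      C\<^sup>2 * ((norm_H a b \<H> (- (t *\<^sub>R v) - A u))\<^sup>2 + (norm_H a b \<H> (t *\<^sub>R u - A v))\<^sup>2)"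
    using imaginary_resolvent_bound[OF assms(2,3,4,9,10,13,14,16,17,18)] by blast
  have dense: "\<exists>v\<in>D. norm_H a b \<H> (u - v) < e" if "u \<in> L2_on a b" "e > 0" for u e
    using H1_0_preimage_dense[OF that] assms(11) by blast
  have "exponentially_stable (L2_on a b) (norm_H a b \<H>) S"
    using E.contraction_semigroup_exponentially_stable[OF S[unfolded N] assms(9) dense[unfolded N] C[unfolded N]]
    unfolding N by blast
  moreover have "C0_semigroup (L2_on a b) (norm_H a b \<H>) S"
    using S(1) by (simp add: contraction_semigroup_def)
  ultimately show ?thesis
    using S(2) by blast
qed

end
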